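(* Let $D$ be the classifying space of a simply connected Calabi-Yau threefold $X$ with $n=\dim H^1(X,T_X)$, and let $U\subset D$ be a normal horizontal slice of dimension $n$ with Weil-Petersson Kähler form $\omega_{WP}$. Let $$\omega_1=(n+3)\,\omega_{WP}+\mathrm{Ric}(\omega_{WP}).$$ Then $\omega_1$ is a constant multiple of the Hodge metric of $U$.
   Context: Let $H=H^3(X,\mathbb C)\cong\mathbb C^{2n+2}$, with real structure $H^3(X,\mathbb R)$, and $Q(\xi,\eta)=-\int_X\xi\wedge\eta$, a nondegenerate skew-symmetric form. Classifying space: $D$ is the set of all decompositions $H=\bigoplus_{p+q=3}H^{p,q}$ with $H^{p,q}=\overline{H^{q,p}}$, $\dim H^{3,0}=\dim H^{0,3}=1$, $\dim H^{2,1}=\dim H^{1,2}=n$, satisfying: (i) $Q(H^{p,q},H^{p',q'})=0$ unless $p'=3-p$ and $q'=3-q$; (ii) $(\sqrt{-1})^{p-q}Q(\psi,\bar\psi)>0$ for $0\ne\psi\in H^{p,q}$. Equivalently, points of $D$ are filtrations $0\subset F^3\subset F^2\subset F^1\subset H$ with $F^p=\bigoplus_{r\ge p}H^{r,3-r}$. $D=G/V$ is a homogeneous complex manifold, where $G\cong Sp(n+1,\mathbb R)$ is the group of real automorphisms of $(H,Q)$ and $V$ is the compact stabilizer of a point. The tautological bundle with fibre $F^p$ is denoted $\underline F^p$. Horizontal slices: the horizontal distribution is $T_h(D)=\{Y\in T(D): YF^3\subset F^2,\ YF^2\subset F^1\}$, where the holomorphic tangent bundle $T(D)$ is viewed inside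 $\mathrm{Hom}(H,H)$. A horizontal slice is a complex integral submanifold of $T_h(D)$. For a nonzero local holomorphic section $\Omega$ of $\underline F^3$ put $\sigma=-\frac{\sqrt{-1}}2\partial\bar\partial\log|Q(\Omega,\bar\Omega)|$. A horizontal slice $U$ is called normal if $\sigma|_U$ is positive definite at every point, and then $\omega_{WP}=\sigma|_U$ is its Weil-Petersson metric (Kähler form). For a Kähler form $\frac{\sqrt{-1}}2g_{i\bar j}dz^i\wedge d\bar z^j$, $\mathrm{Ric}$ is the form $-\frac{\sqrt{-1}}2\partial\bar\partial\log\det(g_{i\bar j})$. Invariant Hermitian metric and Hodge metric: let $K\supset V$ be the maximal connected compact subgroup of $G$ containing $V$, $\mathfrak g=\mathfrak k\oplus\mathfrak p$ the Cartan decomposition, $B$ the Killing form. Give $\mathfrak g$ the inner product equal to $-B$ on $\mathfrak k$, $B$ on $\mathfrak p$, with $\mathfrak k\perp\mathfrak p$; restrict it to the orthogonal complement of $\mathfrak v=\mathrm{Lie}(V)$, identified with the tangent space of $D$ at $eV$, and translate by $G$. This is the invariant Hermitian metric of $D$; let $\omega_D$ be its fundamental $(1,1)$-form. The Hodge metric of $U$ is $\omega_D|_U$. *)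

theory Defs
  imports "HOL-Analysis.Analysis"
begin

text \<open>
  The cohomology \<open>H\<close> is \<open>complex^'m\<close>, its real structure is the standard one (real vectors),
  and \<open>Q\<close> is an arbitrary nondegenerate skew form defined over the reals.  The threefold enters
  the classifying space only through these data and through the number \<open>n\<close>.
\<close>

definition cnj_vec :: "complex^'m \<Rightarrow> complex^'m"
  where "cnj_vec v = (\<chi> i. cnj (v $ i))"

definition complexify :: "real^'m^'m \<Rightarrow> complex^'m^'m"
  where "complexify g = (\<chi> i j. complex_of_real (g $ i $ j))"

definition polarization :: "(complex^'m \<Rightarrow> complex^'m \<Rightarrow> complex) \<Rightarrow> bool"
  where "polarization Q \<longleftrightarrow>
    (\<forall>u. Vector_Spaces.linear (*s) (*) (Q u)) \<and>
    (\<forall>u w. Q u w = - Q w u) \<and>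
    (\<forall>u w. Q (cnj_vec u) (cnj_vec w) = cnj (Q u w)) \<and>
    (\<forall>u. u \<noteq> 0 \<longrightarrow> (\<exists>w. Q u w \<noteq> 0))"


section \<open>The classifying space\<close>

text \<open>
  A Hodge decomposition is stored as \<open>x p = H\<^sup>p\<^sup>,\<^sup>3\<^sup>-\<^sup>p\<close>; for \<open>p > 3\<close> the junk value is \<open>{0}\<close>,
  so that a point is determined by its decomposition.
\<close>

type_synonym 'm hodge = "nat \<Rightarrow> (complex^'m) set"

definition classifying_space ::
    "nat \<Rightarrow> (complex^'m \<Rightarrow> complex^'m \<Rightarrow> complex) \<Rightarrow> 'm::finite hodge set"
  where "classifying_space n Q = {x.
    (\<forall>p. vec.subspace (x p)) \<and> (\<forall>p>3. x p = {0}) \<and>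
    (\<forall>v. \<exists>!f. (\<forall>p. f p \<in> x p) \<and> v = (\<Sum>p\<le>3. f p)) \<and>
    (\<forall>p\<le>3. x p = cnj_vec ` x (3 - p)) \<and>
    vec.dim (x 3) = 1 \<and> vec.dim (x 2) = n \<and> vec.dim (x 1) = n \<and> vec.dim (x 0) = 1 \<and>
    (\<forall>p\<le>3. \<forall>p'\<le>3. p' \<noteq> 3 - p \<longrightarrow> (\<forall>u \<in> x p. \<forall>w \<in> x p'. Q u w = 0)) \<and>
    (\<forall>p\<le>3. \<forall>\<psi> \<in> x p. \<psi> \<noteq> 0 \<longrightarrow>
       (let a = \<i> powi (int p - int (3 - p)) * Q \<psi> (cnj_vec \<psi>) in Im a = 0 \<and> Re a > 0))}"

definition Fil :: "'m::finite hodge \<Rightarrow> nat \<Rightarrow> (complex^'m) set"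
  where "Fil x p = vec.span (\<Union>r\<in>{p..3}. x r)"

text \<open>
  The holomorphic tangent space of \<open>D\<close> at \<open>x\<close> inside \<open>Hom(H,H)\<close>: the infinitesimal complex
  automorphisms of \<open>Q\<close> that lower the Hodge type strictly.  They are a complement, in the
  complexified Lie algebra, of the stabiliser of the filtration.
\<close>

definition tangent_space ::
    "(complex^'m \<Rightarrow> complex^'m \<Rightarrow> complex) \<Rightarrow> 'm::finite hodge \<Rightarrow> (complex^'m^'m) set"
  where "tangent_space Q x = {Y.
    (\<forall>u w. Q (Y *v u) w + Q u (Y *v w) = 0) \<and>
    (\<forall>p\<le>3. \<forall>u \<in> x p. Y *v u \<in> vec.span (\<Union>r\<in>{..<p}. x r))}"

definition horizontal_space ::
    "(complex^'m \<Rightarrow> complex^'m \<Rightarrow> complex) \<Rightarrow> 'm::finite hodge \<Rightarrow> (complex^'m^'m) set"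
  where "horizontal_space Q x = {Y \<in> tangent_space Q x.
    (\<forall>u \<in> Fil x 3. Y *v u \<in> Fil x 2) \<and> (\<forall>u \<in> Fil x 2. Y *v u \<in> Fil x 1)}"


section \<open>Holomorphic maps into the classifying space\<close>

definition holo_on :: "(complex^'a \<Rightarrow> complex^'b) \<Rightarrow> (complex^'a) set \<Rightarrow> bool"
  where "holo_on f W \<longleftrightarrow>
    (\<forall>z\<in>W. \<exists>f'. (f has_derivative f') (at z) \<and> Vector_Spaces.linear (*s) (*s) f')"

text \<open>\<open>s\<close> is a holomorphic section over \<open>N\<close> of the pull-back under \<open>\<phi>\<close> of the tautological
  bundle with fibre \<open>F\<^sup>p\<close>.\<close>

definition hol_section ::
    "(complex^'n \<Rightarrow> 'm::finite hodge) \<Rightarrow> nat \<Rightarrow> (complex^'n) set \<Rightarrow> (complex^'n \<Rightarrow> complex^'m) \<Rightarrow> bool"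
  where "hol_section \<phi> p N s \<longleftrightarrow> open N \<and> holo_on s N \<and> (\<forall>z\<in>N. s z \<in> Fil (\<phi> z) p)"

text \<open>
  The complex structure of \<open>D\<close> is the one of the flag manifold: a map into \<open>D\<close> is holomorphic
  iff the pulled-back bundles \<open>F\<^sup>p\<close> are locally generated by holomorphic sections (their rank is
  constant on \<open>D\<close>, so this makes them holomorphic subbundles of the trivial bundle \<open>H\<close>).
\<close>

definition holo_into_D ::
    "nat \<Rightarrow> (complex^'m \<Rightarrow> complex^'m \<Rightarrow> complex) \<Rightarrow> (complex^'n) set \<Rightarrow>
     (complex^'n \<Rightarrow> 'm::finite hodge) \<Rightarrow> bool"
  where "holo_into_D n Q W \<phi> \<longleftrightarrow> \<phi> ` W \<subseteq> classifying_space n Q \<and>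
    (\<forall>z\<in>W. \<forall>p\<in>{1..3}. \<exists>N S. z \<in> N \<and> N \<subseteq> W \<and> finite S \<and> (\<forall>s\<in>S. hol_section \<phi> p N s) \<and>
       open N \<and> (\<forall>w\<in>N. Fil (\<phi> w) p = vec.span ((\<lambda>s. s w) ` S)))"

text \<open>
  The differential of \<open>\<phi>\<close> at \<open>z\<close> in direction \<open>v\<close>, as an element \<open>Y\<close> of \<open>Hom(H,H)\<close>: modulo \<open>F\<^sup>p\<close>,
  differentiating a section of \<open>F\<^sup>p\<close> is applying \<open>Y\<close> to its value.
\<close>

definition differential ::
    "(complex^'m \<Rightarrow> complex^'m \<Rightarrow> complex) \<Rightarrow> (complex^'n) set \<Rightarrow> (complex^'n \<Rightarrow> 'm::finite hodge) \<Rightarrow>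
     complex^'n \<Rightarrow> complex^'n \<Rightarrow> complex^'m^'m"
  where "differential Q W \<phi> z v = (THE Y. Y \<in> tangent_space Q (\<phi> z) \<and>
    (\<forall>p\<in>{1..3}. \<forall>N s. z \<in> N \<and> N \<subseteq> W \<and> hol_section \<phi> p N s \<longrightarrow>
       frechet_derivative s (at z) v - Y *v s z \<in> Fil (\<phi> z) p))"


section \<open>Horizontal slices\<close>

definition horizontal_chart ::
    "nat \<Rightarrow> (complex^'m \<Rightarrow> complex^'m \<Rightarrow> complex) \<Rightarrow> (complex^'n) set \<Rightarrow>
     (complex^'n \<Rightarrow> 'm::finite hodge) \<Rightarrow> bool"
  where "horizontal_chart n Q W \<phi> \<longleftrightarrow>
    open W \<and> inj_on \<phi> W \<and> holo_into_D n Q W \<phi> \<and>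
    (\<forall>z\<in>W. inj (differential Q W \<phi> z) \<and> range (differential Q W \<phi> z) \<subseteq> horizontal_space Q (\<phi> z))"

text \<open>
  A slice is a subset \<open>U\<close> of \<open>D\<close> with an atlas of injective holomorphic horizontal immersions
  (inverses of coordinate charts) from open sets of \<open>complex^'n\<close> and holomorphic transition maps.
  The topology of \<open>U\<close> is the one of the atlas, so immersed submanifolds are included.
\<close>

definition horizontal_slice ::
    "nat \<Rightarrow> (complex^'m \<Rightarrow> complex^'m \<Rightarrow> complex) \<Rightarrow> 'm::finite hodge set \<Rightarrow>
     ((complex^'n) set \<times> (complex^'n \<Rightarrow> 'm hodge)) set \<Rightarrow> bool"
  where "horizontal_slice n Q U \<A> \<longleftrightarrow>
    (\<forall>(W, \<phi>)\<in>\<A>. horizontal_chart n Q W \<phi>) \<and>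
    U = (\<Union>(W, \<phi>)\<in>\<A>. \<phi> ` W) \<and>
    (\<forall>(W, \<phi>)\<in>\<A>. \<forall>(W', \<phi>')\<in>\<A>. open {z \<in> W. \<phi> z \<in> \<phi>' ` W'} \<and>
       holo_on (\<lambda>z. inv_into W' \<phi>' (\<phi> z)) {z \<in> W. \<phi> z \<in> \<phi>' ` W'})"


section \<open>Weil-Petersson metric and Ricci form\<close>

definition wirt :: "'n \<Rightarrow> (complex^'n \<Rightarrow> complex) \<Rightarrow> complex^'n \<Rightarrow> complex"
  where "wirt i f z =
    (frechet_derivative f (at z) (axis i 1) - \<i> * frechet_derivative f (at z) (axis i \<i>)) / 2"

definition wirt_bar :: "'n \<Rightarrow> (complex^'n \<Rightarrow> complex) \<Rightarrow> complex^'n \<Rightarrow> complex"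
  where "wirt_bar i f z =
    (frechet_derivative f (at z) (axis i 1) + \<i> * frechet_derivative f (at z) (axis i \<i>)) / 2"

text \<open>The matrix of second derivatives with respect to \<open>z\<^sub>i\<close> and the conjugate of \<open>z\<^sub>j\<close>.\<close>

definition levi :: "(complex^'n \<Rightarrow> complex) \<Rightarrow> complex^'n \<Rightarrow> complex^'n^'n"
  where "levi f z = (\<chi> i j. wirt i (wirt_bar j f) z)"

text \<open>The form \<open>(\<i>/2) \<Sum> h\<^sub>i\<^sub>j dz\<^sub>i \<and> d(cnj z\<^sub>j)\<close>, evaluated on two tangent vectors.\<close>

definition form11 :: "complex^'n^'n \<Rightarrow> complex^'n \<Rightarrow> complex^'n \<Rightarrow> complex"
  where "form11 h v w =
    \<i> / 2 * (\<Sum>i\<in>UNIV. \<Sum>j\<in>UNIV. h $ i $ j * (v $ i * cnj (w $ j) - w $ i * cnj (v $ j)))"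

definition positive_definite :: "complex^'n^'n \<Rightarrow> bool"
  where "positive_definite h \<longleftrightarrow> (\<forall>v. v \<noteq> 0 \<longrightarrow>
    (let a = (\<Sum>i\<in>UNIV. \<Sum>j\<in>UNIV. h $ i $ j * v $ i * cnj (v $ j)) in Im a = 0 \<and> Re a > 0))"

text \<open>
  The coefficients \<open>g\<^sub>i\<^sub>j\<close> of \<open>\<sigma> = (\<i>/2) \<Sum> g\<^sub>i\<^sub>j dz\<^sub>i \<and> d(cnj z\<^sub>j)\<close> in a chart.  The value does not
  depend on the chosen section.
\<close>

definition local_Omega ::
    "(complex^'n) set \<Rightarrow> (complex^'n \<Rightarrow> 'm::finite hodge) \<Rightarrow> complex^'n \<Rightarrow> complex^'n \<Rightarrow> complex^'m"
  where "local_Omega W \<phi> z = (SOME \<Omega>. \<exists>N. z \<in> N \<and> N \<subseteq> W \<and> hol_section \<phi> 3 N \<Omega> \<and>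
    (\<forall>w\<in>N. \<Omega> w \<noteq> 0))"

definition wp_coeff ::
    "(complex^'m \<Rightarrow> complex^'m \<Rightarrow> complex) \<Rightarrow> (complex^'n) set \<Rightarrow> (complex^'n \<Rightarrow> 'm::finite hodge) \<Rightarrow>
     complex^'n \<Rightarrow> complex^'n^'n"
  where "wp_coeff Q W \<phi> z = (let \<Omega> = local_Omega W \<phi> z in
    - levi (\<lambda>w. complex_of_real (ln (cmod (Q (\<Omega> w) (cnj_vec (\<Omega> w)))))) z)"

definition ricci_coeff :: "(complex^'n \<Rightarrow> complex^'n^'n) \<Rightarrow> complex^'n \<Rightarrow> complex^'n^'n"
  where "ricci_coeff g z = - levi (\<lambda>w. ln (det (g w))) z"

definition normal_horizontal_slice ::
    "nat \<Rightarrow> (complex^'m \<Rightarrow> complex^'m \<Rightarrow> complex) \<Rightarrow> 'm::finite hodge set \<Rightarrow>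
     ((complex^'n) set \<times> (complex^'n \<Rightarrow> 'm hodge)) set \<Rightarrow> bool"
  where "normal_horizontal_slice n Q U \<A> \<longleftrightarrow> horizontal_slice n Q U \<A> \<and>
    (\<forall>(W, \<phi>)\<in>\<A>. \<forall>z\<in>W. positive_definite (wp_coeff Q W \<phi> z))"

definition omega_WP ::
    "(complex^'m \<Rightarrow> complex^'m \<Rightarrow> complex) \<Rightarrow> (complex^'n) set \<Rightarrow> (complex^'n \<Rightarrow> 'm::finite hodge) \<Rightarrow>
     complex^'n \<Rightarrow> complex^'n \<Rightarrow> complex^'n \<Rightarrow> complex"
  where "omega_WP Q W \<phi> z = form11 (wp_coeff Q W \<phi> z)"

definition Ric_WP ::
    "(complex^'m \<Rightarrow> complex^'m \<Rightarrow> complex) \<Rightarrow> (complex^'n) set \<Rightarrow> (complex^'n \<Rightarrow> 'm::finite hodge) \<Rightarrow>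
     complex^'n \<Rightarrow> complex^'n \<Rightarrow> complex^'n \<Rightarrow> complex"
  where "Ric_WP Q W \<phi> z = form11 (ricci_coeff (wp_coeff Q W \<phi>) z)"

definition omega_1 ::
    "nat \<Rightarrow> (complex^'m \<Rightarrow> complex^'m \<Rightarrow> complex) \<Rightarrow> (complex^'n) set \<Rightarrow>
     (complex^'n \<Rightarrow> 'm::finite hodge) \<Rightarrow> complex^'n \<Rightarrow> complex^'n \<Rightarrow> complex^'n \<Rightarrow> complex"
  where "omega_1 n Q W \<phi> z v w = of_nat (n + 3) * omega_WP Q W \<phi> z v w + Ric_WP Q W \<phi> z v w"


section \<open>The groups and Lie algebras\<close>

definition matrix_subgroup :: "(real^'m^'m) set \<Rightarrow> bool"
  where "matrix_subgroup S \<longleftrightarrow> mat 1 \<in> S \<and> (\<forall>g\<in>S. \<forall>h\<in>S. g ** h \<in> S) \<and>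
    (\<forall>g\<in>S. invertible g \<and> matrix_inv g \<in> S)"

definition aut_group :: "(complex^'m \<Rightarrow> complex^'m \<Rightarrow> complex) \<Rightarrow> (real^'m^'m) set"
  where "aut_group Q =
    {g. invertible g \<and> (\<forall>u w. Q (complexify g *v u) (complexify g *v w) = Q u w)}"

definition act :: "real^'m^'m \<Rightarrow> 'm::finite hodge \<Rightarrow> 'm hodge"
  where "act g x = (\<lambda>p. (\<lambda>u. complexify g *v u) ` x p)"

definition stabilizer ::
    "(complex^'m \<Rightarrow> complex^'m \<Rightarrow> complex) \<Rightarrow> 'm::finite hodge \<Rightarrow> (real^'m^'m) set"
  where "stabilizer Q x\<^sub>0 = {g \<in> aut_group Q. act g x\<^sub>0 = x\<^sub>0}"

definition max_compact ::
    "(complex^'m \<Rightarrow> complex^'m \<Rightarrow> complex) \<Rightarrow> 'm::finite hodge \<Rightarrow> (real^'m^'m) set"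
  where "max_compact Q x\<^sub>0 =
    (let cc = {K. matrix_subgroup K \<and> compact K \<and> connected K \<and>
                  stabilizer Q x\<^sub>0 \<subseteq> K \<and> K \<subseteq> aut_group Q}
     in THE K. K \<in> cc \<and> (\<forall>K'\<in>cc. K \<subseteq> K' \<longrightarrow> K' = K))"

text \<open>\<open>A\<close> belongs to the Lie algebra iff its one-parameter group \<open>\<gamma> t = exp (t A)\<close> stays in \<open>S\<close>.\<close>

definition lie_alg :: "(real^'m^'m) set \<Rightarrow> (real^'m^'m) set"
  where "lie_alg S = {A. \<exists>\<gamma> :: real \<Rightarrow> real^'m^'m. \<gamma> 0 = mat 1 \<and>
    (\<forall>t. (\<gamma> has_vector_derivative \<gamma> t ** A) (at t)) \<and> (\<forall>t. \<gamma> t \<in> S)}"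

definition bracket :: "real^'m^'m \<Rightarrow> real^'m^'m \<Rightarrow> real^'m^'m"
  where "bracket A C = A ** C - C ** A"

text \<open>The trace of an endomorphism \<open>T\<close> of the subspace \<open>S\<close>; it does not depend on the basis.\<close>

definition trace_on :: "'v::real_vector set \<Rightarrow> ('v \<Rightarrow> 'v) \<Rightarrow> real"
  where "trace_on S T = (let E = (SOME E. independent E \<and> span E = S)
    in \<Sum>b\<in>E. representation E (T b) b)"

definition killing_form ::
    "(complex^'m \<Rightarrow> complex^'m \<Rightarrow> complex) \<Rightarrow> real^'m^'m \<Rightarrow> real^'m^'m \<Rightarrow> real"
  where "killing_form Q X Y = trace_on (lie_alg (aut_group Q)) (\<lambda>Z. bracket X (bracket Y Z))"

text \<open>The \<open>\<pp>\<close> of the Cartan decomposition is the Killing-orthogonal complement of \<open>\<kk>\<close>.\<close>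

definition cartan_k ::
    "(complex^'m \<Rightarrow> complex^'m \<Rightarrow> complex) \<Rightarrow> 'm::finite hodge \<Rightarrow> (real^'m^'m) set"
  where "cartan_k Q x\<^sub>0 = lie_alg (max_compact Q x\<^sub>0)"

definition cartan_p ::
    "(complex^'m \<Rightarrow> complex^'m \<Rightarrow> complex) \<Rightarrow> 'm::finite hodge \<Rightarrow> (real^'m^'m) set"
  where "cartan_p Q x\<^sub>0 =
    {X \<in> lie_alg (aut_group Q). \<forall>A \<in> cartan_k Q x\<^sub>0. killing_form Q X A = 0}"

definition k_part ::
    "(complex^'m \<Rightarrow> complex^'m \<Rightarrow> complex) \<Rightarrow> 'm::finite hodge \<Rightarrow> real^'m^'m \<Rightarrow> real^'m^'m"
  where "k_part Q x\<^sub>0 X = (THE A. A \<in> cartan_k Q x\<^sub>0 \<and> X - A \<in> cartan_p Q x\<^sub>0)"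

definition cartan_inner ::
    "(complex^'m \<Rightarrow> complex^'m \<Rightarrow> complex) \<Rightarrow> 'm::finite hodge \<Rightarrow> real^'m^'m \<Rightarrow> real^'m^'m \<Rightarrow> real"
  where "cartan_inner Q x\<^sub>0 X Y =
    - killing_form Q (k_part Q x\<^sub>0 X) (k_part Q x\<^sub>0 Y)
    + killing_form Q (X - k_part Q x\<^sub>0 X) (Y - k_part Q x\<^sub>0 Y)"


section \<open>The invariant Hermitian metric and the Hodge metric\<close>

definition v_perp ::
    "(complex^'m \<Rightarrow> complex^'m \<Rightarrow> complex) \<Rightarrow> 'm::finite hodge \<Rightarrow> (real^'m^'m) set"
  where "v_perp Q x\<^sub>0 =
    {\<xi> \<in> lie_alg (aut_group Q). \<forall>A \<in> lie_alg (stabilizer Q x\<^sub>0). cartan_inner Q x\<^sub>0 \<xi> A = 0}"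

text \<open>
  The identification of the tangent space at \<open>x\<^sub>0\<close> with \<open>v_perp\<close>: \<open>\<xi>\<close> corresponds to \<open>Y\<close> iff the
  curve \<open>exp (t \<xi>) x\<^sub>0\<close> has velocity \<open>Y\<close>, i.e. \<open>\<xi>\<close> and \<open>Y\<close> induce the same maps \<open>F\<^sup>p \<rightarrow> H / F\<^sup>p\<close>.
\<close>

definition real_tangent ::
    "(complex^'m \<Rightarrow> complex^'m \<Rightarrow> complex) \<Rightarrow> 'm::finite hodge \<Rightarrow> complex^'m^'m \<Rightarrow> real^'m^'m"
  where "real_tangent Q x\<^sub>0 Y = (THE \<xi>. \<xi> \<in> v_perp Q x\<^sub>0 \<and>
    (\<forall>p\<in>{1..3}. \<forall>u \<in> Fil x\<^sub>0 p. (complexify \<xi> - Y) *v u \<in> Fil x\<^sub>0 p))"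

text \<open>
  \<open>D\<close> is \<open>G/V\<close> with base point \<open>x\<^sub>0\<close>.  A tangent vector \<open>Y\<close> at \<open>x = g x\<^sub>0\<close> is moved back to \<open>x\<^sub>0\<close> by
  \<open>g\<close>, which acts on \<open>Hom(H,H)\<close> by conjugation; the result does not depend on the choice of \<open>g\<close>.
\<close>

definition invariant_metric ::
    "(complex^'m \<Rightarrow> complex^'m \<Rightarrow> complex) \<Rightarrow> 'm::finite hodge \<Rightarrow> 'm hodge \<Rightarrow>
     complex^'m^'m \<Rightarrow> complex^'m^'m \<Rightarrow> real"
  where "invariant_metric Q x\<^sub>0 x Y Z =
    (let g = (SOME g. g \<in> aut_group Q \<and> act g x\<^sub>0 = x);
         pull = (\<lambda>Y. real_tangent Q x\<^sub>0 (complexify (matrix_inv g) ** Y ** complexify g))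
     in cartan_inner Q x\<^sub>0 (pull Y) (pull Z))"

text \<open>Fundamental form of a Hermitian metric with real part \<open>\<rho>\<close>: \<open>\<rho> (J Y) Z\<close>, where the complex
  structure \<open>J\<close> is multiplication by \<open>\<i>\<close> on the holomorphic tangent space.\<close>

definition omega_D ::
    "(complex^'m \<Rightarrow> complex^'m \<Rightarrow> complex) \<Rightarrow> 'm::finite hodge \<Rightarrow> 'm hodge \<Rightarrow>
     complex^'m^'m \<Rightarrow> complex^'m^'m \<Rightarrow> real"
  where "omega_D Q x\<^sub>0 x Y Z = invariant_metric Q x\<^sub>0 x (mat \<i> ** Y) Z"

definition hodge_form ::
    "(complex^'m \<Rightarrow> complex^'m \<Rightarrow> complex) \<Rightarrow> 'm::finite hodge \<Rightarrow>
     (complex^'n) set \<Rightarrow> (complex^'n \<Rightarrow> 'm hodge) \<Rightarrow> complex^'n \<Rightarrow> complex^'n \<Rightarrow> complex^'n \<Rightarrow> real"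
  where "hodge_form Q x\<^sub>0 W \<phi> z v w =
    omega_D Q x\<^sub>0 (\<phi> z) (differential Q W \<phi> z v) (differential Q W \<phi> z w)"

end

theory Submission
  imports Defs "HOL-Complex_Analysis.Cauchy_Integral_Formula"
begin

text \<open>
  A unitary basis of \<open>H\<^sup>3\<^sup>,\<^sup>0 \<oplus> H\<^sup>1\<^sup>,\<^sup>2\<close> for \<open>\<langle>u, w\<rangle> = - \<i> Q(u, cnj w)\<close>, together with its conjugate, is a basis of
  \<open>H\<close> adapted to the decomposition; \<open>G\<close> permutes these bases transitively.  The Weil operator
  (\<open>\<i>\<close> on \<open>H\<^sup>3\<^sup>,\<^sup>0 \<oplus> H\<^sup>1\<^sup>,\<^sup>2\<close> and \<open>-\<i>\<close> on its conjugate) lies in \<open>V\<close>.  A compact group containing it is closed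
  under adjoints for the positive form that it defines, hence consists of isometries; so \<open>K\<close> is its centraliser.
  The Killing form is a positive multiple of the trace form, horizontal vectors lie in \<open>\<pp> \<otimes> \<complex>\<close>, and therefore
  the Hodge form of \<open>Y\<close>, \<open>Z\<close> is a negative multiple of \<open>Im tr(Y cnj Z)\<close>.

  On the slice, horizontality turns \<open>u\<^sub>i = \<partial>\<^sub>i \<Omega>\<close> into sections of \<open>F\<^sup>2\<close>.  Normalise \<open>\<Omega>\<close> by \<open>\<langle>\<Omega>(w), \<Omega>(z)\<rangle> = 1\<close>; then at \<open>z\<close>
  the metric is \<open>g\<^sub>i\<^sub>j = - \<langle>u\<^sub>i, u\<^sub>j\<rangle>\<close> and the second derivatives of \<open>log det g\<close> give
  \<open>(n + 3) g\<^sub>k\<^sub>l + Ric\<^sub>k\<^sub>l = 2 g\<^sub>k\<^sub>l + \<Sum> g\<^sup>i\<^sup>j \<langle>Y\<^sub>k u\<^sub>i, Y\<^sub>l u\<^sub>j\<rangle>\<close>, where \<open>Y\<^sub>k\<close> is the differential of the chart.  This is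
  \<open>tr(Y\<^sub>k cnj Y\<^sub>l)\<close>: the blocks \<open>H\<^sup>3\<^sup>,\<^sup>0 \<rightarrow> H\<^sup>2\<^sup>,\<^sup>1\<close> and \<open>H\<^sup>1\<^sup>,\<^sup>2 \<rightarrow> H\<^sup>0\<^sup>,\<^sup>3\<close> are dual and contribute \<open>g\<^sub>k\<^sub>l\<close> each, the block
  \<open>H\<^sup>2\<^sup>,\<^sup>1 \<rightarrow> H\<^sup>1\<^sup>,\<^sup>2\<close> contributes the sum.
\<close>


section \<open>Holomorphic functions of several variables\<close>

text \<open>Holomorphy means only that a complex-linear derivative exists, while the Ricci form
  differentiates sections repeatedly; hence the Cauchy estimates.

  The obstacle in the Ricci computation is the (2,1)-component of the second derivatives of
  \<open>\<Omega>\<close>, which horizontality does not determine. It occurs once in the product of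
  first derivatives of \<open>g\<close> and once in the second derivative of \<open>g\<close>, and
  cancels because the slice has dimension \<open>n\<close>, so that the \<open>u\<^sub>i\<close>
  form a basis of \<open>H\<^sup>2\<^sup>,\<^sup>1\<close>. The Ricci form then contains
  \<open>- (n + 1) g\<close>, with \<open>n\<close> from the trace of the identity and
  \<open>1\<close> from the other pairing of indices; \<open>n + 3\<close> leaves the two copies of
  \<open>g\<close> that the trace requires.

  \<open>K\<close>, the Cartan components and the lift of a tangent vector are definite
  descriptions, so each needs uniqueness. For \<open>K\<close> the centraliser is shown to contain
  every candidate, and it must itself be compact and connected to be one.

  The constant is the inverse of \<open>2 (dim H + 2)\<close>: \<open>dim H + 2\<close> is the ratio
  of Killing form to trace form, \<open>2\<close> comes from the real lift
  \<open>Y + cnj Y\<close>.\<close>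

lemma holomorphic_linear_approx:
  fixes f :: "complex \<Rightarrow> complex"
  assumes hol: "f holomorphic_on ball 0 R" and R: "0 < R"
    and M: "\<And>z. z \<in> ball 0 R \<Longrightarrow> cmod (f z) \<le> M" and h: "cmod h \<le> R / 4"
  shows "cmod (f h - f 0 - h * deriv f 0) \<le> 32 * M / R\<^sup>2 * (cmod h)\<^sup>2"
proof -
  \<comment> \<open>Cauchy's inequality on circles of radius \<open>R/4\<close> about points of
    \<open>cball 0 (R/4)\<close>; they stay inside the ball where \<open>M\<close> bounds
    \<open>f\<close>, and \<open>2 M\<close> divided by the square of \<open>R/4\<close> gives the
    factor 32.\<close>
  have B: "cmod ((deriv ^^ 2) f x) \<le> 32 * M / R\<^sup>2" if x: "x \<in> cball 0 (R/4)" for x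
  proof -
    have sub: "cball x (R/4) \<subseteq> ball 0 R"
    proof
      fix y assume "y \<in> cball x (R/4)"
      then have "cmod (y - x) \<le> R/4" by (simp add: dist_norm norm_minus_commute)
      moreover have "cmod y \<le> cmod (y - x) + cmod x" by (metis diff_add_cancel norm_triangle_ineq)
      ultimately show "y \<in> ball 0 R" using x R by simp
    qed
    have 1: "f holomorphic_on cball x (R/4)" by (rule holomorphic_on_subset[OF hol sub])
    have "cmod ((deriv ^^ 2) f x) \<le> fact 2 * M / (R/4)^2"
    proof (rule Cauchy_inequality)
      show "f holomorphic_on ball x (R/4)" using 1 holomorphic_on_subset ball_subset_cball by blast
      show "continuous_on (cball x (R/4)) f" using 1 holomorphic_on_imp_continuous_on by blast
      show "0 < R/4" using R by simp
      fix y assume "cmod (x - y) = R/4"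
      then have "y \<in> cball x (R/4)" by (simp add: dist_norm)
      then show "cmod (f y) \<le> M" using sub M by blast
    qed
    also have "\<dots> = 32 * M / R\<^sup>2" using R by (simp add: power2_eq_square field_simps)
    finally show ?thesis .
  qed
  have der: "((deriv ^^ i) f has_field_derivative (deriv ^^ (Suc i)) f x) (at x within cball 0 (R/4))"
    if "x \<in> cball 0 (R/4)" for i x
  proof -
    have "x \<in> ball 0 R" using that R by simp
    moreover have "(deriv ^^ i) f holomorphic_on ball 0 R"
      using hol by (rule holomorphic_higher_deriv) auto
    ultimately have "((deriv ^^ i) f has_field_derivative deriv ((deriv ^^ i) f) x) (at x)"
      by (intro holomorphic_derivI[where S="ball 0 R"]) auto
    then show ?thesis by (simp add: has_field_derivative_at_within)
  qed
  have "cmod ((deriv ^^ 0) f h - (\<Sum>i\<le>1. (deriv ^^ i) f 0 * (h - 0) ^ i / fact i))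
      \<le> (32 * M / R\<^sup>2) * cmod (h - 0) ^ Suc 1 / fact 1"
    apply (rule complex_Taylor[where S = "cball 0 (R/4)"])
    using der B h R by (auto simp: numeral_2_eq_2)
  then show ?thesis by (simp add: mult.commute diff_diff_eq power2_eq_square)
qed

text \<open>Only homogeneity over the complex numbers is demanded, since a Frechet derivative is
  additive anyway. The link with \<open>holo_on\<close> is \<open>holo_on_iff\<close>.\<close>

definition cdiff :: "(complex^'n \<Rightarrow> complex) \<Rightarrow> complex^'n \<Rightarrow> bool"
  where "cdiff f z \<longleftrightarrow> (\<exists>f'. (f has_derivative f') (at z) \<and> (\<forall>c v. f' (c *s v) = c * f' v))"

lemma cdiffD:
  assumes "cdiff f z"
  shows "(f has_derivative frechet_derivative f (at z)) (at z)"
    and "frechet_derivative f (at z) (c *s v) = c * frechet_derivative f (at z) v"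
    and "linear (frechet_derivative f (at z))"
proof -
  from assms obtain f' where f': "(f has_derivative f') (at z)" "\<And>c v. f' (c *s v) = c * f' v"
    unfolding cdiff_def by blast
  then show 1: "(f has_derivative frechet_derivative f (at z)) (at z)"
    using frechet_derivative_at by metis
  show "frechet_derivative f (at z) (c *s v) = c * frechet_derivative f (at z) v"
    using f' frechet_derivative_at by metis
  show "linear (frechet_derivative f (at z))" using 1 has_derivative_linear by blast
qed

lemma norm_smult_vec: "norm (c *s v) = cmod c * norm (v::complex^'n)"
  using L2_set_right_distrib[of "cmod c" "\<lambda>i. norm (v $ i)" UNIV] by (simp add: norm_vec_def norm_mult)

lemma cdiff_line:
  assumes "cdiff f (a + s *s v)"
  shows "((\<lambda>s. f (a + s *s v)) has_field_derivative frechet_derivative f (at (a + s *s v)) v) (at s)"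
proof -
  have bl: "bounded_linear (\<lambda>s. s *s v)"
    by (rule bounded_linear_intro[where K="norm v"])
       (auto simp: vec_eq_iff scaleR_conv_of_real[where 'a=complex] algebra_simps norm_smult_vec)
  have "((\<lambda>s. a + s *s v) has_derivative (\<lambda>t. t *s v)) (at s)"
    using bounded_linear.has_derivative[OF bl has_derivative_ident[of "at s"]]
    by (auto intro!: derivative_eq_intros)
  from has_derivative_compose[OF this cdiffD(1)[OF assms]]
  have "((\<lambda>s. f (a + s *s v)) has_derivative (\<lambda>t. frechet_derivative f (at (a + s *s v)) (t *s v))) (at s)" .
  then show ?thesis
    by (simp add: cdiffD(2)[OF assms] has_field_derivative_def mult.commute[of _ "frechet_derivative f (at (a + s *s v)) v"] )
qed

lemma line_in_ball:
  fixes a :: "complex^'n"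
  assumes "a \<in> ball z r" "norm v \<le> 1" "cmod s \<le> t"
  shows "a + s *s v \<in> ball z (r + t)"
proof -
  have "dist z (a + s *s v) \<le> dist z a + norm (s *s v)"
    by (metis add_diff_cancel_left' dist_commute dist_norm dist_triangle)
  also have "norm (s *s v) \<le> t"
    using mult_mono[OF assms(3,2)] norm_ge_zero[of s] assms(3) by (simp add: norm_smult_vec)
  also have "dist z a + t < r + t" using assms by simp
  finally show ?thesis using assms by simp
qed

text \<open>Along complex lines the derivative is a uniform limit of difference quotients, hence holomorphic; its
  own differential is a limit of complex-linear maps, and Taylor's estimate on lines makes it a Frechet
  derivative.\<close>

lemma cdiff_frechet_derivative:
  fixes f :: "complex^'n \<Rightarrow> complex"
  assumes W: "open W" and f: "\<And>z. z \<in> W \<Longrightarrow> cdiff f z" and z0: "z0 \<in> W"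
  shows "cdiff (\<lambda>z. frechet_derivative f (at z) v) z0"
proof -
  define d where "d a w = frechet_derivative f (at a) w" for a w
  \<comment> \<open>Directions are first restricted to the unit ball, so that
    \<open>a + s *s v\<close> with \<open>a\<close> within \<open>r\<close> of \<open>z0\<close> and
    \<open>s\<close> of modulus below \<open>r\<close> stays within \<open>2 r\<close> of
    \<open>z0\<close>. A rescaling at the end removes the restriction.\<close>
  have main: "cdiff (\<lambda>z. d z v) z0" if v: "norm v \<le> 1" for v
  proof -
    obtain r0 where r0: "0 < r0" "cball z0 r0 \<subseteq> W" using W z0 open_contains_cball by blast
    define r where "r = r0 / 2"
    have r: "0 < r" using r0 r_def by simp
    have sub: "ball z0 (r + r) \<subseteq> W" using r0 r_def ball_subset_cball by fastforce
    have "continuous_on W f"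
      using f cdiffD(1) by (meson continuous_at_imp_continuous_on has_derivative_continuous)
    then have "compact (f ` cball z0 r0)"
      by (intro compact_continuous_image compact_cball continuous_on_subset[OF _ r0(2)])
    then obtain M where M0: "\<And>z. z \<in> cball z0 r0 \<Longrightarrow> cmod (f z) \<le> M"
      using compact_imp_bounded bounded_iff by (metis imageI)
    have M: "cmod (f z) \<le> M" if "z \<in> ball z0 (r + r)" for z
      using M0 that r_def by simp
    have lin: "(\<lambda>s. f (a + s *s w)) holomorphic_on ball 0 r" if "a \<in> ball z0 r" "norm w \<le> 1" for a w
      unfolding holomorphic_on_def field_differentiable_def
    proof
      fix s assume "s \<in> ball (0::complex) r"
      then have "a + s *s w \<in> W" using line_in_ball[OF that, of s r] sub by auto
      then show "\<exists>f'. ((\<lambda>s. f (a + s *s w)) has_field_derivative f') (at s within ball 0 r)"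
        using cdiff_line[OF f] has_field_derivative_at_within by blast
    qed
    have dl: "deriv (\<lambda>s. f (a + s *s w)) 0 = d a w" if "a \<in> ball z0 r" "norm w \<le> 1" for a w
    proof -
      have "a \<in> W" using sub that r by auto
      then show ?thesis
        unfolding d_def using DERIV_imp_deriv[OF cdiff_line[of f a 0 w]] f by simp
    qed
    have bnd: "cmod (f (a + s *s w)) \<le> M" if "a \<in> ball z0 r" "norm w \<le> 1" "s \<in> ball 0 r" for a w s
      by (rule M, rule line_in_ball) (use that in auto)
    \<comment> \<open>Step sizes tending to \<open>0\<close>. Below \<open>r / 4\<close> the
      estimate of \<open>holomorphic_linear_approx\<close> applies, and
      \<open>z0 + \<epsilon> k *s v\<close> stays in the ball.\<close>
    define \<epsilon> where "\<epsilon> k = complex_of_real (r / 4 / real (Suc k))" for k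
    have eps: "\<epsilon> k \<noteq> 0" "cmod (\<epsilon> k) \<le> r / 4" "cmod (\<epsilon> k) = r / 4 / real (Suc k)" for k
      using r by (auto simp: \<epsilon>_def norm_divide field_simps simp del: of_real_divide of_nat_Suc)
    define q where "q k a = (f (a + \<epsilon> k *s v) - f a) / \<epsilon> k" for k a
    have qb: "cmod (q k a - d a v) \<le> 32 * M / r\<^sup>2 * cmod (\<epsilon> k)" if a: "a \<in> ball z0 r" for k a
    proof -
      have "cmod (f (a + \<epsilon> k *s v) - f (a + 0 *s v) - \<epsilon> k * deriv (\<lambda>s. f (a + s *s v)) 0)
          \<le> 32 * M / r\<^sup>2 * (cmod (\<epsilon> k))\<^sup>2"
        by (rule holomorphic_linear_approx[OF lin[OF a v] r]) (use bnd[OF a v] eps in auto)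
      then have "cmod (f (a + \<epsilon> k *s v) - f a - \<epsilon> k * d a v) \<le> 32 * M / r\<^sup>2 * (cmod (\<epsilon> k))\<^sup>2"
        by (simp add: dl[OF a v])
      moreover have "q k a - d a v = (f (a + \<epsilon> k *s v) - f a - \<epsilon> k * d a v) / \<epsilon> k"
        using eps(1) by (simp add: q_def field_simps)
      ultimately show ?thesis
        using eps(1)[of k] by (simp add: norm_divide divide_le_eq power2_eq_square mult.assoc)
    qed
    have ul: "uniform_limit (ball z0 r) q (\<lambda>a. d a v) sequentially"
      unfolding uniform_limit_sequentially_iff
    proof (intro allI impI)
      fix e :: real assume e: "e > 0"
      have "(\<lambda>k. 32 * M / r\<^sup>2 * (r / 4 / real (Suc k))) \<longlonglongrightarrow> 32 * M / r\<^sup>2 * 0"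
        by (intro tendsto_intros LIMSEQ_Suc lim_const_over_n)
      then have "(\<lambda>k. 32 * M / r\<^sup>2 * cmod (\<epsilon> k)) \<longlonglongrightarrow> 0" by (simp only: eps(3) mult_zero_right)
      then have "\<exists>N. \<forall>k\<ge>N. 32 * M / r\<^sup>2 * cmod (\<epsilon> k) < e"
        using e by (auto simp only: order_tendsto_iff eventually_sequentially)
      then show "\<exists>N. \<forall>n\<ge>N. \<forall>x\<in>ball z0 r. dist (q n x) (d x v) < e"
        unfolding dist_norm using qb by (meson le_less_trans)
    qed
    have epsv: "z0 + \<epsilon> k *s v \<in> ball z0 r" for k
      using eps(2)[of k] r v mult_mono[OF eps(2)[of k] v] by (simp add: dist_norm norm_smult_vec)
    \<comment> \<open>\<open>G k h\<close> is the derivative of \<open>q k\<close> at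
      \<open>z0\<close> in direction \<open>h\<close>. The \<open>q k\<close> converge uniformly, so
      on every complex line their derivatives converge too; the candidate \<open>L\<close> for the
      differential is the limit of the complex-linear maps \<open>G k\<close>.\<close>
    define G where "G k h = (d (z0 + \<epsilon> k *s v) h - d z0 h) / \<epsilon> k" for k h
    define H where "H h s = d (z0 + s *s h) v" for h s
    have props: "H h holomorphic_on ball 0 r \<and> (\<lambda>k. G k h) \<longlonglongrightarrow> deriv (H h) 0" if h: "norm h \<le> 1" for h
    proof -
      have inb: "z0 + s *s h \<in> ball z0 r" if "s \<in> ball 0 r" for s
      proof -
        have "norm (s *s h) \<le> cmod s * 1" unfolding norm_smult_vec by (intro mult_left_mono h) auto
        then show ?thesis using that by (simp add: dist_norm)
      qed
      have qder: "((\<lambda>s. q k (z0 + s *s h)) has_field_derivative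
          (d (z0 + \<epsilon> k *s v + s *s h) h - d (z0 + s *s h) h) / \<epsilon> k) (at s)" if s: "s \<in> ball 0 r" for k s
      proof -
        have 1: "z0 + \<epsilon> k *s v + s *s h \<in> W"
          using line_in_ball[OF epsv h, of s r] s sub by auto
        have 2: "z0 + s *s h \<in> W" using inb[OF s] sub r by auto
        have e: "z0 + s *s h + \<epsilon> k *s v = z0 + \<epsilon> k *s v + s *s h" for s by simp
        show ?thesis unfolding q_def d_def e
          by (rule DERIV_cdivide, rule DERIV_diff; rule cdiff_line, rule f) (use 1 2 in auto)
      qed
      have ul2: "uniform_limit (ball 0 r) (\<lambda>k s. q k (z0 + s *s h)) (H h) sequentially"
        using ul inb unfolding uniform_limit_sequentially_iff H_def by meson
      have hq: "(\<lambda>s. q k (z0 + s *s h)) holomorphic_on ball 0 r" for k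
        using qder unfolding holomorphic_on_def field_differentiable_def
        using has_field_derivative_at_within by blast
      have hl: "\<exists>d>0. cball x d \<subseteq> ball 0 r \<and> uniform_limit (cball x d) (\<lambda>k s. q k (z0 + s *s h)) (H h) sequentially"
        if "x \<in> ball 0 r" for x
        using that open_contains_cball[of "ball 0 r"] uniform_limit_on_subset[OF ul2] by (metis open_ball)
      have hol: "H h holomorphic_on ball 0 r"
        by (rule holomorphic_uniform_sequence[OF _ hq hl]) auto
      from has_complex_derivative_uniform_sequence[OF open_ball qder hl]
      obtain g' where "\<forall>x\<in>ball 0 r. (H h has_field_derivative g' x) (at x) \<and>
           (\<lambda>k. (d (z0 + \<epsilon> k *s v + x *s h) h - d (z0 + x *s h) h) / \<epsilon> k) \<longlonglongrightarrow> g' x"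
        by blast
      note g' = bspec[OF this]
      have "(H h has_field_derivative g' 0) (at 0)" "(\<lambda>k. G k h) \<longlonglongrightarrow> g' 0"
        using g'[of 0] r by (simp_all add: G_def)
      then show ?thesis using hol by (simp add: DERIV_imp_deriv)
    qed
    have Gsm: "G k (c *s h) = c * G k h" for k c h
    proof -
      have "z0 + \<epsilon> k *s v \<in> W" using epsv[of k] sub r by auto
      then show ?thesis
        using cdiffD(2)[OF f, of "z0 + \<epsilon> k *s v" c h] cdiffD(2)[OF f[OF z0], of c h]
        by (simp add: G_def d_def right_diff_distrib)
    qed
    have Gadd: "G k (h + h') = G k h + G k h'" for k h h'
    proof -
      have "z0 + \<epsilon> k *s v \<in> W" using epsv[of k] sub r by auto
      then have "linear (d (z0 + \<epsilon> k *s v))" "linear (d z0)"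
        unfolding d_def[abs_def] using f z0 cdiffD(3) by blast+
      then show ?thesis by (simp add: G_def linear_add add_divide_distrib diff_divide_distrib)
    qed
    define L where "L h = lim (\<lambda>k. G k h)" for h
    have GL: "(\<lambda>k. G k h) \<longlonglongrightarrow> L h" for h
    proof -
      \<comment> \<open>Adding \<open>1\<close> to the norm makes the rescaling legitimate for
        \<open>h = 0\<close> as well.\<close>
      define c where "c = complex_of_real (norm h + 1)"
      have c: "c \<noteq> 0" unfolding c_def
        by (metis add_nonneg_pos norm_ge_zero of_real_eq_0_iff order_less_irrefl zero_less_one)
      have cc: "cmod c = norm h + 1" unfolding c_def by (metis abs_of_nonneg add_nonneg_nonneg norm_ge_zero norm_of_real zero_le_one)
      have "norm (inverse c *s h) \<le> 1"
        unfolding norm_smult_vec norm_inverse cc by (simp add: field_simps add_pos_nonneg)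
      then have "(\<lambda>k. c * G k (inverse c *s h)) \<longlonglongrightarrow> c * deriv (H (inverse c *s h)) 0"
        using props by (intro tendsto_intros) auto
      moreover have "c * G k (inverse c *s h) = G k h" for k
        using c by (simp only: Gsm mult.assoc[symmetric] right_inverse) simp
      ultimately have "convergent (\<lambda>k. G k h)"
        by (auto simp: convergent_def)
      then show ?thesis unfolding L_def by (simp add: convergent_LIMSEQ_iff)
    qed
    have Lsm: "L (c *s h) = c * L h" for c h
      using LIMSEQ_unique[OF GL[of "c *s h"]] tendsto_mult[OF tendsto_const GL[of h], of c] by (simp add: Gsm)
    have Ladd: "L (h + h') = L h + L h'" for h h'
      using LIMSEQ_unique[OF GL[of "h + h'"]] tendsto_add[OF GL[of h] GL[of h']] by (simp add: Gadd)
    have LH: "L h = deriv (H h) 0" if "norm h \<le> 1" for h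
      using props[OF that] GL LIMSEQ_unique by blast
    have Lscale: "L (t *\<^sub>R h) = t *\<^sub>R L h" for t h
    proof -
      have "t *\<^sub>R h = complex_of_real t *s h" by (simp add: vec_eq_iff scaleR_conv_of_real[where 'a=complex])
      then show ?thesis by (simp add: Lsm scaleR_conv_of_real)
    qed
    have "linear L" by (rule linearI) (use Ladd Lscale in auto)
    then have bl: "bounded_linear L" by (rule linear_conv_bounded_linear[THEN iffD1])
    \<comment> \<open>A bound on the whole ball, obtained from a single difference quotient, so that
      Taylor's estimate applies to \<open>H h\<close> with a constant independent of the direction
      \<open>h\<close>.\<close>
    have db: "cmod (d a v) \<le> 32 * M / r\<^sup>2 * (r/4) + (M + M) / (r/4)" if a: "a \<in> ball z0 r" for a
    proof -
      have e0: "cmod (\<epsilon> 0) = r/4" using eps(3)[of 0] by simp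
      have "cmod (q 0 a) = cmod (f (a + \<epsilon> 0 *s v) - f a) / (r/4)" by (simp add: q_def norm_divide e0)
      moreover have "cmod (f (a + \<epsilon> 0 *s v) - f a) \<le> M + M"
        using bnd[OF a v, of "\<epsilon> 0"] bnd[OF a v, of 0] e0 r norm_triangle_ineq4[of "f (a + \<epsilon> 0 *s v)" "f a"] by simp
      ultimately have "cmod (q 0 a) \<le> (M + M) / (r/4)" using r by (simp add: divide_right_mono)
      moreover have "cmod (q 0 a - d a v) \<le> 32 * M / r\<^sup>2 * (r/4)" using qb[OF a, of 0] e0 by simp
      moreover have "cmod (d a v) \<le> cmod (q 0 a - d a v) + cmod (q 0 a)"
        by (metis add.commute norm_minus_commute norm_triangle_sub)
      ultimately show ?thesis by linarith
    qed
    define B where "B = 32 * (32 * M / r\<^sup>2 * (r/4) + (M + M) / (r/4)) / r\<^sup>2"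
    have est: "cmod (d (z0 + y) v - d z0 v - L y) \<le> B * (norm y)\<^sup>2" if y: "norm y \<le> r/4" for y
    proof (cases "y = 0")
      case True then show ?thesis using Lsm[of 0 0] by simp
    next
      case False
      define s where "s = complex_of_real (norm y)"
      define h where "h = inverse s *s y"
      have s: "s \<noteq> 0" "cmod s = norm y" using False by (auto simp: s_def)
      have h1: "norm h \<le> 1" using s False by (simp add: h_def norm_smult_vec norm_inverse)
      have yh: "y = s *s h" using s by (simp add: h_def)
      have "cmod (H h s - H h 0 - s * deriv (H h) 0) \<le> 32 * (32 * M / r\<^sup>2 * (r/4) + (M + M) / (r/4)) / r\<^sup>2 * (cmod s)\<^sup>2"
      proof (rule holomorphic_linear_approx[OF _ r])
        show "H h holomorphic_on ball 0 r" using props[OF h1] by blast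
        show "cmod s \<le> r/4" using s y by simp
        fix t assume t: "t \<in> ball (0::complex) r"
        have "norm (t *s h) \<le> cmod t * 1" unfolding norm_smult_vec by (intro mult_left_mono h1) auto
        then have "z0 + t *s h \<in> ball z0 r" using t by (simp add: dist_norm)
        then show "cmod (H h t) \<le> 32 * M / r\<^sup>2 * (r/4) + (M + M) / (r/4)" unfolding H_def by (rule db)
      qed
      then show ?thesis using s by (simp add: H_def yh[symmetric] LH[OF h1, symmetric] Lsm[symmetric] B_def)
    qed
    have "((\<lambda>z. d z v) has_derivative L) (at z0)"
      unfolding has_derivative_at
    proof (intro conjI bl)
      show "(\<lambda>h. norm (d (z0 + h) v - d z0 v - L h) / norm h) \<midarrow>0\<rightarrow> 0"
      proof (rule tendsto_0_le[where K=1])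
        show "(\<lambda>h. B * norm h) \<midarrow>0\<rightarrow> 0" by (auto intro!: tendsto_eq_intros)
        have "\<forall>\<^sub>F y in at (0::complex^'n). norm y \<le> r/4 "
          unfolding eventually_at using r by (intro exI[of _ "r/4"]) (auto simp: dist_norm)
        then show "\<forall>\<^sub>F y in at 0. norm (norm (d (z0 + y) v - d z0 v - L y) / norm y) \<le> norm (B * norm y) * 1"
        proof (rule eventually_mono)
          fix y :: "complex^'n" assume "norm y \<le> r/4"
          from est[OF this] show "norm (norm (d (z0 + y) v - d z0 v - L y) / norm y) \<le> norm (B * norm y) * 1"
            by (cases "y = 0") (auto simp: divide_le_eq power2_eq_square mult.assoc abs_mult intro: order_trans[OF _ mult_right_mono[OF abs_ge_self]])
        qed
      qed
    qed
    then show ?thesis unfolding cdiff_def using Lsm by blast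
  qed
  define c where "c = complex_of_real (norm v + 1)"
  have c: "c \<noteq> 0" unfolding c_def
    by (metis add_nonneg_pos norm_ge_zero of_real_eq_0_iff order_less_irrefl zero_less_one)
  have cc: "cmod c = norm v + 1" unfolding c_def by (metis abs_of_nonneg add_nonneg_nonneg norm_ge_zero norm_of_real zero_le_one)
  have "norm (inverse c *s v) \<le> 1"
    unfolding norm_smult_vec norm_inverse cc by (simp add: field_simps add_pos_nonneg)
  from main[OF this] obtain L where L: "((\<lambda>z. d z (inverse c *s v)) has_derivative L) (at z0)"
    "\<And>a h. L (a *s h) = a * L h" unfolding cdiff_def by blast
  have "((\<lambda>z. c * d z (inverse c *s v)) has_derivative (\<lambda>h. c * L h)) (at z0)"
    by (intro derivative_intros L)
  moreover have "c * d z (inverse c *s v) = d z v" if "z \<in> W" for z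
    using cdiffD(2)[OF f[OF that], of "inverse c" v] c by (simp add: d_def)
  ultimately have "((\<lambda>z. d z v) has_derivative (\<lambda>h. c * L h)) (at z0)"
    using has_derivative_transform_within_open[OF _ W z0, where f = "\<lambda>z. c * d z (inverse c *s v)"] by simp
  then show ?thesis unfolding cdiff_def d_def using L(2) by (auto simp: mult.left_commute)
qed

section \<open>Wirtinger derivatives of log det\<close>

lemma invertible_matrix_inv:
  fixes g :: "'a::field^'k^'k"
  assumes "invertible g"
  shows "matrix_inv g ** g = mat 1" "g ** matrix_inv g = mat 1"
  using assms unfolding matrix_inv_def invertible_def by (metis (mono_tags, lifting) someI_ex)+

lemma matrix_inv_mult:
  fixes M :: "'a::field^'k^'k"
  assumes "det M \<noteq> 0"
  shows "matrix_inv M ** M = mat 1" "M ** matrix_inv M = mat 1"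
  using assms invertible_matrix_inv invertible_det_nz by blast+

text \<open>Cramer's rule exhibits the entries of the inverse as rational functions of the entries.
  It is stated over any field because it yields differentiability over the complex numbers and
  continuity over the reals.\<close>

lemma matrix_inv_cramer:
  fixes M :: "'a::field^'k^'k"
  assumes "det M \<noteq> 0"
  shows "matrix_inv M $ p $ q = det (\<chi> i j. if j = p then (axis q 1 :: 'a^'k) $ i else M $ i $ j) / det M"
proof -
  have "M *v (matrix_inv M *v axis q 1) = axis q 1"
    by (simp add: matrix_vector_mul_assoc invertible_matrix_inv assms invertible_det_nz)
  then have "matrix_inv M *v axis q 1 = (\<chi> k. det(\<chi> i j. if j=k then (axis q 1 :: 'a^'k)$i else M$i$j) / det M)"
    using cramer[OF assms] by blast
  then have "(matrix_inv M *v axis q 1) $ p = det (\<chi> i j. if j = p then (axis q 1 :: 'a^'k) $ i else M $ i $ j) / det M"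
    by simp
  moreover have "(matrix_inv M *v axis q 1) $ p = matrix_inv M $ p $ q"
    by (simp add: matrix_vector_mult_def axis_def if_distrib cong: if_cong)
  ultimately show ?thesis by simp
qed

text \<open>Says that \<open>df\<close> is the sum of \<open>a i\<close> times
  \<open>dz\<^sub>i\<close> and \<open>b i\<close> times the conjugate differential, tested on the
  real and imaginary coordinate vectors. As a relation it includes differentiability, and
  derivatives can be composed by introduction rules.\<close>

definition has_wirt ::
    "(complex^'n \<Rightarrow> complex) \<Rightarrow> ('n \<Rightarrow> complex) \<Rightarrow> ('n \<Rightarrow> complex) \<Rightarrow> complex^'n \<Rightarrow> bool"
  where "has_wirt f a b z \<longleftrightarrow> (\<exists>f'. (f has_derivative f') (at z) \<and>
    (\<forall>i. f' (axis i 1) = a i + b i \<and> f' (axis i \<i>) = \<i> * (a i - b i)))"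

lemma has_wirt_imp:
  assumes "has_wirt f a b z"
  shows "wirt i f z = a i" "wirt_bar i f z = b i" "f differentiable (at z)"
proof -
  from assms obtain f' where f': "(f has_derivative f') (at z)"
    "\<And>i. f' (axis i 1) = a i + b i" "\<And>i. f' (axis i \<i>) = \<i> * (a i - b i)"
    unfolding has_wirt_def by blast
  have "frechet_derivative f (at z) = f'" using f'(1) frechet_derivative_at by metis
  then show "wirt i f z = a i" "wirt_bar i f z = b i"
    by (simp_all add: wirt_def wirt_bar_def f' algebra_simps)
  show "f differentiable (at z)" using f'(1) differentiable_def by blast
qed

lemma differentiable_imp_has_wirt:
  assumes "f differentiable (at z)"
  shows "has_wirt f (\<lambda>i. wirt i f z) (\<lambda>i. wirt_bar i f z) z"
  unfolding has_wirt_def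
  using frechet_derivative_works[THEN iffD1, OF assms]
  by (intro exI[of _ "frechet_derivative f (at z)"]) (auto simp: wirt_def wirt_bar_def field_simps)

lemma has_wirt_cong:
  assumes "has_wirt f a b z" "\<And>i. a i = a' i" "\<And>i. b i = b' i"
  shows "has_wirt f a' b' z"
  using assms by (simp add: has_wirt_def)

lemma has_wirt_transform:
  assumes "has_wirt f a b z" "open N" "z \<in> N" "\<And>w. w \<in> N \<Longrightarrow> f w = g w"
  shows "has_wirt g a b z"
  using assms(1) unfolding has_wirt_def
  using has_derivative_transform_within_open[OF _ assms(2,3)] assms(4) by blast

lemma has_wirt_const: "has_wirt (\<lambda>w. c) (\<lambda>i. 0) (\<lambda>i. 0) z"
  unfolding has_wirt_def by (intro exI[of _ "\<lambda>_. 0"]) auto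

lemma has_wirt_add:
  assumes "has_wirt f a b z" "has_wirt g c d z"
  shows "has_wirt (\<lambda>w. f w + g w) (\<lambda>i. a i + c i) (\<lambda>i. b i + d i) z"
proof -
  from assms obtain f' g' where
    "(f has_derivative f') (at z)" "\<And>i. f' (axis i 1) = a i + b i" "\<And>i. f' (axis i \<i>) = \<i> * (a i - b i)"
    "(g has_derivative g') (at z)" "\<And>i. g' (axis i 1) = c i + d i" "\<And>i. g' (axis i \<i>) = \<i> * (c i - d i)"
    unfolding has_wirt_def by blast
  then show ?thesis unfolding has_wirt_def
    by (intro exI[of _ "\<lambda>h. f' h + g' h"]) (auto intro!: derivative_intros simp: algebra_simps)
qed

lemma has_wirt_mult:
  assumes "has_wirt f a b z" "has_wirt g c d z"
  shows "has_wirt (\<lambda>w. f w * g w) (\<lambda>i. a i * g z + f z * c i) (\<lambda>i. b i * g z + f z * d i) z"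
proof -
  from assms obtain f' g' where
    "(f has_derivative f') (at z)" "\<And>i. f' (axis i 1) = a i + b i" "\<And>i. f' (axis i \<i>) = \<i> * (a i - b i)"
    "(g has_derivative g') (at z)" "\<And>i. g' (axis i 1) = c i + d i" "\<And>i. g' (axis i \<i>) = \<i> * (c i - d i)"
    unfolding has_wirt_def by blast
  then show ?thesis unfolding has_wirt_def
    by (intro exI[of _ "\<lambda>h. f z * g' h + f' h * g z"]) (auto intro!: derivative_intros simp: distrib_left distrib_right right_diff_distrib left_diff_distrib mult_ac)
qed

lemma has_wirt_compose_field:
  assumes "has_wirt f a b z" "(\<phi> has_field_derivative d) (at (f z))"
  shows "has_wirt (\<lambda>w. \<phi> (f w)) (\<lambda>i. d * a i) (\<lambda>i. d * b i) z"
proof -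
  from assms obtain f' where f':
    "(f has_derivative f') (at z)" "\<And>i. f' (axis i 1) = a i + b i" "\<And>i. f' (axis i \<i>) = \<i> * (a i - b i)"
    unfolding has_wirt_def by blast
  have "(\<phi> has_derivative (*) d) (at (f z))" using assms(2) by (simp add: has_field_derivative_def)
  from has_derivative_compose[OF f'(1) this] show ?thesis unfolding has_wirt_def
    by (intro exI[of _ "\<lambda>h. d * f' h"]) (auto simp: algebra_simps f')
qed

lemma has_wirt_cmult: "has_wirt f a b z \<Longrightarrow> has_wirt (\<lambda>w. c * f w) (\<lambda>i. c * a i) (\<lambda>i. c * b i) z"
  using has_wirt_mult[OF has_wirt_const, of f a b z c] by simp

lemma has_wirt_uminus: "has_wirt f a b z \<Longrightarrow> has_wirt (\<lambda>w. - f w) (\<lambda>i. - a i) (\<lambda>i. - b i) z"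
  using has_wirt_cmult[of f a b z "-1"] by simp

lemma has_wirt_inverse:
  "has_wirt f a b z \<Longrightarrow> f z \<noteq> 0 \<Longrightarrow>
    has_wirt (\<lambda>w. inverse (f w)) (\<lambda>i. - (a i / (f z)\<^sup>2)) (\<lambda>i. - (b i / (f z)\<^sup>2)) z"
  by (rule has_wirt_cong, rule has_wirt_compose_field[where \<phi> = inverse and f = f], assumption)
     (auto intro!: derivative_eq_intros simp: power2_eq_square field_simps)

lemma has_wirt_ln:
  "has_wirt f a b z \<Longrightarrow> f z \<notin> \<real>\<^sub>\<le>\<^sub>0 \<Longrightarrow>
    has_wirt (\<lambda>w. ln (f w)) (\<lambda>i. a i / f z) (\<lambda>i. b i / f z) z"
  by (rule has_wirt_cong, rule has_wirt_compose_field[where \<phi> = ln and f = f], assumption)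
     (auto intro!: derivative_eq_intros simp: field_simps)

lemma has_wirt_sum:
  assumes "finite S" "\<And>k. k \<in> S \<Longrightarrow> has_wirt (f k) (a k) (b k) z"
  shows "has_wirt (\<lambda>w. \<Sum>k\<in>S. f k w) (\<lambda>i. \<Sum>k\<in>S. a k i) (\<lambda>i. \<Sum>k\<in>S. b k i) z"
  using assms
proof (induction S rule: finite_induct)
  case empty
  then show ?case by (simp add: has_wirt_const)
next
  case (insert x F)
  then show ?case by (simp add: has_wirt_add)
qed

lemma has_wirt_prod:
  assumes "finite S" "\<And>k. k \<in> S \<Longrightarrow> has_wirt (f k) (a k) (b k) z"
  shows "has_wirt (\<lambda>w. \<Prod>k\<in>S. f k w)
    (\<lambda>i. \<Sum>k\<in>S. a k i * (\<Prod>l\<in>S - {k}. f l z)) (\<lambda>i. \<Sum>k\<in>S. b k i * (\<Prod>l\<in>S - {k}. f l z)) z"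
  using assms
proof (induction S rule: finite_induct)
  case empty
  then show ?case by (simp add: has_wirt_const)
next
  case (insert x F)
  have *: "c x * (\<Prod>l\<in>F. f l z) + f x z * (\<Sum>k\<in>F. c k * (\<Prod>l\<in>F - {k}. f l z)) =
      (\<Sum>k\<in>insert x F. c k * (\<Prod>l\<in>insert x F - {k}. f l z))" for c :: "_ \<Rightarrow> complex"
  proof -
    have *: "c k * (\<Prod>l\<in>insert x F - {k}. f l z) = f x z * (c k * (\<Prod>l\<in>F - {k}. f l z))" if "k \<in> F" for k
    proof -
      have "insert x F - {k} = insert x (F - {k})" using insert that by auto
      then show ?thesis using insert by (simp only: prod.insert finite_Diff Diff_iff not_False_eq_True simp_thms mult_ac)
    qed
    have "insert x F - {x} = F" using insert by auto
    then show ?thesis using insert(1,2) sum.cong[OF refl *, of F]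
      by (simp only: sum.insert sum_distrib_left) (simp add: mult.commute)
  qed
  have "has_wirt (\<lambda>w. \<Prod>k\<in>F. f k w)
    (\<lambda>i. \<Sum>k\<in>F. a k i * (\<Prod>l\<in>F - {k}. f l z)) (\<lambda>i. \<Sum>k\<in>F. b k i * (\<Prod>l\<in>F - {k}. f l z)) z"
    using insert by blast
  from has_wirt_mult[OF _ this, of "f x" "a x" "b x"] show ?case
    unfolding *[symmetric] using insert by simp
qed

text \<open>The derivative of the determinant at the identity: a permutation other than
  \<open>id\<close> moves at least two indices, so an off-diagonal zero remains after one factor has
  been differentiated.\<close>

lemma sum_permutations_identity:
  fixes a :: "complex^'k^'k"
  shows "(\<Sum>p | p permutes (UNIV::'k set). of_int (sign p) *
      (\<Sum>k\<in>UNIV. a $ k $ p k * (\<Prod>l\<in>UNIV - {k}. (mat 1 :: complex^'k^'k) $ l $ p l))) = trace a"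
proof -
  let ?t = "\<lambda>p. of_int (sign p) *
      (\<Sum>k\<in>UNIV. a $ k $ p k * (\<Prod>l\<in>UNIV - {k}. (mat 1 :: complex^'k^'k) $ l $ p l))"
  have z: "?t p = 0" if p: "p permutes (UNIV::'k set)" "p \<noteq> id" for p
  proof -
    have "(\<Prod>l\<in>UNIV - {k}. (mat 1 :: complex^'k^'k) $ l $ p l) = 0" for k
    proof -
      have "\<exists>l. l \<noteq> k \<and> p l \<noteq> l"
      proof (rule ccontr)
        assume "\<nexists>l. l \<noteq> k \<and> p l \<noteq> l"
        then have f: "p l = l" if "l \<noteq> k" for l using that by blast
        have "p k = k" using f[of "p k"] p(1) by (metis permutes_def)
        then have "p l = l" for l using f by (cases "l = k") auto
        then have "p = id" by (simp add: fun_eq_iff)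
        then show False using p by blast
      qed
      then obtain l where "l \<in> UNIV - {k}" "(mat 1 :: complex^'k^'k) $ l $ p l = 0"
        by (auto simp: mat_def)
      then show ?thesis by (meson finite_code prod_zero)
    qed
    then show ?thesis by (simp only: mult_zero_right sum.neutral_const)
  qed
  have "sum ?t {p. p permutes (UNIV::'k set)} = sum ?t {id}"
    by (rule sum.mono_neutral_right) (use z in \<open>auto simp: finite_permutations permutes_id\<close>)
  also have "\<dots> = trace a"
    by (simp add: trace_def mat_def sign_id)
  finally show ?thesis .
qed

lemma has_wirt_det_expansion:
  fixes M :: "complex^'n \<Rightarrow> complex^'k^'k"
  assumes M: "\<And>p q. has_wirt (\<lambda>w. M w $ p $ q) (\<lambda>i. A i $ p $ q) (\<lambda>i. B i $ p $ q) z"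
  shows "has_wirt (\<lambda>w. det (M w))
    (\<lambda>i. \<Sum>p | p permutes UNIV. of_int (sign p) * (\<Sum>k\<in>UNIV. A i $ k $ p k * (\<Prod>l\<in>UNIV - {k}. M z $ l $ p l)))
    (\<lambda>i. \<Sum>p | p permutes UNIV. of_int (sign p) * (\<Sum>k\<in>UNIV. B i $ k $ p k * (\<Prod>l\<in>UNIV - {k}. M z $ l $ p l))) z"
  unfolding det_def
  by (intro has_wirt_sum has_wirt_cmult has_wirt_prod M) (auto simp: finite_permutations)

lemma has_wirt_det_identity:
  fixes M :: "complex^'n \<Rightarrow> complex^'k^'k"
  assumes M: "\<And>p q. has_wirt (\<lambda>w. M w $ p $ q) (\<lambda>i. A i $ p $ q) (\<lambda>i. B i $ p $ q) z"
    and 1: "M z = mat 1"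
  shows "has_wirt (\<lambda>w. det (M w)) (\<lambda>i. trace (A i)) (\<lambda>i. trace (B i)) z"
  using has_wirt_det_expansion[where M = M, OF M] unfolding 1 sum_permutations_identity .

lemma has_wirt_matrix_mult:
  assumes M: "\<And>p q. has_wirt (\<lambda>w. M w $ p $ q) (\<lambda>i. A i $ p $ q) (\<lambda>i. B i $ p $ q) z"
    and N: "\<And>p q. has_wirt (\<lambda>w. N w $ p $ q) (\<lambda>i. C i $ p $ q) (\<lambda>i. D i $ p $ q) z"
  shows "has_wirt (\<lambda>w. (M w ** N w) $ p $ q)
    (\<lambda>i. (A i ** N z + M z ** C i) $ p $ q) (\<lambda>i. (B i ** N z + M z ** D i) $ p $ q) z"
  using has_wirt_sum[of UNIV, OF finite has_wirt_mult[OF M N], of "\<lambda>k. p" "\<lambda>k. k" "\<lambda>k. k" "\<lambda>k. q"]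
  by (simp add: matrix_matrix_mult_def sum.distrib)

text \<open>Jacobi's formula. Multiplication by the constant inverse \<open>X\<close> of
  \<open>M z\<close> reduces it to a matrix that is the identity at \<open>z\<close>, where only the
  trace survives.\<close>

lemma has_wirt_det:
  fixes M :: "complex^'n \<Rightarrow> complex^'k^'k"
  assumes M: "\<And>p q. has_wirt (\<lambda>w. M w $ p $ q) (\<lambda>i. A i $ p $ q) (\<lambda>i. B i $ p $ q) z"
    and X: "X ** M z = mat 1"
  shows "has_wirt (\<lambda>w. det (M w)) (\<lambda>i. det (M z) * trace (X ** A i)) (\<lambda>i. det (M z) * trace (X ** B i)) z"
proof -
  have X': "has_wirt (\<lambda>w. X $ p $ q) (\<lambda>i. (0::complex^'k^'k) $ p $ q) (\<lambda>i. (0::complex^'k^'k) $ p $ q) z" for p q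
    by (simp add: has_wirt_const)
  have X'': "M z ** X = mat 1" using X matrix_left_right_inverse by blast
  have "has_wirt (\<lambda>w. (X ** M w) $ p $ q) (\<lambda>i. (X ** A i) $ p $ q) (\<lambda>i. (X ** B i) $ p $ q) z" for p q
    by (rule has_wirt_cong[OF has_wirt_matrix_mult[OF X' M]]) simp_all
  from has_wirt_det_identity[where M = "\<lambda>w. X ** M w", OF this X]
  have "has_wirt (\<lambda>w. det (X ** M w)) (\<lambda>i. trace (X ** A i)) (\<lambda>i. trace (X ** B i)) z" .
  then have "has_wirt (\<lambda>w. det (M z) * det (X ** M w)) (\<lambda>i. det (M z) * trace (X ** A i)) (\<lambda>i. det (M z) * trace (X ** B i)) z"
    by (rule has_wirt_cmult)
  moreover have "det (M z) * det (X ** M w) = det (M w)" for w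
    by (simp add: det_mul[symmetric] matrix_mul_assoc X'')
  ultimately show ?thesis by simp
qed

lemma matrix_inv_differentiable:
  fixes M :: "complex^'n \<Rightarrow> complex^'k^'k"
  assumes N: "open N" "z \<in> N" and dz: "\<And>w. w \<in> N \<Longrightarrow> det (M w) \<noteq> 0"
    and M: "\<And>p q. (\<lambda>w. M w $ p $ q) differentiable (at z)"
  shows "(\<lambda>w. matrix_inv (M w) $ p $ q) differentiable (at z)"
proof -
  have dd: "(\<lambda>w. det (F w)) differentiable (at z)" if "\<And>p q. (\<lambda>w. F w $ p $ q) differentiable (at z)"
    for F :: "complex^'n \<Rightarrow> complex^'k^'k"
  proof -
    have "has_wirt (\<lambda>w. F w $ p $ q) (\<lambda>i. (\<chi> p q. wirt i (\<lambda>w. F w $ p $ q) z) $ p $ q)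
        (\<lambda>i. (\<chi> p q. wirt_bar i (\<lambda>w. F w $ p $ q) z) $ p $ q) z" for p q
      using differentiable_imp_has_wirt[OF that] by simp
    from has_wirt_det_expansion[where M = F, OF this] show ?thesis by (rule has_wirt_imp(3))
  qed
  let ?F = "\<lambda>w. (\<chi> i j. if j = p then (axis q 1 :: complex^'k) $ i else M w $ i $ j) :: complex^'k^'k"
  have "(\<lambda>w. det (?F w)) differentiable (at z)"
  proof (rule dd)
    fix i j show "(\<lambda>w. ?F w $ i $ j) differentiable (at z)" using M by (cases "j = p") auto
  qed
  then obtain D1 where D1: "((\<lambda>w. det (?F w)) has_derivative D1) (at z)" unfolding differentiable_def by blast
  obtain D2 where D2: "((\<lambda>w. det (M w)) has_derivative D2) (at z)" using dd[OF M] unfolding differentiable_def by blast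
  have "\<exists>D. ((\<lambda>w. det (?F w) / det (M w)) has_derivative D) (at z)"
    using has_derivative_divide[OF D1 D2] dz[OF N(2)] by blast
  then obtain D where D: "((\<lambda>w. det (?F w) / det (M w)) has_derivative D) (at z)" by blast
  have "((\<lambda>w. matrix_inv (M w) $ p $ q) has_derivative D) (at z)"
    by (rule has_derivative_transform_within_open[OF D N]) (simp add: matrix_inv_cramer dz)
  then show ?thesis unfolding differentiable_def by blast
qed

text \<open>Cramer's rule already gives differentiability, so the derivative can be read off by
  differentiating the equation that says inverse times matrix is the identity.\<close>

lemma has_wirt_matrix_inv:
  fixes M :: "complex^'n \<Rightarrow> complex^'k^'k"
  assumes N: "open N" "z \<in> N" and dz: "\<And>w. w \<in> N \<Longrightarrow> det (M w) \<noteq> 0"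
    and M: "\<And>p q. has_wirt (\<lambda>w. M w $ p $ q) (\<lambda>i. A i $ p $ q) (\<lambda>i. B i $ p $ q) z"
  shows "has_wirt (\<lambda>w. matrix_inv (M w) $ p $ q)
    (\<lambda>i. (- (matrix_inv (M z) ** A i ** matrix_inv (M z))) $ p $ q)
    (\<lambda>i. (- (matrix_inv (M z) ** B i ** matrix_inv (M z))) $ p $ q) z"
proof -
  let ?X = "\<lambda>w. matrix_inv (M w)"
  define C where "C i = (\<chi> p q. wirt i (\<lambda>w. ?X w $ p $ q) z)" for i
  define D where "D i = (\<chi> p q. wirt_bar i (\<lambda>w. ?X w $ p $ q) z)" for i
  have X: "has_wirt (\<lambda>w. ?X w $ p $ q) (\<lambda>i. C i $ p $ q) (\<lambda>i. D i $ p $ q) z" for p q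
    using differentiable_imp_has_wirt[OF matrix_inv_differentiable[OF N dz has_wirt_imp(3)[OF M]]]
    by (simp add: C_def D_def)
  have inv: "?X z ** M z = mat 1" "M z ** ?X z = mat 1" using matrix_inv_mult[OF dz[OF N(2)]] by auto
  have P: "has_wirt (\<lambda>w. (mat 1 :: complex^'k^'k) $ p $ q)
      (\<lambda>i. (C i ** M z + ?X z ** A i) $ p $ q) (\<lambda>i. (D i ** M z + ?X z ** B i) $ p $ q) z" for p q
    by (rule has_wirt_transform[OF has_wirt_matrix_mult[OF X M] N]) (simp add: matrix_inv_mult dz)
  have "(C i ** M z + ?X z ** A i) $ p $ q = 0" "(D i ** M z + ?X z ** B i) $ p $ q = 0" for i p q
    using has_wirt_imp(1,2)[OF P, of i] has_wirt_imp(1,2)[OF has_wirt_const[of "(mat 1 :: complex^'k^'k) $ p $ q" z], of i]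
    by simp_all
  then have "C i ** M z + ?X z ** A i = 0" "D i ** M z + ?X z ** B i = 0" for i
    by (simp_all add: vec_eq_iff)
  then have e: "C i ** M z = - (?X z ** A i)" "D i ** M z = - (?X z ** B i)" for i
    by (simp_all add: eq_neg_iff_add_eq_0)
  have "C i = - (?X z ** A i ** ?X z)" "D i = - (?X z ** B i ** ?X z)" for i
  proof -
    have "C i = (C i ** M z) ** ?X z" "D i = (D i ** M z) ** ?X z"
      by (simp_all add: matrix_mul_assoc[symmetric] inv)
    then show "C i = - (?X z ** A i ** ?X z)" "D i = - (?X z ** B i ** ?X z)"
      unfolding e by (simp_all add: vec_eq_iff matrix_matrix_mult_def sum_negf)
  qed
  with X show ?thesis by simp
qed

lemma has_wirt_trace:
  assumes M: "\<And>p q. has_wirt (\<lambda>w. M w $ p $ q) (\<lambda>i. A i $ p $ q) (\<lambda>i. B i $ p $ q) z"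
  shows "has_wirt (\<lambda>w. trace (M w)) (\<lambda>i. trace (A i)) (\<lambda>i. trace (B i)) z"
  unfolding trace_def by (intro has_wirt_sum M) auto

lemma levi_eqI:
  assumes N: "open N" "z \<in> N"
    and f: "\<And>w. w \<in> N \<Longrightarrow> has_wirt f (a w) (b w) w"
    and c: "\<And>j. has_wirt (\<lambda>w. b w j) (c j) (d j) z"
  shows "levi f z $ i $ j = c j i"
proof -
  have "has_wirt (wirt_bar j f) (c j) (d j) z"
    by (rule has_wirt_transform[OF c N]) (simp add: has_wirt_imp(2)[OF f])
  then show ?thesis by (simp add: levi_def has_wirt_imp(1))
qed

text \<open>The first derivative of \<open>ln det\<close> is the trace of the inverse times the
  derivative; it is needed on all of \<open>N\<close>, since one more differentiation follows. The
  condition on \<open>det\<close> keeps the principal logarithm differentiable.\<close>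

lemma levi_ln_det:
  fixes M :: "complex^'n \<Rightarrow> complex^'k^'k"
  assumes N: "open N" "z \<in> N" and dz: "\<And>w. w \<in> N \<Longrightarrow> det (M w) \<notin> \<real>\<^sub>\<le>\<^sub>0"
    and M: "\<And>w p q. w \<in> N \<Longrightarrow> has_wirt (\<lambda>w. M w $ p $ q) (\<lambda>i. A w i $ p $ q) (\<lambda>i. B w i $ p $ q) w"
    and B: "\<And>j p q. has_wirt (\<lambda>w. B w j $ p $ q) (\<lambda>i. C j i $ p $ q) (\<lambda>i. D j i $ p $ q) z"
    and X: "X ** M z = mat 1"
  shows "levi (\<lambda>w. ln (det (M w))) z $ i $ j = trace (X ** C j i) - trace (X ** A z i ** X ** B z j)"
proof -
  have nz: "det (M w) \<noteq> 0" if "w \<in> N" for w using dz[OF that] by auto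
  have Xz: "matrix_inv (M z) = X"
    by (metis X matrix_inv_mult(2) matrix_mul_assoc matrix_mul_lid matrix_mul_rid nz[OF N(2)])
  have 1: "has_wirt (\<lambda>w. ln (det (M w))) (\<lambda>i. trace (matrix_inv (M w) ** A w i)) (\<lambda>i. trace (matrix_inv (M w) ** B w i)) w"
    if w: "w \<in> N" for w
    by (rule has_wirt_cong[OF has_wirt_ln[OF has_wirt_det[OF M[OF w] matrix_inv_mult(1)[OF nz[OF w]]] dz[OF w]]])
       (use nz[OF w] in auto)
  have 2: "has_wirt (\<lambda>w. trace (matrix_inv (M w) ** B w j))
     (\<lambda>i. trace (- (X ** A z i ** X) ** B z j + X ** C j i)) (\<lambda>i. trace (- (X ** B z i ** X) ** B z j + X ** D j i)) z" for j
    using has_wirt_trace[OF has_wirt_matrix_mult[OF has_wirt_matrix_inv[OF N nz M[OF N(2)]] B]] unfolding Xz .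
  have "levi (\<lambda>w. ln (det (M w))) z $ i $ j = trace (- (X ** A z i ** X) ** B z j + X ** C j i)"
    by (rule levi_eqI[OF N 1 2])
  also have "- (X ** A z i ** X) ** B z j + X ** C j i = X ** C j i - X ** A z i ** X ** B z j"
    by (simp add: vec_eq_iff matrix_matrix_mult_def sum_negf)
  finally show ?thesis by (simp add: trace_sub)
qed

text \<open>Along the segment from the identity to \<open>h\<close> the matrix stays Hermitian and
  positive definite, so its determinant is real and nonzero. It starts at \<open>1\<close> and stays
  positive by continuity.\<close>

lemma det_positive:
  fixes h :: "complex^'n^'n"
  assumes pd: "positive_definite h" and herm: "\<And>i j. h $ j $ i = cnj (h $ i $ j)"
  shows "det h \<notin> \<real>\<^sub>\<le>\<^sub>0"
proof -
  define m where "m t = (\<chi> i j. complex_of_real (1 - t) * (mat 1 :: complex^'n^'n) $ i $ j + complex_of_real t * h $ i $ j)" for t :: real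
  have real: "det (m t) \<in> \<real>" for t
  proof -
    have "cnj (det (m t)) = det (\<chi> i j. cnj (m t $ i $ j))"
      by (simp add: det_def)
    also have "(\<chi> i j. cnj (m t $ i $ j)) = transpose (m t)"
    proof -
      have "cnj (m t $ i $ j) = m t $ j $ i" for i j
        by (simp add: m_def mat_def herm[of i j])
      then show ?thesis by (simp add: vec_eq_iff transpose_def)
    qed
    also have "det (transpose (m t)) = det (m t)" by (rule det_transpose)
    finally show ?thesis by (simp add: Reals_cnj_iff)
  qed
  have nz: "det (m t) \<noteq> 0" if t: "t \<in> {0..1}" for t
  proof
    assume "det (m t) = 0"
    \<comment> \<open>The form in \<open>positive_definite\<close> contracts \<open>v\<close> with
      the first index, so a kernel vector of the transpose is wanted.\<close>
    then have "det (transpose (m t)) = 0" by (simp add: det_transpose)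
    then have "\<not> invertible (transpose (m t))" by (simp add: invertible_det_nz)
    then have "\<nexists>B. B ** transpose (m t) = mat 1" by (simp add: invertible_left_inverse)
    then obtain v where v: "transpose (m t) *v v = 0" "v \<noteq> 0"
      using matrix_left_invertible_ker by blast
    define S where "S = (\<Sum>i\<in>UNIV. \<Sum>j\<in>UNIV. h $ i $ j * v $ i * cnj (v $ j))"
    have S: "Re S > 0" using pd v(2) by (simp add: positive_definite_def S_def Let_def)
    have "0 = (\<Sum>j\<in>UNIV. (transpose (m t) *v v) $ j * cnj (v $ j))"
      by (simp only: v zero_index mult_zero_left sum.neutral_const)
    also have "\<dots> = (\<Sum>j\<in>UNIV. \<Sum>i\<in>UNIV. m t $ i $ j * v $ i * cnj (v $ j))"
      by (simp add: matrix_vector_mult_def transpose_def sum_distrib_right)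
    also have "\<dots> = (\<Sum>i\<in>UNIV. \<Sum>j\<in>UNIV. m t $ i $ j * v $ i * cnj (v $ j))" by (rule sum.swap)
    also have "\<dots> = (\<Sum>i\<in>UNIV. \<Sum>j\<in>UNIV. complex_of_real (1 - t) * (if i = j then v $ i * cnj (v $ j) else 0)
        + complex_of_real t * (h $ i $ j * v $ i * cnj (v $ j)))"
      by (intro sum.cong refl) (auto simp: m_def mat_def algebra_simps)
    also have "\<dots> = complex_of_real (1 - t) * (\<Sum>i\<in>UNIV. v $ i * cnj (v $ i)) + complex_of_real t * S"
      unfolding S_def sum.distrib sum_distrib_left[symmetric] by simp
    also have "(\<Sum>i\<in>UNIV. v $ i * cnj (v $ i)) = complex_of_real (\<Sum>i\<in>UNIV. (cmod (v $ i))\<^sup>2)"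
      by (simp add: complex_mult_cnj cmod_power2)
    finally have "Re 0 = Re (complex_of_real (1 - t) * complex_of_real (\<Sum>i\<in>UNIV. (cmod (v $ i))\<^sup>2) + complex_of_real t * S)"
      by (rule arg_cong)
    then have "0 = (1 - t) * (\<Sum>i\<in>UNIV. (cmod (v $ i))\<^sup>2) + t * Re S"
      by (simp del: of_real_sum of_real_diff of_real_power)
    moreover have "(\<Sum>i\<in>UNIV. (cmod (v $ i))\<^sup>2) > 0"
    proof -
      obtain k where "v $ k \<noteq> 0" using v(2) by (auto simp: vec_eq_iff)
      then show ?thesis by (intro sum_pos2[of _ k]) auto
    qed
    moreover have "0 \<le> 1 - t" "0 \<le> t" using t by auto
    ultimately show False
      using S by (smt (verit) mult_nonneg_nonneg mult_pos_pos)
  qed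
  have "continuous_on {0..1} (\<lambda>t. Re (det (m t)))"
    unfolding det_def m_def by (auto intro!: continuous_intros)
  moreover have "Re (det (m 0)) = 1"
  proof -
    have "m 0 = mat 1" by (simp add: m_def vec_eq_iff)
    then show ?thesis by simp
  qed
  moreover have "Re (det (m t)) \<noteq> 0" if "t \<in> {0..1}" for t
  proof -
    have "Im (det (m t)) = 0" using real complex_is_Real_iff by blast
    then show ?thesis using nz[OF that] by (auto simp: complex_eq_iff)
  qed
  ultimately have "Re (det (m 1)) > 0"
    using IVT2'[of "\<lambda>t. Re (det (m t))" 1 0 0] by fastforce
  moreover have "m 1 = h" by (simp add: m_def vec_eq_iff)
  ultimately show ?thesis by (auto simp: complex_nonpos_Reals_iff)
qed

section \<open>Hodge frames\<close>

lemma cnj_vec_nth [simp]: "cnj_vec v $ i = cnj (v $ i)"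
  by (simp add: cnj_vec_def)

lemma cnj_vec_simps [simp]:
  "cnj_vec (cnj_vec u) = u" "cnj_vec 0 = 0" "cnj_vec (u + v) = cnj_vec u + cnj_vec v"
  "cnj_vec (u - v) = cnj_vec u - cnj_vec v" "cnj_vec (- u) = - cnj_vec u"
  "cnj_vec (c *s u) = cnj c *s cnj_vec u"
  by (simp_all add: vec_eq_iff)

lemma cnj_vec_sum: "cnj_vec (\<Sum>k\<in>S. g k) = (\<Sum>k\<in>S. cnj_vec (g k))"
  by (simp add: vec_eq_iff)

lemma mat_vec_linear:
  fixes M :: "complex^'a^'b"
  shows "M *v (u + w) = M *v u + M *v w" "M *v (u - w) = M *v u - M *v w" "M *v (c *s u) = c *s (M *v u)"
    "M *v 0 = 0" "M *v (- u) = - (M *v u)" "M *v (\<Sum>k\<in>S. g k) = (\<Sum>k\<in>S. M *v g k)"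
  using vec.linear_axioms[of M]
  by (simp_all add: vec.add vec.diff vec.scale vec.zero vec.neg vec.sum)

definition herm :: "(complex^'m \<Rightarrow> complex^'m \<Rightarrow> complex) \<Rightarrow> complex^'m \<Rightarrow> complex^'m \<Rightarrow> complex"
  where "herm Q u w = - \<i> * Q u (cnj_vec w)"

text \<open>A frame \<open>f\<close> consists of a vector \<open>f None\<close> of type (3,0) and vectors \<open>f (Some i)\<close> of type (1,2); on
  these two types \<open>herm Q\<close> is positive.  The Boolean component of an index selects the vector or its
  conjugate.\<close>

definition basis_vec :: "('n option \<Rightarrow> complex^'m) \<Rightarrow> 'n option \<times> bool \<Rightarrow> complex^'m"
  where "basis_vec f k = (if snd k then f (fst k) else cnj_vec (f (fst k)))"

text \<open>The sign on the conjugate vectors makes the coordinates dual to the basis: on those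
  vectors \<open>herm Q\<close> takes the value \<open>-1\<close>.\<close>

definition coord ::
    "(complex^'m \<Rightarrow> complex^'m \<Rightarrow> complex) \<Rightarrow> ('n option \<Rightarrow> complex^'m) \<Rightarrow> 'n option \<times> bool \<Rightarrow> complex^'m \<Rightarrow> complex"
  where "coord Q f k u = (if snd k then herm Q u (f (fst k)) else - herm Q u (cnj_vec (f (fst k))))"

definition hodge_type :: "'n option \<times> bool \<Rightarrow> nat"
  where "hodge_type k = (if fst k = None then (if snd k then 3 else 0) else (if snd k then 1 else 2))"

definition flip :: "'a \<times> bool \<Rightarrow> 'a \<times> bool"
  where "flip k = (fst k, \<not> snd k)"

lemma flip_simps [simp]: "flip (flip k) = k" "fst (flip k) = fst k" "snd (flip k) = (\<not> snd k)" "flip k = flip l \<longleftrightarrow> k = l"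
  by (auto simp: flip_def prod_eq_iff)

lemma bij_flip: "bij flip"
  by (rule o_bij[of flip]) (auto simp: fun_eq_iff)

lemma sum_flip: "(\<Sum>k\<in>UNIV. g (flip k)) = (\<Sum>k\<in>UNIV. g k)"
  by (rule sum.reindex_bij_betw[OF bij_flip])

lemma hodge_type_flip: "hodge_type (flip k) = 3 - hodge_type k"
  by (auto simp: hodge_type_def)

lemma hodge_type_le: "hodge_type k \<le> 3"
  by (auto simp: hodge_type_def)

text \<open>The last clause recovers the decomposition from the frame, so points of the classifying
  space can be compared, moved and stabilised by working with frames alone.\<close>

definition hodge_frame ::
    "(complex^'m \<Rightarrow> complex^'m \<Rightarrow> complex) \<Rightarrow> 'm::finite hodge \<Rightarrow> ('n::finite option \<Rightarrow> complex^'m) \<Rightarrow> bool"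
  where "hodge_frame Q x f \<longleftrightarrow>
    (\<forall>k l. coord Q f k (basis_vec f l) = (if k = l then 1 else 0)) \<and>
    (\<forall>u. u = (\<Sum>k\<in>UNIV. coord Q f k u *s basis_vec f k)) \<and>
    (\<forall>p. x p = {u. \<forall>k. hodge_type k \<noteq> p \<longrightarrow> coord Q f k u = 0})"

locale polarized =
  fixes Q :: "complex^'m \<Rightarrow> complex^'m \<Rightarrow> complex"
  assumes pol: "polarization Q"
begin

lemma Q_right: "Q u (v + w) = Q u v + Q u w" "Q u (c *s v) = c * Q u v"
proof -
  have "Vector_Spaces.linear (*s) (*) (Q u)" using pol unfolding polarization_def by blast
  then show "Q u (v + w) = Q u v + Q u w" "Q u (c *s v) = c * Q u v"
    by (auto simp: Vector_Spaces.linear_iff)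
qed

lemma Q_skew: "Q u w = - Q w u"
  using pol unfolding polarization_def by blast

lemma Q_left: "Q (v + w) u = Q v u + Q w u" "Q (c *s v) u = c * Q v u"
  using Q_skew[of "v + w" u] Q_skew[of v u] Q_skew[of w u] Q_skew[of "c *s v" u] by (simp_all add: Q_right)

lemma Q_cnj: "Q (cnj_vec u) (cnj_vec w) = cnj (Q u w)"
  using pol unfolding polarization_def by blast

lemma Q_nondeg: "(\<And>w. Q u w = 0) \<Longrightarrow> u = 0"
  using pol unfolding polarization_def by blast

lemma Q_zero [simp]: "Q u 0 = 0" "Q 0 u = 0"
  using Q_right(2)[of u 0 0] Q_left(2)[of 0 0 u] by simp_all

lemma Q_minus: "Q u (- w) = - Q u w" "Q (- u) w = - Q u w"
  using Q_right(2)[of u "-1" w] Q_left(2)[of "-1" u w] by simp_all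

lemma Q_diff: "Q u (v - w) = Q u v - Q u w" "Q (v - w) u = Q v u - Q w u"
  using Q_right(1)[of u v "- w"] Q_left(1)[of v "- w" u] by (simp_all add: Q_minus)

lemma Q_sum: "Q u (\<Sum>k\<in>S. g k) = (\<Sum>k\<in>S. Q u (g k))" "Q (\<Sum>k\<in>S. g k) u = (\<Sum>k\<in>S. Q (g k) u)"
  by (induction S rule: infinite_finite_induct; simp add: Q_right Q_left)+

lemma herm_left: "herm Q (u + v) w = herm Q u w + herm Q v w" "herm Q (c *s u) w = c * herm Q u w"
    "herm Q (u - v) w = herm Q u w - herm Q v w" "herm Q (- u) w = - herm Q u w" "herm Q 0 w = 0"
    "herm Q (\<Sum>k\<in>S. g k) w = (\<Sum>k\<in>S. herm Q (g k) w)"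
  by (simp_all add: herm_def Q_left Q_diff Q_minus Q_sum algebra_simps sum_distrib_left sum_negf)

lemma herm_cnj: "herm Q w u = cnj (herm Q u w)"
  using Q_cnj[of u "cnj_vec w"] Q_skew[of w "cnj_vec u"] by (simp add: herm_def)

lemma herm_right: "herm Q w (u + v) = herm Q w u + herm Q w v" "herm Q w (c *s u) = cnj c * herm Q w u"
    "herm Q w (u - v) = herm Q w u - herm Q w v" "herm Q w (- u) = - herm Q w u" "herm Q w 0 = 0"
    "herm Q w (\<Sum>k\<in>S. g k) = (\<Sum>k\<in>S. herm Q w (g k))"
  by (simp_all add: herm_cnj[of w] herm_left)

lemma herm_cnj_vec: "herm Q (cnj_vec u) (cnj_vec w) = - cnj (herm Q u w)"
  using Q_cnj[of u "cnj_vec w"] by (simp add: herm_def)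

lemma coord_linear: "coord Q f k (u + v) = coord Q f k u + coord Q f k v" "coord Q f k (c *s u) = c * coord Q f k u"
    "coord Q f k (u - v) = coord Q f k u - coord Q f k v" "coord Q f k (- u) = - coord Q f k u" "coord Q f k 0 = 0"
    "coord Q f k (\<Sum>j\<in>S. g j) = (\<Sum>j\<in>S. coord Q f k (g j))"
  by (simp_all add: coord_def herm_left sum_negf)

lemma coord_cnj_vec: "coord Q f k (cnj_vec u) = cnj (coord Q f (flip k) u)"
  using herm_cnj_vec[of u "cnj_vec (f (fst k))"] herm_cnj_vec[of u "f (fst k)"]
  by (auto simp: coord_def)

lemma coord_eq_Q: "coord Q f k u = (if snd k then - \<i> else \<i>) * Q u (basis_vec f (flip k))"
  by (simp add: coord_def herm_def basis_vec_def)

lemma cnj_basis_vec: "cnj_vec (basis_vec f k) = basis_vec f (flip k)"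
  by (simp add: basis_vec_def)

lemma orthonormal_independent:
  assumes "finite E" "\<And>u v. u \<in> E \<Longrightarrow> v \<in> E \<Longrightarrow> herm Q u v = (if u = v then 1 else 0)"
  shows "vec.independent E"
  unfolding vec.independent_explicit_finite_subsets
proof (intro allI impI ballI)
  fix S u v assume S: "S \<subseteq> E" "finite S" "(\<Sum>v\<in>S. u v *s v) = 0" "v \<in> S"
  have "0 = herm Q (\<Sum>w\<in>S. u w *s w) v" by (simp add: S herm_left)
  also have "\<dots> = (\<Sum>w\<in>S. u w * (if w = v then 1 else 0))"
    unfolding herm_left using S assms by (intro sum.cong refl) (auto simp: subset_iff)
  also have "\<dots> = u v" using S by (simp add: if_distrib cong: if_cong)
  finally show "u v = 0" by simp
qed

text \<open>Gram-Schmidt, one vector at a time: an orthonormal set with fewer than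
  \<open>vec.dim S\<close> elements cannot span \<open>S\<close>.\<close>

lemma orthonormal_basis_exists:
  assumes S: "vec.subspace S" and pos: "\<And>u. u \<in> S \<Longrightarrow> u \<noteq> 0 \<Longrightarrow> Im (herm Q u u) = 0 \<and> 0 < Re (herm Q u u)"
  shows "\<exists>E. finite E \<and> card E = vec.dim S \<and> E \<subseteq> S \<and> vec.span E = S \<and>
    (\<forall>u\<in>E. \<forall>v\<in>E. herm Q u v = (if u = v then 1 else 0))"
proof -
  have step: "\<exists>E. finite E \<and> card E = k \<and> E \<subseteq> S \<and> (\<forall>u\<in>E. \<forall>v\<in>E. herm Q u v = (if u = v then 1 else 0))"
    if "k \<le> vec.dim S" for k
    using that
  proof (induction k)
    case 0 then show ?case by (intro exI[of _ "{}"]) auto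
  next
    case (Suc k)
    then obtain E where E: "finite E" "card E = k" "E \<subseteq> S"
      "\<And>u v. u \<in> E \<Longrightarrow> v \<in> E \<Longrightarrow> herm Q u v = (if u = v then 1 else 0)" by fastforce
    have "\<not> S \<subseteq> vec.span E"
    proof
      assume "S \<subseteq> vec.span E"
      then have "vec.dim S \<le> card E" using vec.dim_le_card[OF _ E(1)] by blast
      then show False using Suc E by simp
    qed
    then obtain u where u: "u \<in> S" "u \<notin> vec.span E" by blast
    define w where "w = u - (\<Sum>e\<in>E. herm Q u e *s e)"
    have sp: "(\<Sum>e\<in>E. herm Q u e *s e) \<in> vec.span E"
      by (intro vec.span_sum vec.span_scale vec.span_base)
    have "vec.span E \<subseteq> S" using vec.span_minimal[OF E(3) S] .
    then have wS: "w \<in> S" unfolding w_def using S sp u vec.subspace_diff by blast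
    have w0: "w \<noteq> 0" using u sp by (auto simp: w_def)
    have orth: "herm Q w e = 0" if "e \<in> E" for e
    proof -
      have "herm Q w e = herm Q u e - (\<Sum>e'\<in>E. herm Q u e' * (if e' = e then 1 else 0))"
        unfolding w_def herm_left using E that by (intro arg_cong2[of _ _ _ _ "(-)"] sum.cong refl) auto
      also have "\<dots> = 0" using E(1) that by (simp add: if_distrib cong: if_cong)
      finally show ?thesis .
    qed
    define r where "r = Re (herm Q w w)"
    have r: "r > 0" "herm Q w w = complex_of_real r" using pos[OF wS w0] by (auto simp: r_def complex_eq_iff)
    define e where "e = complex_of_real (1 / sqrt r) *s w"
    have eS: "e \<in> S" unfolding e_def by (rule vec.subspace_scale[OF S wS])
    have ee: "herm Q e e = 1"
    proof -
      have "1 / sqrt r * (1 / sqrt r * r) = 1" using r(1) by (simp add: field_simps)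
      then have "complex_of_real (1 / sqrt r * (1 / sqrt r * r)) = 1" by (simp only: of_real_1)
      then show ?thesis
        unfolding e_def herm_left herm_right r(2) of_real_mult complex_cnj_complex_of_real .
    qed
    have eE: "herm Q e v = 0" "herm Q v e = 0" if "v \<in> E" for v
      using orth[OF that] herm_cnj[of v e] by (auto simp: e_def herm_left)
    have "e \<notin> E" using eE ee by auto
    then show ?case
      using E eS ee eE by (intro exI[of _ "insert e E"]) auto
  qed
  from step[OF order_refl] obtain E where E: "finite E" "card E = vec.dim S" "E \<subseteq> S"
    "\<forall>u\<in>E. \<forall>v\<in>E. herm Q u v = (if u = v then 1 else 0)" by blast
  have ind: "vec.independent E" using orthonormal_independent[of E] E by blast
  have "S \<subseteq> vec.span E" by (rule vec.card_ge_dim_independent[OF E(3) ind]) (use E in simp)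
  then have "vec.span E = S" using vec.span_minimal[OF E(3) S] by blast
  with E show ?thesis by blast
qed

text \<open>The positivity condition makes \<open>herm Q\<close> positive on types (3,0) and (1,2),
  where orthonormal bases are taken; the bilinear relations make different types orthogonal.
  Conjugation supplies the two other types.\<close>

lemma hodge_frame_exists:
  fixes x :: "'m hodge"
  assumes x: "x \<in> classifying_space n Q" and n: "CARD('n::finite) = n"
  shows "\<exists>f :: 'n option \<Rightarrow> complex^'m. hodge_frame Q x f"
proof -
  note x' = x[unfolded classifying_space_def mem_Collect_eq Let_def]
  have sub: "vec.subspace (x p)" for p using x'[THEN conjunct1] by (rule spec)
  have z: "x p = {0}" if "p > 3" for p using x'[THEN conjunct2, THEN conjunct1] that by (elim allE impE)
  have dec: "\<exists>!f. (\<forall>p. f p \<in> x p) \<and> v = (\<Sum>p\<le>3. f p)" for v using x'[THEN conjunct2, THEN conjunct2, THEN conjunct1] by (rule spec)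
  have con: "x p = cnj_vec ` x (3 - p)" if "p \<le> 3" for p using x'[THEN conjunct2, THEN conjunct2, THEN conjunct2, THEN conjunct1] that by (elim allE impE)
  have dims: "vec.dim (x 3) = 1" "vec.dim (x 1) = n"
    using x'[THEN conjunct2, THEN conjunct2, THEN conjunct2, THEN conjunct2, THEN conjunct1] x'[THEN conjunct2, THEN conjunct2, THEN conjunct2, THEN conjunct2, THEN conjunct2, THEN conjunct2, THEN conjunct1] .
  have orth: "Q u w = 0" if "p \<le> 3" "p' \<le> 3" "p' \<noteq> 3 - p" "u \<in> x p" "w \<in> x p'" for p p' u w
    using x'[THEN conjunct2, THEN conjunct2, THEN conjunct2, THEN conjunct2, THEN conjunct2, THEN conjunct2, THEN conjunct2, THEN conjunct2, THEN conjunct1] that by (elim allE impE ballE) auto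
  have pos: "Im (\<i> powi (int p - int (3 - p)) * Q u (cnj_vec u)) = 0 \<and> 0 < Re (\<i> powi (int p - int (3 - p)) * Q u (cnj_vec u))"
    if "p \<le> 3" "u \<in> x p" "u \<noteq> 0" for p u
    using x'[THEN conjunct2, THEN conjunct2, THEN conjunct2, THEN conjunct2, THEN conjunct2, THEN conjunct2, THEN conjunct2, THEN conjunct2, THEN conjunct2] that by (elim allE impE ballE) auto
  \<comment> \<open>\<open>p - q\<close> is \<open>3\<close> on type (3,0) and \<open>-1\<close> on
    type (1,2); both powers of \<open>\<i>\<close> equal \<open>- \<i>\<close>, the factor in
    \<open>herm\<close>.\<close>
  have i3: "\<i> powi (3::int) = - \<i>" "\<i> powi (- 1::int) = - \<i>"
    by (simp_all add: power_int_def eval_nat_numeral)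
  have p3: "Im (herm Q u u) = 0 \<and> 0 < Re (herm Q u u)" if "u \<in> x 3" "u \<noteq> 0" for u
    using pos[of 3, OF _ that] by (simp add: herm_def power3_eq_cube)
  have p1: "Im (herm Q u u) = 0 \<and> 0 < Re (herm Q u u)" if "u \<in> x 1" "u \<noteq> 0" for u
    using pos[of 1, OF _ that] by (simp add: herm_def i3)
  obtain E3 where E3: "finite E3" "card E3 = 1" "E3 \<subseteq> x 3" "vec.span E3 = x 3"
    "\<forall>u\<in>E3. \<forall>v\<in>E3. herm Q u v = (if u = v then 1 else 0)"
    using orthonormal_basis_exists[OF sub p3] dims by metis
  obtain E1 where E1: "finite E1" "card E1 = n" "E1 \<subseteq> x 1" "vec.span E1 = x 1"
    "\<forall>u\<in>E1. \<forall>v\<in>E1. herm Q u v = (if u = v then 1 else 0)"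
    using orthonormal_basis_exists[OF sub p1] dims by metis
  obtain e0 where e0: "E3 = {e0}" using E3(2) card_1_singletonE by blast
  obtain e where e: "bij_betw e (UNIV::'n set) E1"
    using finite_same_card_bij[OF finite E1(1)] n E1(2) by metis
  define f where "f a = (case a of None \<Rightarrow> e0 | Some i \<Rightarrow> e i)" for a
  have eE: "e i \<in> E1" for i using e by (auto simp: bij_betw_def)
  have einj: "e i = e j \<longleftrightarrow> i = j" for i j using e by (auto simp: bij_betw_def inj_on_def)
  have e0x: "e0 \<in> x 3" and ex: "e i \<in> x 1" for i using E3 E1 e0 eE by auto
  have fx: "f a \<in> x (hodge_type (a, True))" for a
    by (cases a) (auto simp: f_def hodge_type_def e0x ex simp del: One_nat_def)
  have bx: "basis_vec f k \<in> x (hodge_type k)" for k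
  proof (cases "snd k")
    case True then show ?thesis using fx[of "fst k"] by (cases k) (auto simp: basis_vec_def)
  next
    case False
    have "x (hodge_type k) = cnj_vec ` x (3 - hodge_type k)" by (rule con[OF hodge_type_le])
    moreover have "3 - hodge_type k = hodge_type (fst k, True)" using False by (auto simp: hodge_type_def)
    ultimately show ?thesis using False fx[of "fst k"] by (simp add: basis_vec_def)
  qed
  have hT: "herm Q (f a) (f b) = (if a = b then 1 else 0)" for a b
  proof -
    have c: "cnj_vec (e i) \<in> x 2" "cnj_vec e0 \<in> x 0" for i
      using bx[of "(Some i, False)"] bx[of "(None, False)"] by (simp_all add: basis_vec_def f_def hodge_type_def)
    have "herm Q e0 (e i) = 0" "herm Q (e i) e0 = 0" for i
      using orth[of 3 2, OF _ _ _ e0x c(1)] orth[of 1 0, OF _ _ _ ex c(2)] by (simp_all add: herm_def)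
    then show ?thesis using E3 E1 e0 eE einj by (cases a; cases b) (auto simp: f_def)
  qed
  have hF: "herm Q (f a) (cnj_vec (f b)) = 0" for a b
  proof -
    have "hodge_type (b, True) \<noteq> 3 - hodge_type (a, True)" by (auto simp: hodge_type_def)
    then have "Q (f a) (f b) = 0" by (intro orth[OF _ _ _ fx fx] hodge_type_le)
    then show ?thesis by (simp add: herm_def)
  qed
  have 1: "coord Q f k (basis_vec f l) = (if k = l then 1 else 0)" for k l
    using hT[of "fst l" "fst k"] hF[of "fst l" "fst k"] hF[of "fst k" "fst l"]
      herm_cnj_vec[of "f (fst l)" "f (fst k)"] herm_cnj[of "cnj_vec (f (fst l))" "f (fst k)"]
    by (auto simp: coord_def basis_vec_def prod_eq_iff)
  \<comment> \<open>\<open>V\<close> consists of the vectors reproduced by their expansion. It is a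
    subspace closed under conjugation, so it contains all four types once it contains the chosen
    bases of types (3,0) and (1,2).\<close>
  define V where "V = {u. u = (\<Sum>k\<in>UNIV. coord Q f k u *s basis_vec f k)}"
  have VS: "vec.subspace V"
    unfolding vec.subspace_def V_def
    by (auto simp: coord_linear vec.scale_left_distrib sum.distrib vec.scale_sum_right)
       (metis (no_types, lifting) sum.cong vec.scale_scale vec.scale_sum_right)
  have Vb: "basis_vec f k \<in> V" for k
    unfolding V_def by (simp add: 1 if_distrib[of "\<lambda>c. c *s _"] cong: if_cong)
  have Vc: "cnj_vec u \<in> V" if "u \<in> V" for u
  proof -
    from that have "u = (\<Sum>k\<in>UNIV. coord Q f k u *s basis_vec f k)" by (simp add: V_def)
    then have "cnj_vec u = cnj_vec (\<Sum>k\<in>UNIV. coord Q f k u *s basis_vec f k)" by simp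
    also have "\<dots> = (\<Sum>k\<in>UNIV. cnj (coord Q f k u) *s basis_vec f (flip k))"
      by (simp add: cnj_vec_sum cnj_basis_vec)
    also have "\<dots> = (\<Sum>k\<in>UNIV. cnj (coord Q f (flip k) u) *s basis_vec f k)"
      using sum_flip[of "\<lambda>k. cnj (coord Q f (flip k) u) *s basis_vec f k"] by simp
    finally show ?thesis unfolding V_def mem_Collect_eq coord_cnj_vec .
  qed
  have "x 3 \<subseteq> V" unfolding E3(4)[symmetric] e0
    by (rule vec.span_minimal[OF _ VS]) (use Vb[of "(None, True)"] in \<open>simp add: basis_vec_def f_def\<close>)
  moreover have "x 1 \<subseteq> V" unfolding E1(4)[symmetric]
  proof (rule vec.span_minimal[OF _ VS])
    show "E1 \<subseteq> V"
    proof
      fix u assume "u \<in> E1"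
      then obtain i where "u = e i" using e by (auto simp: bij_betw_def)
      then show "u \<in> V" using Vb[of "(Some i, True)"] by (simp add: basis_vec_def f_def)
    qed
  qed
  moreover have "x 2 \<subseteq> V" using con[of 2] Vc calculation by auto
  moreover have "x 0 \<subseteq> V" using con[of 0] Vc calculation by auto
  ultimately have xV: "x p \<subseteq> V" if "p \<le> 3" for p
    using that by (cases "p = 0 \<or> p = 1 \<or> p = 2") (auto, (metis (no_types) One_nat_def le_antisym not_less_eq_eq numeral_2_eq_2 numeral_3_eq_3 subsetD le_zero_eq)+)
  have 2: "u = (\<Sum>k\<in>UNIV. coord Q f k u *s basis_vec f k)" for u
  proof -
    obtain g where g: "\<forall>p. g p \<in> x p" "u = (\<Sum>p\<le>3. g p)" using dec[of u] by blast
    have "(\<Sum>p\<le>3. g p) \<in> V" by (rule vec.subspace_sum[OF VS]) (use g xV in auto)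
    then have "u \<in> V" by (subst g(2))
    then show ?thesis unfolding V_def mem_Collect_eq .
  qed
  have 3: "x p = {u. \<forall>k. hodge_type k \<noteq> p \<longrightarrow> coord Q f k u = 0}" for p
  proof (intro equalityI subsetI; unfold mem_Collect_eq)
    fix u assume u: "u \<in> x p"
    show "\<forall>k. hodge_type k \<noteq> p \<longrightarrow> coord Q f k u = 0"
    proof (intro allI impI)
      fix k :: "'n option \<times> bool" assume k: "hodge_type k \<noteq> p"
      show "coord Q f k u = 0"
      proof (cases "p \<le> 3")
        case True
        have "hodge_type (flip k) \<noteq> 3 - p" using k True hodge_type_le[of k] by (auto simp: hodge_type_flip)
        then have "Q u (basis_vec f (flip k)) = 0" by (intro orth[OF True _ _ u bx] hodge_type_le)
        then show ?thesis by (simp add: coord_eq_Q)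
      next
        case False then show ?thesis using u z by (simp add: coord_linear)
      qed
    qed
  next
    fix u assume u: "\<forall>k. hodge_type k \<noteq> p \<longrightarrow> coord Q f k u = 0"
    have "coord Q f k u *s basis_vec f k \<in> x p" for k
    proof (cases "hodge_type k = p")
      case True
      then show ?thesis using vec.subspace_scale[OF sub bx, of "coord Q f k u" k] by simp
    next
      case False
      then have "coord Q f k u = 0" using u by blast
      then show ?thesis using vec.subspace_0[OF sub] by simp
    qed
    then have "(\<Sum>k\<in>UNIV. coord Q f k u *s basis_vec f k) \<in> x p"
      by (intro vec.subspace_sum[OF sub])
    then show "u \<in> x p" using 2[of u] by simp
  qed
  show ?thesis unfolding hodge_frame_def using 1 2 3 by blast
qed

end

text \<open>Frame indices are pairs, but are only used as atoms.\<close>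

declare split_paired_All [simp del] split_paired_Ex [simp del]

section \<open>Endomorphisms in a frame: real structure, tangent and horizontal vectors,
  transitivity\<close>

definition cnj_mat :: "complex^'a^'b \<Rightarrow> complex^'a^'b"
  where "cnj_mat M = (\<chi> i j. cnj (M $ i $ j))"

lemma cnj_mat_mult_vec: "cnj_mat M *v cnj_vec u = cnj_vec (M *v u)"
  by (simp add: vec_eq_iff matrix_vector_mult_def cnj_mat_def)

lemma cnj_mat_mult_vec': "cnj_mat M *v u = cnj_vec (M *v cnj_vec u)"
  using cnj_mat_mult_vec[of M "cnj_vec u"] by simp

lemma complexify_simps:
  "complexify (A ** B) = complexify A ** complexify B" "complexify (mat 1) = mat 1"
  "complexify (A + B) = complexify A + complexify B" "complexify (A - B) = complexify A - complexify B"
  "complexify (- A) = - complexify A" "complexify 0 = 0" "complexify (c *\<^sub>R A) = c *\<^sub>R complexify A"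
  by (simp_all add: complexify_def vec_eq_iff matrix_matrix_mult_def mat_def scaleR_conv_of_real[where 'a=complex])

lemma complexify_inject: "complexify A = complexify B \<longleftrightarrow> A = B"
  by (simp add: complexify_def vec_eq_iff)

lemma trace_complexify: "trace (complexify A) = complex_of_real (trace A)"
  by (simp add: trace_def complexify_def)

lemma cnj_mat_complexify: "cnj_mat (complexify g) = complexify g"
  by (simp add: cnj_mat_def complexify_def vec_eq_iff)

lemma complexify_cnj_vec: "complexify g *v cnj_vec u = cnj_vec (complexify g *v u)"
  using cnj_mat_mult_vec[of "complexify g" u] by (simp add: cnj_mat_complexify)

text \<open>A matrix commuting with conjugation has real entries. Real group and Lie algebra
  elements are obtained in this way from matrices prescribed in a frame.\<close>

lemma real_matrix_exists:
  assumes "\<And>u. M *v cnj_vec u = cnj_vec (M *v u)"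
  shows "\<exists>g. complexify g = M"
proof -
  have "cnj_mat M *v u = M *v u" for u
    using assms[of "cnj_vec u"] by (simp add: cnj_mat_mult_vec')
  then have "cnj_mat M = M" by (simp add: matrix_eq)
  then have "complexify (\<chi> i j. Re (M $ i $ j)) = M"
    by (auto simp: cnj_mat_def complexify_def vec_eq_iff complex_eq_iff)
  then show ?thesis by blast
qed

definition infinitesimal ::
    "(complex^'m \<Rightarrow> complex^'m \<Rightarrow> complex) \<Rightarrow> complex^'m^'m \<Rightarrow> bool"
  where "infinitesimal Q Y \<longleftrightarrow> (\<forall>u w. Q (Y *v u) w + Q u (Y *v w) = 0)"

definition entry ::
    "(complex^'m \<Rightarrow> complex^'m \<Rightarrow> complex) \<Rightarrow> ('n option \<Rightarrow> complex^'m) \<Rightarrow> complex^'m^'m \<Rightarrow>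
     'n option \<times> bool \<Rightarrow> 'n option \<times> bool \<Rightarrow> complex"
  where "entry Q f Y k l = coord Q f k (Y *v basis_vec f l)"

locale framed = polarized Q for Q :: "complex^'m \<Rightarrow> complex^'m \<Rightarrow> complex" +
  fixes x :: "'m::finite hodge" and f :: "'n::finite option \<Rightarrow> complex^'m"
  assumes frame: "hodge_frame Q x f"
begin

abbreviation "co \<equiv> coord Q f"
abbreviation "bv \<equiv> basis_vec f"
abbreviation "ent \<equiv> entry Q f"

lemma co_bv: "co k (bv l) = (if k = l then 1 else 0)"
  using frame unfolding hodge_frame_def by blast

lemma expand: "u = (\<Sum>k\<in>UNIV. co k u *s bv k)"
  using frame unfolding hodge_frame_def by blast

lemma x_eq: "x p = {u. \<forall>k. hodge_type k \<noteq> p \<longrightarrow> co k u = 0}"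
  using frame unfolding hodge_frame_def by blast

lemma co_eqI: "(\<And>k. co k u = co k w) \<Longrightarrow> u = w"
  using expand[of u] expand[of w] by simp

lemma co_sum_bv: "co k (\<Sum>l\<in>UNIV. c l *s bv l) = c k"
  by (simp add: coord_linear co_bv if_distrib cong: if_cong)

lemma bv_mem: "bv k \<in> x (hodge_type k)"
  by (auto simp: x_eq co_bv)

text \<open>In a frame \<open>Q\<close> pairs a basis vector only with its own conjugate, so
  \<open>Q\<close> has the same coordinate expression in every frame.\<close>

lemma Q_expand: "Q u w = (\<Sum>k\<in>UNIV. (if snd k then - \<i> else \<i>) * co (flip k) u * co k w)"
proof -
  have "Q u (bv k) = (if snd k then - \<i> else \<i>) * co (flip k) u" for k
    by (simp add: coord_eq_Q)
  moreover have "Q u w = (\<Sum>k\<in>UNIV. co k w * Q u (bv k))"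
    by (subst expand[of w]) (simp add: Q_sum Q_right)
  ultimately show ?thesis by (simp add: mult_ac)
qed

lemma herm_expand: "herm Q u w = (\<Sum>k\<in>UNIV. (if snd k then 1 else - 1) * co k u * cnj (co k w))"
proof -
  have "herm Q u w = (\<Sum>k\<in>UNIV. - \<i> * ((if snd k then - \<i> else \<i>) * co (flip k) u * cnj (co (flip k) w)))"
    unfolding herm_def Q_expand[of u "cnj_vec w"] by (simp add: sum_distrib_left coord_cnj_vec)
  also have "\<dots> = (\<Sum>k\<in>UNIV. (if snd (flip k) then 1 else - 1) * co (flip k) u * cnj (co (flip k) w))"
    by (intro sum.cong) (auto simp: mult.assoc)
  also have "\<dots> = (\<Sum>k\<in>UNIV. (if snd k then 1 else - 1) * co k u * cnj (co k w))"
    by (rule sum_flip)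
  finally show ?thesis .
qed

lemma subspace_co: "vec.subspace {u. \<forall>k. P k \<longrightarrow> co k u = 0}"
  by (simp add: vec.subspace_def coord_linear)

text \<open>Covers at once the filtration, with types at least \<open>p\<close>, and the strictly
  lower types that occur in \<open>tangent_space\<close>.\<close>

lemma span_types: "vec.span (\<Union>r\<in>R. x r) = {u. \<forall>k. hodge_type k \<notin> R \<longrightarrow> co k u = 0}"
proof (intro equalityI vec.span_minimal subspace_co)
  show "(\<Union>r\<in>R. x r) \<subseteq> {u. \<forall>k. hodge_type k \<notin> R \<longrightarrow> co k u = 0}"
  proof (intro UN_least subsetI, unfold x_eq mem_Collect_eq, intro allI impI)
    fix r u and k :: "'n option \<times> bool" assume "r \<in> R" "\<forall>k. hodge_type k \<noteq> r \<longrightarrow> co k u = 0" "hodge_type k \<notin> R"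
    then show "co k u = 0" by metis
  qed
  show "{u. \<forall>k. hodge_type k \<notin> R \<longrightarrow> co k u = 0} \<subseteq> vec.span (\<Union>r\<in>R. x r)"
  proof
    fix u assume u: "u \<in> {u. \<forall>k. hodge_type k \<notin> R \<longrightarrow> co k u = 0}"
    have "co k u *s bv k \<in> vec.span (\<Union>r\<in>R. x r)" for k
    proof (cases "hodge_type k \<in> R")
      case True then show ?thesis using bv_mem[of k] by (blast intro: vec.span_scale vec.span_base)
    next
      case False then show ?thesis using u by (simp add: vec.span_zero)
    qed
    then have "(\<Sum>k\<in>UNIV. co k u *s bv k) \<in> vec.span (\<Union>r\<in>R. x r)" by (intro vec.span_sum)
    then show "u \<in> vec.span (\<Union>r\<in>R. x r)" using expand[of u] by simp
  qed
qed

lemma Fil_eq: "Fil x p = {u. \<forall>k. hodge_type k < p \<longrightarrow> co k u = 0}"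
  unfolding Fil_def span_types by (auto simp: hodge_type_le)

lemma lower_eq: "vec.span (\<Union>r\<in>{..<p}. x r) = {u. \<forall>k. p \<le> hodge_type k \<longrightarrow> co k u = 0}"
  unfolding span_types by (auto simp: not_less)

lemma co_mult: "co k (Y *v u) = (\<Sum>l\<in>UNIV. ent Y k l * co l u)"
  by (subst expand[of u]) (simp add: mat_vec_linear coord_linear entry_def mult.commute)

lemma ent_mult: "ent (Y ** Z) k l = (\<Sum>j\<in>UNIV. ent Y k j * ent Z j l)"
  by (simp add: entry_def matrix_vector_mul_assoc[symmetric] co_mult[of k Y "Z *v _"])

lemma ent_linear: "ent (Y + Z) k l = ent Y k l + ent Z k l" "ent (Y - Z) k l = ent Y k l - ent Z k l"
  "ent (- Y) k l = - ent Y k l" "ent 0 k l = 0"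
proof -
  have "(- Y) *v u = - (Y *v u)" for u by (simp add: vec_eq_iff matrix_vector_mult_def sum_negf)
  then show "ent (Y + Z) k l = ent Y k l + ent Z k l" "ent (Y - Z) k l = ent Y k l - ent Z k l"
    "ent (- Y) k l = - ent Y k l" "ent 0 k l = 0"
    by (simp_all add: entry_def matrix_vector_mult_add_rdistrib matrix_vector_mult_diff_rdistrib coord_linear)
qed

lemma ent_eqI:
  assumes "\<And>k l. ent Y k l = ent Z k l"
  shows "Y = Z"
proof -
  have "Y *v u = Z *v u" for u by (rule co_eqI) (simp add: co_mult assms)
  then show ?thesis by (simp add: matrix_eq)
qed

lemma ent_cnj_mat: "ent (cnj_mat Y) k l = cnj (ent Y (flip k) (flip l))"
  by (simp add: entry_def cnj_mat_mult_vec' cnj_basis_vec coord_cnj_vec)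

lemma trace_ent: "trace Y = (\<Sum>k\<in>UNIV. ent Y k k)"
proof -
  have bl: "bv k = (\<Sum>i\<in>UNIV. bv k $ i *s axis i 1)" for k
    by (simp add: vec_eq_iff axis_def if_distrib cong: if_cong)
  have "ent Y k k = (\<Sum>i\<in>UNIV. bv k $ i * co k (Y *v axis i 1))" for k
    unfolding entry_def by (subst bl) (simp add: mat_vec_linear coord_linear)
  then have "(\<Sum>k\<in>UNIV. ent Y k k) = (\<Sum>k\<in>UNIV. \<Sum>i\<in>UNIV. bv k $ i * co k (Y *v axis i 1))" by simp
  also have "\<dots> = (\<Sum>i\<in>UNIV. \<Sum>k\<in>UNIV. bv k $ i * co k (Y *v axis i 1))" by (rule sum.swap)
  also have "\<dots> = (\<Sum>i\<in>UNIV. (Y *v axis i 1) $ i)"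
  proof (rule sum.cong)
    fix i
    show "(\<Sum>k\<in>UNIV. bv k $ i * co k (Y *v axis i 1)) = (Y *v axis i 1) $ i"
      by (subst (2) expand[of "Y *v axis i 1"]) (simp add: mult.commute)
  qed simp
  also have "\<dots> = trace Y"
    by (simp add: trace_def matrix_vector_mult_def axis_def if_distrib cong: if_cong)
  finally show ?thesis ..
qed

lemma trace_mult_ent: "trace (Y ** Z) = (\<Sum>k\<in>UNIV. \<Sum>l\<in>UNIV. ent Y k l * ent Z l k)"
  by (simp add: trace_ent ent_mult)

definition frame_matrix :: "('n option \<times> bool \<Rightarrow> 'n option \<times> bool \<Rightarrow> complex) \<Rightarrow> complex^'m^'m"
  where "frame_matrix a = matrix (\<lambda>u. \<Sum>k\<in>UNIV. (\<Sum>l\<in>UNIV. a k l * co l u) *s bv k)"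

lemma frame_matrix_mult: "frame_matrix a *v u = (\<Sum>k\<in>UNIV. (\<Sum>l\<in>UNIV. a k l * co l u) *s bv k)"
  unfolding frame_matrix_def
  by (rule matrix_works)
     (auto simp: Vector_Spaces.linear_iff vec.vector_space_axioms coord_linear sum.distrib algebra_simps
        vec.scale_left_distrib sum_distrib_left vec.scale_sum_right)

lemma ent_frame_matrix: "ent (frame_matrix a) k l = a k l"
  unfolding entry_def frame_matrix_mult co_sum_bv by (simp add: co_bv if_distrib cong: if_cong)

lemma infinitesimal_iff:
  "infinitesimal Q Y \<longleftrightarrow>
    (\<forall>k l. (if snd k then - \<i> else \<i>) * ent Y (flip k) l + (if snd l then \<i> else - \<i>) * ent Y (flip l) k = 0)"
proof -
  have Qb: "Q u (bv k) = (if snd k then - \<i> else \<i>) * co (flip k) u"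
    "Q (bv k) u = (if snd k then \<i> else - \<i>) * co (flip k) u" for u k
    using Q_skew[of "bv k" u] by (auto simp: coord_eq_Q)
  have b: "Q (Y *v bv l) (bv k) + Q (bv l) (Y *v bv k) =
      (if snd k then - \<i> else \<i>) * ent Y (flip k) l + (if snd l then \<i> else - \<i>) * ent Y (flip l) k" for k l
    by (simp only: Qb entry_def)
  have "infinitesimal Q Y \<longleftrightarrow> (\<forall>k l. Q (Y *v bv l) (bv k) + Q (bv l) (Y *v bv k) = 0)"
  proof
    assume R: "\<forall>k l. Q (Y *v bv l) (bv k) + Q (bv l) (Y *v bv k) = 0"
    show "infinitesimal Q Y" unfolding infinitesimal_def
    proof (intro allI)
      fix u w
      have eu: "Q (Z *v u) v = (\<Sum>l\<in>UNIV. co l u * Q (Z *v bv l) v)" for Z v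
        by (subst expand[of u]) (simp add: mat_vec_linear Q_sum Q_left)
      have ew: "Q v (Z *v w) = (\<Sum>k\<in>UNIV. co k w * Q v (Z *v bv k))" for Z v
        by (subst expand[of w]) (simp add: mat_vec_linear Q_sum Q_right)
      have "Q (Y *v u) w + Q u (Y *v w) =
        (\<Sum>l\<in>UNIV. \<Sum>k\<in>UNIV. co l u * (co k w * (Q (Y *v bv l) (bv k) + Q (bv l) (Y *v bv k))))"
        using eu[of Y w] ew[of _ "mat 1"] eu[of "mat 1" "Y *v w"] ew[of _ Y]
        by (simp add: sum_distrib_left sum.distrib distrib_left)
      then show "Q (Y *v u) w + Q u (Y *v w) = 0" using R by simp
    qed
  qed (auto simp: infinitesimal_def)
  then show ?thesis by (simp only: b)
qed

lemma tangent_iff: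
  "Y \<in> tangent_space Q x \<longleftrightarrow> infinitesimal Q Y \<and> (\<forall>k l. hodge_type l \<le> hodge_type k \<longrightarrow> ent Y k l = 0)"
proof -
  have "(\<forall>p\<le>3. \<forall>u\<in>x p. Y *v u \<in> vec.span (\<Union>r\<in>{..<p}. x r)) \<longleftrightarrow>
      (\<forall>k l. hodge_type l \<le> hodge_type k \<longrightarrow> ent Y k l = 0)" (is "?L \<longleftrightarrow> ?R")
  proof
    assume ?L
    then show ?R using bv_mem hodge_type_le unfolding lower_eq entry_def by blast
  next
    assume R: ?R
    show ?L
    proof (intro allI impI ballI)
      fix p u assume u: "u \<in> x p"
      show "Y *v u \<in> vec.span (\<Union>r\<in>{..<p}. x r)"
        unfolding lower_eq mem_Collect_eq
      proof (intro allI impI)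
        fix k :: "'n option \<times> bool" assume k: "p \<le> hodge_type k"
        have "ent Y k l * co l u = 0" for l
          using R u k by (cases "hodge_type l = p") (auto simp: x_eq)
        then show "co k (Y *v u) = 0" by (simp only: co_mult sum.neutral_const)
      qed
    qed
  qed
  then show ?thesis by (auto simp: tangent_space_def infinitesimal_def)
qed

text \<open>Strict lowering leaves type 1 only type 0 as a target, so the conditions on
  \<open>F\<^sup>3\<close> and \<open>F\<^sup>2\<close> together force a drop by exactly
  one.\<close>

lemma horizontal_iff:
  "Y \<in> horizontal_space Q x \<longleftrightarrow>
     infinitesimal Q Y \<and> (\<forall>k l. ent Y k l \<noteq> 0 \<longrightarrow> hodge_type l = Suc (hodge_type k))"
proof
  assume Y: "Y \<in> horizontal_space Q x"
  then have t: "infinitesimal Q Y" "\<And>k l. hodge_type l \<le> hodge_type k \<Longrightarrow> ent Y k l = 0"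
    and h: "\<And>u. u \<in> Fil x 3 \<Longrightarrow> Y *v u \<in> Fil x 2" "\<And>u. u \<in> Fil x 2 \<Longrightarrow> Y *v u \<in> Fil x 1"
    by (auto simp: horizontal_space_def tangent_iff)
  have F: "bv l \<in> Fil x (hodge_type l)" for l by (auto simp: Fil_eq co_bv)
  have "hodge_type l = Suc (hodge_type k)" if "ent Y k l \<noteq> 0" for k l
  proof -
    have lt: "hodge_type k < hodge_type l" using t(2) that by (meson leI)
    have "hodge_type k = 2" if "hodge_type l = 3"
    proof -
      have "\<not> hodge_type k < 2"
        using h(1)[of "bv l"] F[of l] \<open>ent Y k l \<noteq> 0\<close> that by (auto simp: Fil_eq entry_def)
      then show ?thesis using lt that by linarith
    qed
    moreover have "hodge_type k = 1" if "hodge_type l = 2"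
    proof -
      have "\<not> hodge_type k < 1"
        using h(2)[of "bv l"] F[of l] \<open>ent Y k l \<noteq> 0\<close> that by (auto simp: Fil_eq entry_def)
      then show ?thesis using lt that by linarith
    qed
    ultimately show ?thesis using lt hodge_type_le[of l]
      by (cases "hodge_type l = 3"; cases "hodge_type l = 2") auto
  qed
  with t(1) show "infinitesimal Q Y \<and> (\<forall>k l. ent Y k l \<noteq> 0 \<longrightarrow> hodge_type l = Suc (hodge_type k))" by blast
next
  assume Y: "infinitesimal Q Y \<and> (\<forall>k l. ent Y k l \<noteq> 0 \<longrightarrow> hodge_type l = Suc (hodge_type k))"
  have "ent Y k l = 0" if "hodge_type l \<le> hodge_type k" for k l using Y that by force
  with Y have t: "Y \<in> tangent_space Q x" unfolding tangent_iff by blast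
  have "Y *v u \<in> Fil x p" if "u \<in> Fil x (Suc p)" for u p
    unfolding Fil_eq mem_Collect_eq
  proof (intro allI impI)
    fix k :: "'n option \<times> bool" assume k: "hodge_type k < p"
    have "ent Y k l * co l u = 0" for l
      using Y that k by (cases "ent Y k l = 0") (auto simp: Fil_eq)
    then show "co k (Y *v u) = 0" by (simp only: co_mult sum.neutral_const)
  qed
  from this[of _ 2] this[of _ 1] show "Y \<in> horizontal_space Q x"
    using t by (simp add: horizontal_space_def numeral_3_eq_3 numeral_2_eq_2)
qed

lemma frame_act:
  assumes g: "g \<in> aut_group Q"
  shows "hodge_frame Q (act g x) (\<lambda>a. complexify g *v f a)"
proof -
  let ?M = "complexify g" let ?f' = "\<lambda>a. complexify g *v f a"
  have QM: "Q (?M *v u) (?M *v w) = Q u w" for u w using g unfolding aut_group_def by blast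
  have b: "basis_vec ?f' k = ?M *v bv k" for k by (simp add: basis_vec_def complexify_cnj_vec)
  have c: "coord Q ?f' k (?M *v u) = co k u" for k u by (simp only: coord_eq_Q b QM)
  have inv: "invertible g" using g by (simp add: aut_group_def)
  define N where "N = complexify (matrix_inv g)"
  have N: "?M ** N = mat 1" "N ** ?M = mat 1"
    by (simp_all add: N_def complexify_simps(1,2)[symmetric] invertible_matrix_inv[OF inv])
  have MN: "?M *v (N *v u) = u" for u by (simp add: matrix_vector_mul_assoc N)
  have "u = (\<Sum>k\<in>UNIV. coord Q ?f' k u *s basis_vec ?f' k)" for u
  proof -
    have "?M *v (N *v u) = (\<Sum>k\<in>UNIV. co k (N *v u) *s (?M *v bv k))"
      by (subst expand[of "N *v u"]) (simp add: mat_vec_linear)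
    moreover have "co k (N *v u) = coord Q ?f' k u" for k using c[of k "N *v u"] by (simp add: MN)
    ultimately show ?thesis by (simp add: MN b)
  qed
  moreover have "act g x p = {u. \<forall>k. hodge_type k \<noteq> p \<longrightarrow> coord Q ?f' k u = 0}" for p
  proof -
    have "{u. \<forall>k. hodge_type k \<noteq> p \<longrightarrow> coord Q ?f' k u = 0} = (\<lambda>u. ?M *v u) ` {u. \<forall>k. hodge_type k \<noteq> p \<longrightarrow> co k u = 0}"
    proof (intro equalityI subsetI)
      fix u assume "u \<in> {u. \<forall>k. hodge_type k \<noteq> p \<longrightarrow> coord Q ?f' k u = 0}"
      then have "N *v u \<in> {u. \<forall>k. hodge_type k \<noteq> p \<longrightarrow> co k u = 0}"
        using c[of _ "N *v u"] by (simp add: MN)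
      then show "u \<in> (\<lambda>u. ?M *v u) ` {u. \<forall>k. hodge_type k \<noteq> p \<longrightarrow> co k u = 0}"
        by (intro image_eqI[of _ _ "N *v u"]) (simp_all add: MN)
    qed (auto simp: c)
    then show ?thesis by (simp add: act_def x_eq)
  qed
  ultimately show ?thesis unfolding hodge_frame_def by (simp add: b c co_bv)
qed

text \<open>The map carrying one frame to the other preserves all coordinates. Conjugation and
  \<open>Q\<close> have the same coordinate expressions in both frames, so the map is real and
  preserves \<open>Q\<close>.\<close>

lemma transitive:
  assumes f': "hodge_frame Q x' (f' :: 'n option \<Rightarrow> complex^'m)"
  shows "\<exists>g\<in>aut_group Q. act g x = x'"
proof -
  interpret F: framed Q x' f' by unfold_locales (rule f')
  define M where "M = matrix (\<lambda>u. \<Sum>k\<in>UNIV. co k u *s F.bv k)"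
  have M: "M *v u = (\<Sum>k\<in>UNIV. co k u *s F.bv k)" for u
    unfolding M_def by (rule matrix_works)
      (auto simp: Vector_Spaces.linear_iff vec.vector_space_axioms coord_linear sum.distrib
        vec.scale_left_distrib vec.scale_sum_right)
  have c: "F.co k (M *v u) = co k u" for k u by (simp add: M F.co_sum_bv)
  have "M *v cnj_vec u = cnj_vec (M *v u)" for u
    by (rule F.co_eqI) (simp add: c coord_cnj_vec)
  then obtain g where g: "complexify g = M" using real_matrix_exists by blast
  have Qg: "Q (complexify g *v u) (complexify g *v w) = Q u w" for u w
    by (simp only: g F.Q_expand[of "M *v u" "M *v w"] Q_expand[of u w] c)
  have "g *v a = 0 \<Longrightarrow> a = 0" for a
  proof -
    assume "g *v a = 0"
    then have "complexify g *v (\<chi> i. complex_of_real (a $ i)) = 0"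
      by (simp add: vec_eq_iff matrix_vector_mult_def complexify_def flip: of_real_mult of_real_sum)
    then have "co k (\<chi> i. complex_of_real (a $ i)) = 0" for k
      using c[of k "\<chi> i. complex_of_real (a $ i)"] by (simp add: g coord_linear)
    then have "(\<chi> i. complex_of_real (a $ i)) = 0" by (intro co_eqI) (simp add: coord_linear)
    then show "a = 0" by (simp add: vec_eq_iff)
  qed
  then have "invertible g" using matrix_left_invertible_ker[of g] by (simp add: invertible_left_inverse)
  then have ga: "g \<in> aut_group Q" using Qg by (simp add: aut_group_def)
  have "(\<lambda>a. complexify g *v f a) = f'"
  proof
    fix a
    show "complexify g *v f a = f' a"
      unfolding g
      by (rule F.co_eqI) (use co_bv[of _ "(a, True)"] F.co_bv[of _ "(a, True)"] in \<open>simp add: c basis_vec_def\<close>)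
  qed
  then have "hodge_frame Q (act g x) f'" using frame_act[OF ga] by simp
  then have "act g x = x'" using f' unfolding hodge_frame_def by (simp add: fun_eq_iff)
  then show ?thesis using ga by blast
qed

end

section \<open>Lie algebras and the Killing form\<close>

fun mat_power :: "real^'m^'m \<Rightarrow> nat \<Rightarrow> real^'m^'m"
  where "mat_power A 0 = mat 1" | "mat_power A (Suc k) = mat_power A k ** A"

definition mat_exp :: "real^'m^'m \<Rightarrow> real \<Rightarrow> real^'m^'m"
  where "mat_exp A t = (\<chi> i j. \<Sum>k. mat_power A k $ i $ j / fact k * t ^ k)"

lemma mat_power_bound:
  fixes A :: "real^'m^'m"
  shows "\<exists>C. \<forall>k i j. \<bar>mat_power A k $ i $ j\<bar> \<le> C ^ k"
proof -
  define B where "B = Max (range (\<lambda>(i, j). \<bar>A $ i $ j\<bar>))"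
  have B: "\<bar>A $ i $ j\<bar> \<le> B" for i j
    unfolding B_def by (rule Max_ge) (auto intro!: image_eqI[of _ _ "(i, j)"])
  have B0: "0 \<le> B" using B[of undefined undefined] by linarith
  have "\<bar>mat_power A k $ i $ j\<bar> \<le> (real CARD('m) * B) ^ k" for k i j
  proof (induction k arbitrary: i j)
    case 0 then show ?case by (simp add: mat_def)
  next
    case (Suc k)
    have "\<bar>mat_power A (Suc k) $ i $ j\<bar> \<le> (\<Sum>l\<in>UNIV. \<bar>mat_power A k $ i $ l * A $ l $ j\<bar>)"
      by (simp add: matrix_matrix_mult_def)
    also have "\<dots> \<le> (\<Sum>l\<in>(UNIV::'m set). (real CARD('m) * B) ^ k * B)"
    proof (rule sum_mono)
      fix l :: 'm
      show "\<bar>mat_power A k $ i $ l * A $ l $ j\<bar> \<le> (real CARD('m) * B) ^ k * B"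
        unfolding abs_mult by (rule mult_mono[OF Suc B]) (auto simp: B0)
    qed
    also have "\<dots> = (real CARD('m) * B) ^ Suc k" by simp
    finally show ?case .
  qed
  then show ?thesis by blast
qed

lemma mat_exp_summable: "summable (\<lambda>k. mat_power A k $ i $ j / fact k * t ^ k)"
proof -
  obtain C where C: "\<bar>mat_power A k $ i $ j\<bar> \<le> C ^ k" for k i j using mat_power_bound[of A] by blast
  show ?thesis
  proof (rule summable_comparison_test)
    show "\<exists>N. \<forall>k\<ge>N. norm (mat_power A k $ i $ j / fact k * t ^ k) \<le> inverse (fact k) * (C * \<bar>t\<bar>) ^ k"
    proof (intro exI allI impI)
      fix k
      have "\<bar>mat_power A k $ i $ j\<bar> * \<bar>t\<bar> ^ k / fact k \<le> C ^ k * \<bar>t\<bar> ^ k / fact k"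
        by (intro divide_right_mono mult_right_mono C) auto
      then show "norm (mat_power A k $ i $ j / fact k * t ^ k) \<le> inverse (fact k) * (C * \<bar>t\<bar>) ^ k"
        by (simp add: abs_mult power_abs power_mult_distrib field_simps)
    qed
    show "summable (\<lambda>k. inverse (fact k) * (C * \<bar>t\<bar>) ^ k)" by (rule summable_exp)
  qed
qed

lemma has_vector_derivative_matrix:
  fixes F :: "real \<Rightarrow> real^'m^'k"
  assumes "\<And>i j. ((\<lambda>t. F t $ i $ j) has_real_derivative D $ i $ j) (at t)"
  shows "(F has_vector_derivative D) (at t)"
  using assms unfolding has_vector_derivative_def has_derivative_componentwise_within[of F]
  by (auto simp: Basis_vec_def inner_axis has_field_derivative_def mult_commute_abs)

lemma has_vector_derivative_matrix_nth:
  fixes F :: "real \<Rightarrow> real^'m^'k"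
  assumes "(F has_vector_derivative D) (at t)"
  shows "((\<lambda>t. F t $ i $ j) has_real_derivative D $ i $ j) (at t)"
proof -
  have "bounded_linear (\<lambda>M :: real^'m^'k. M $ i $ j)"
    by (intro bounded_linear_compose[OF bounded_linear_vec_nth bounded_linear_vec_nth, unfolded o_def])
  from bounded_linear.has_vector_derivative[OF this assms] show ?thesis
    by (simp add: has_real_derivative_iff_has_vector_derivative)
qed

lemma mat_exp_0: "mat_exp A 0 = mat 1"
  by (simp add: mat_exp_def vec_eq_iff powser_zero del: times_divide_eq_left)

lemma mat_exp_derivative: "(mat_exp A has_vector_derivative mat_exp A t ** A) (at t)"
proof (rule has_vector_derivative_matrix)
  fix i j
  define c where "c k = mat_power A k $ i $ j / fact k" for k
  have "((\<lambda>t. \<Sum>k. c k * t ^ k) has_real_derivative (\<Sum>k. diffs c k * t ^ k)) (at t)"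
    by (rule termdiffs_strong_converges_everywhere) (unfold c_def, rule mat_exp_summable)
  moreover have "diffs c k * t ^ k = (\<Sum>l\<in>UNIV. mat_power A k $ i $ l / fact k * t ^ k * A $ l $ j)" for k
  proof -
    have "diffs c k = mat_power A (Suc k) $ i $ j / fact k"
      by (simp add: diffs_def c_def fact_Suc del: mat_power.simps of_nat_Suc)
    then show ?thesis by (simp add: matrix_matrix_mult_def sum_divide_distrib sum_distrib_left sum_distrib_right mult_ac)
  qed
  moreover have "(\<Sum>k. \<Sum>l\<in>UNIV. mat_power A k $ i $ l / fact k * t ^ k * A $ l $ j) = (mat_exp A t ** A) $ i $ j"
  proof -
    have "(\<Sum>k. \<Sum>l\<in>UNIV. mat_power A k $ i $ l / fact k * t ^ k * A $ l $ j) =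
        (\<Sum>l\<in>UNIV. \<Sum>k. mat_power A k $ i $ l / fact k * t ^ k * A $ l $ j)"
      by (intro suminf_sum summable_mult2 mat_exp_summable)
    also have "\<dots> = (\<Sum>l\<in>UNIV. (\<Sum>k. mat_power A k $ i $ l / fact k * t ^ k) * A $ l $ j)"
      by (intro sum.cong refl suminf_mult2[symmetric] mat_exp_summable)
    finally show ?thesis by (simp add: matrix_matrix_mult_def mat_exp_def)
  qed
  ultimately show "((\<lambda>t. mat_exp A t $ i $ j) has_real_derivative (mat_exp A t ** A) $ i $ j) (at t)"
    by (simp add: mat_exp_def c_def)
qed

lemma mat_exp_linear_zero:
  assumes "\<And>k. (\<Sum>i\<in>UNIV. \<Sum>j\<in>UNIV. c i j * mat_power A k $ i $ j) = 0"
  shows "(\<Sum>i\<in>UNIV. \<Sum>j\<in>UNIV. c i j * mat_exp A t $ i $ j) = 0"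
proof -
  have "(\<Sum>i\<in>UNIV. \<Sum>j\<in>UNIV. c i j * mat_exp A t $ i $ j) =
      (\<Sum>k. \<Sum>i\<in>UNIV. \<Sum>j\<in>UNIV. c i j * (mat_power A k $ i $ j / fact k * t ^ k))"
  proof -
    have "(\<lambda>k. \<Sum>i\<in>UNIV. \<Sum>j\<in>UNIV. c i j * (mat_power A k $ i $ j / fact k * t ^ k)) sums
        (\<Sum>i\<in>UNIV. \<Sum>j\<in>UNIV. c i j * (\<Sum>k. mat_power A k $ i $ j / fact k * t ^ k))"
      by (intro sums_sum sums_mult summable_sums mat_exp_summable)
    from sums_unique[OF this] show ?thesis by (simp add: mat_exp_def del: times_divide_eq_left)
  qed
  also have "\<dots> = (\<Sum>k. (\<Sum>i\<in>UNIV. \<Sum>j\<in>UNIV. c i j * mat_power A k $ i $ j) / fact k * t ^ k)"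
    by (simp add: sum_distrib_right sum_distrib_left sum_divide_distrib mult_ac)
  also have "\<dots> = 0" by (simp add: assms)
  finally show ?thesis .
qed

text \<open>\<open>trace_on\<close> uses an arbitrarily chosen basis. Composing with a projection
  onto \<open>S\<close> extends the endomorphism to the whole space without changing its trace,
  which can then be computed in the standard basis.\<close>

lemma trace_on_projection:
  fixes S :: "'v::euclidean_space set"
  assumes S: "subspace S" and P: "linear P" "\<And>v. P v \<in> S" "\<And>v. v \<in> S \<Longrightarrow> P v = v"
    and T: "linear T" "\<And>v. v \<in> S \<Longrightarrow> T v \<in> S"
  shows "trace_on S T = (\<Sum>b\<in>Basis. b \<bullet> T (P b))"
proof -
  define E where "E = (SOME E. independent E \<and> span E = S)"
  have "\<exists>E. independent E \<and> span E = S"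
    using basis_exists[of S] S by (metis span_subspace)
  then have E: "independent E" "span E = S" unfolding E_def by (metis (mono_tags, lifting) someI_ex)+
  have fin: "finite E" using E(1) independent_imp_finite by blast
  have ES: "e \<in> S" if "e \<in> E" for e using E that span_base by metis
  have rep: "v = (\<Sum>e\<in>E. representation E v e *\<^sub>R e)" if "v \<in> S" for v
    using sum_representation_eq[OF E(1) _ fin, of v] E(2) that by simp
  have "(\<Sum>b\<in>Basis. b \<bullet> T (P b)) = (\<Sum>b\<in>Basis. \<Sum>e\<in>E. representation E (P b) e * (b \<bullet> T e))"
  proof (rule sum.cong)
    fix b
    have "T (P b) = T (\<Sum>e\<in>E. representation E (P b) e *\<^sub>R e)" using rep[OF P(2)] by simp
    then show "b \<bullet> T (P b) = (\<Sum>e\<in>E. representation E (P b) e * (b \<bullet> T e))"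
      by (simp add: linear_sum[OF T(1)] linear_scale[OF T(1)] inner_sum_right)
  qed simp
  also have "\<dots> = (\<Sum>e\<in>E. \<Sum>b\<in>Basis. representation E (P b) e * (b \<bullet> T e))" by (rule sum.swap)
  also have "\<dots> = (\<Sum>e\<in>E. representation E (T e) e)"
  proof (rule sum.cong)
    fix e assume e: "e \<in> E"
    have "T e = P (T e)" using P(3) T(2)[OF ES[OF e]] by simp
    also have "\<dots> = P (\<Sum>b\<in>Basis. (b \<bullet> T e) *\<^sub>R b)" by (simp add: inner_commute[of _ "T e"] euclidean_representation)
    also have "\<dots> = (\<Sum>b\<in>Basis. (b \<bullet> T e) *\<^sub>R P b)" by (simp add: linear_sum[OF P(1)] linear_scale[OF P(1)])
    finally have "representation E (T e) e = representation E (\<Sum>b\<in>Basis. (b \<bullet> T e) *\<^sub>R P b) e" by simp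
    also have "\<dots> = (\<Sum>b\<in>Basis. representation E ((b \<bullet> T e) *\<^sub>R P b) e)"
      by (subst representation_sum[OF E(1)]) (use P(2) E(2) S in \<open>auto simp: subspace_scale\<close>)
    also have "\<dots> = (\<Sum>b\<in>Basis. (b \<bullet> T e) * representation E (P b) e)"
      by (intro sum.cong refl) (use representation_scale[OF E(1)] P(2) E(2) in auto)
    finally show "(\<Sum>b\<in>Basis. representation E (P b) e * (b \<bullet> T e)) = representation E (T e) e"
      by (simp add: mult.commute)
  qed simp
  finally show ?thesis by (simp add: trace_on_def E_def[symmetric] Let_def)
qed

section \<open>The trace of a product of adjoint maps on the symplectic Lie algebra\<close>

definition symplectic_algebra :: "real^'m^'m \<Rightarrow> (real^'m^'m) set"
  where "symplectic_algebra \<Omega> = {X. transpose X ** \<Omega> + \<Omega> ** X = 0}"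

lemma matrix_ring_simps:
  fixes A B C :: "real^'m^'m"
  shows "A ** (B + C) = A ** B + A ** C" "(B + C) ** A = B ** A + C ** A"
    "A ** (B - C) = A ** B - A ** C" "(B - C) ** A = B ** A - C ** A"
    "(- A) ** B = - (A ** B)" "A ** (- B) = - (A ** B)"
    "(c *\<^sub>R A) ** B = c *\<^sub>R (A ** B)" "A ** (c *\<^sub>R B) = c *\<^sub>R (A ** B)"
  by (simp_all add: vec_eq_iff matrix_matrix_mult_def sum.distrib sum_subtractf sum_negf sum_distrib_left algebra_simps)

lemma transpose_simps:
  fixes A B :: "real^'m^'m"
  shows "transpose (A + B) = transpose A + transpose B" "transpose (- A) = - transpose A"
    "transpose (A - B) = transpose A - transpose B" "transpose (c *\<^sub>R A) = c *\<^sub>R transpose A"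
  by (simp_all add: vec_eq_iff transpose_def)

lemma trace_real_simps:
  fixes A B :: "real^'m^'m"
  shows "trace (- A) = - trace A" "trace (c *\<^sub>R A) = c * trace A"
  by (simp_all add: trace_def sum_negf sum_distrib_left)

lemma sum_Basis_matrix:
  "(\<Sum>b\<in>(Basis :: (real^'m^'m) set). G b) = (\<Sum>i\<in>UNIV. \<Sum>j\<in>UNIV. G (axis i (axis j 1)))"
proof -
  have "(Basis :: (real^'m^'m) set) = (\<lambda>(i, j). axis i (axis j 1)) ` UNIV"
    by (auto simp: Basis_vec_def)
  moreover have inj: "inj (\<lambda>(i, j). axis i (axis j (1::real)) :: real^'m^'m)"
    by (auto simp: inj_on_def axis_eq_axis)
  ultimately have "(\<Sum>b\<in>(Basis :: (real^'m^'m) set). G b) = (\<Sum>(i, j)\<in>UNIV. G (axis i (axis j 1)))"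
    using sum.reindex[OF inj, of G] by (simp add: case_prod_unfold o_def)
  then show ?thesis by (simp add: sum.cartesian_product)
qed

text \<open>The left-hand sides are the traces, on the space of all matrices, of multiplication from
  both sides without and with a transposition. The double commutator and its composition with the
  symplectic adjoint expand into such maps.\<close>

lemma trace_left_right:
  fixes A B :: "real^'m^'m"
  shows "(\<Sum>b\<in>Basis. b \<bullet> (A ** b ** B)) = trace A * trace B"
    and "(\<Sum>b\<in>Basis. b \<bullet> (A ** transpose b ** B)) = trace (A ** transpose B)"
proof -
  have 1: "(A ** axis i (axis j 1) ** B) $ k $ l = A $ k $ i * B $ j $ l" for i j k l
  proof -
    have "A $ k $ s * (axis i (axis j 1) :: real^'m^'m) $ s $ r = (if s = i then (if r = j then A $ k $ i else 0) else 0)" for s r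
      by (simp add: axis_def)
    then have a: "(A ** axis i (axis j 1)) $ k $ r = (if r = j then A $ k $ i else 0)" for r
      by (simp add: matrix_matrix_mult_def)
    have "(A ** axis i (axis j 1)) $ k $ r * B $ r $ l = (if r = j then A $ k $ i * B $ j $ l else 0)" for r
      by (simp add: a)
    then show ?thesis by (simp add: matrix_matrix_mult_def[of "A ** _"])
  qed
  have 2: "transpose (axis i (axis j 1) :: real^'m^'m) = axis j (axis i 1)" for i j
    by (auto simp: transpose_def axis_def vec_eq_iff)
  show "(\<Sum>b\<in>Basis. b \<bullet> (A ** b ** B)) = trace A * trace B"
    by (simp add: sum_Basis_matrix inner_axis' 1 trace_def sum_product)
  show "(\<Sum>b\<in>Basis. b \<bullet> (A ** transpose b ** B)) = trace (A ** transpose B)"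
    unfolding sum_Basis_matrix 2
    by (simp add: inner_axis' 1) (simp add: trace_def matrix_matrix_mult_def transpose_def)
qed

text \<open>\<open>X\<close> is conjugate by \<open>\<Omega>\<close> to minus its transpose.\<close>

lemma symplectic_trace_zero:
  fixes \<Omega> :: "real^'m^'m"
  assumes \<Omega>: "\<Omega>' ** \<Omega> = mat 1" "\<Omega> ** \<Omega>' = mat 1" and X: "X \<in> symplectic_algebra \<Omega>"
  shows "trace X = 0"
proof -
  have "\<Omega> ** X = - (transpose X ** \<Omega>)" using X by (simp add: symplectic_algebra_def eq_neg_iff_add_eq_0 add.commute)
  then have "\<Omega>' ** (\<Omega> ** X) = - (\<Omega>' ** (transpose X ** \<Omega>))" by (simp add: matrix_ring_simps)
  then have "X = - (\<Omega>' ** transpose X ** \<Omega>)" by (simp add: matrix_mul_assoc \<Omega>)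
  then have "trace X = - trace (\<Omega>' ** transpose X ** \<Omega>)" by (metis trace_real_simps(1))
  also have "trace (\<Omega>' ** transpose X ** \<Omega>) = trace (\<Omega> ** (\<Omega>' ** transpose X))" by (rule trace_mul_sym)
  also have "\<dots> = trace X" by (simp add: matrix_mul_assoc \<Omega>, simp add: trace_def transpose_def)
  finally show ?thesis by simp
qed

text \<open>\<open>P\<close> projects all matrices onto the symplectic ones, so the trace is half of that of \<open>ad X ad Y\<close> on all
  matrices minus half of that of its composition with the symplectic adjoint.\<close>

lemma trace_ad_ad_symplectic:
  fixes \<Omega> :: "real^'m^'m"
  assumes \<Omega>: "\<Omega>' ** \<Omega> = mat 1" "\<Omega> ** \<Omega>' = mat 1" and skew: "transpose \<Omega> = - \<Omega>"
    and X: "X \<in> symplectic_algebra \<Omega>" and Y: "Y \<in> symplectic_algebra \<Omega>"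
  shows "trace_on (symplectic_algebra \<Omega>) (\<lambda>Z. bracket X (bracket Y Z)) = (real CARD('m) + 2) * trace (X ** Y)"
proof -
  \<comment> \<open>\<open>\<Omega>' ** transpose Z ** \<Omega>\<close> is the symplectic adjoint of
    \<open>Z\<close>, an involution whose eigenspace for \<open>-1\<close> is the algebra.\<close>
  define P where "P Z = (1/2) *\<^sub>R (Z - \<Omega>' ** transpose Z ** \<Omega>)" for Z :: "real^'m^'m"
  define T where "T Z = bracket X (bracket Y Z)" for Z
  have sk': "transpose \<Omega>' = - \<Omega>'"
  proof -
    have "transpose \<Omega> ** transpose \<Omega>' = mat 1" by (simp add: matrix_transpose_mul[symmetric] \<Omega>)
    then have "\<Omega>' ** (transpose \<Omega> ** transpose \<Omega>') = \<Omega>'" by simp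
    then show ?thesis by (simp add: skew matrix_ring_simps matrix_mul_assoc \<Omega>) (metis minus_minus)
  qed
  have tr: "transpose Z ** \<Omega> = - (\<Omega> ** Z)" if "Z \<in> symplectic_algebra \<Omega>" for Z
    using that by (simp add: symplectic_algebra_def eq_neg_iff_add_eq_0)
  have sub: "subspace (symplectic_algebra \<Omega>)"
  proof -
    have z: "transpose (0::real^'m^'m) ** \<Omega> + \<Omega> ** 0 = 0"
      by (simp add: vec_eq_iff matrix_matrix_mult_def transpose_def)
    have a: "transpose (A + C) ** \<Omega> + \<Omega> ** (A + C) = (transpose A ** \<Omega> + \<Omega> ** A) + (transpose C ** \<Omega> + \<Omega> ** C)" for A C
      by (simp add: transpose_simps matrix_ring_simps)
    have c: "transpose (r *\<^sub>R A) ** \<Omega> + \<Omega> ** (r *\<^sub>R A) = r *\<^sub>R (transpose A ** \<Omega> + \<Omega> ** A)" for r A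
      by (simp add: transpose_simps matrix_ring_simps scaleR_add_right)
    show ?thesis unfolding subspace_def symplectic_algebra_def mem_Collect_eq
      using z by (simp add: a c)
  qed
  have linP: "linear P"
    by (rule linearI) (simp_all add: P_def transpose_simps matrix_ring_simps algebra_simps)
  have PS: "P Z \<in> symplectic_algebra \<Omega>" for Z
  proof -
    have "\<Omega> ** (\<Omega>' ** transpose Z ** \<Omega>) = transpose Z ** \<Omega>"
      by (simp add: matrix_mul_assoc \<Omega>)
    moreover have "transpose (\<Omega>' ** transpose Z ** \<Omega>) ** \<Omega> = \<Omega> ** Z"
    proof -
      have "transpose (\<Omega>' ** transpose Z ** \<Omega>) ** \<Omega> = transpose \<Omega> ** (transpose (transpose Z) ** transpose \<Omega>') ** \<Omega>"
        by (simp only: matrix_transpose_mul)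
      also have "\<dots> = \<Omega> ** Z ** (\<Omega>' ** \<Omega>)"
        by (simp add: transpose_transpose skew sk' matrix_ring_simps matrix_mul_assoc)
      finally show ?thesis by (simp add: \<Omega>)
    qed
    ultimately show ?thesis
      by (simp add: symplectic_algebra_def P_def transpose_simps matrix_ring_simps)
         (simp add: scaleR_diff_right[symmetric] scaleR_add_right[symmetric])
  qed
  have Pid: "P Z = Z" if "Z \<in> symplectic_algebra \<Omega>" for Z
  proof -
    have "\<Omega>' ** transpose Z ** \<Omega> = - Z"
      by (simp add: matrix_mul_assoc[symmetric] tr[OF that] matrix_ring_simps) (simp add: matrix_mul_assoc \<Omega>)
    then show ?thesis by (simp add: P_def scaleR_2[symmetric])
  qed
  have linT: "linear T"
    by (rule linearI) (simp_all add: T_def bracket_def matrix_ring_simps algebra_simps)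
  have br: "bracket A C \<in> symplectic_algebra \<Omega>" if "A \<in> symplectic_algebra \<Omega>" "C \<in> symplectic_algebra \<Omega>" for A C
  proof -
    have 1: "transpose (A ** C) ** \<Omega> = \<Omega> ** (C ** A)" if "A \<in> symplectic_algebra \<Omega>" "C \<in> symplectic_algebra \<Omega>" for A C
    proof -
      have "transpose (A ** C) ** \<Omega> = transpose C ** (transpose A ** \<Omega>)" by (simp add: matrix_transpose_mul matrix_mul_assoc)
      also have "\<dots> = - (transpose C ** \<Omega> ** A)" by (simp add: tr[OF that(1)] matrix_ring_simps matrix_mul_assoc)
      also have "\<dots> = \<Omega> ** (C ** A)" by (simp add: tr[OF that(2)] matrix_ring_simps matrix_mul_assoc)
      finally show ?thesis .
    qed
    show ?thesis
      using 1[OF that] 1[OF that(2,1)]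
      by (simp add: symplectic_algebra_def bracket_def transpose_simps matrix_ring_simps)
  qed
  have "trace_on (symplectic_algebra \<Omega>) T = (\<Sum>b\<in>Basis. b \<bullet> T (P b))"
    by (rule trace_on_projection[OF sub linP PS Pid linT]) (auto simp: T_def br X Y)
  also have "\<dots> = (\<Sum>b\<in>Basis. (1/2) * (b \<bullet> T b) - (1/2) * (b \<bullet> T (\<Omega>' ** transpose b ** \<Omega>)))"
    by (simp add: P_def linear_scale[OF linT] linear_diff[OF linT] inner_diff_right right_diff_distrib)
  also have "\<dots> = (1/2) * (\<Sum>b\<in>Basis. b \<bullet> T b) - (1/2) * (\<Sum>b\<in>Basis. b \<bullet> T (\<Omega>' ** transpose b ** \<Omega>))"
    by (simp add: sum_subtractf sum_distrib_left)
  \<comment> \<open>Of the four terms of the double commutator the two mixed ones give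
    \<open>trace X * trace Y\<close>, which vanishes; each of the others gives
    \<open>CARD('m)\<close> times the trace of the product.\<close>
  also have "(\<Sum>b\<in>Basis. b \<bullet> T b) = 2 * real CARD('m) * trace (X ** Y)"
  proof -
    have "b \<bullet> T b = b \<bullet> ((X ** Y) ** b ** mat 1) - b \<bullet> (X ** b ** Y) - b \<bullet> (Y ** b ** X) + b \<bullet> (mat 1 ** b ** (Y ** X))" for b
      by (simp add: T_def bracket_def matrix_ring_simps matrix_mul_assoc inner_diff_right inner_add_right)
    then have "(\<Sum>b\<in>Basis. b \<bullet> T b) = trace (X ** Y) * trace (mat 1 :: real^'m^'m) - trace X * trace Y - trace Y * trace X + trace (mat 1 :: real^'m^'m) * trace (Y ** X)"
      by (simp only: sum.distrib sum_subtractf trace_left_right)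
    then show ?thesis
      by (simp add: symplectic_trace_zero[OF \<Omega> X] trace_mul_sym[of Y X] trace_I)
  qed
  \<comment> \<open>Here each of the four terms gives \<open>- trace (X ** Y)\<close>. With the
    factors \<open>1/2\<close> and \<open>-1/2\<close> the two sums combine to the coefficient
    \<open>CARD('m) + 2\<close>.\<close>
  also have "(\<Sum>b\<in>Basis. b \<bullet> T (\<Omega>' ** transpose b ** \<Omega>)) = - 4 * trace (X ** Y)"
  proof -
    have "b \<bullet> T (\<Omega>' ** transpose b ** \<Omega>) = b \<bullet> ((X ** Y ** \<Omega>') ** transpose b ** \<Omega>) - b \<bullet> ((X ** \<Omega>') ** transpose b ** (\<Omega> ** Y))
      - b \<bullet> ((Y ** \<Omega>') ** transpose b ** (\<Omega> ** X)) + b \<bullet> (\<Omega>' ** transpose b ** (\<Omega> ** Y ** X))" for b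
      by (simp add: T_def bracket_def matrix_ring_simps matrix_mul_assoc inner_diff_right inner_add_right)
    then have "(\<Sum>b\<in>Basis. b \<bullet> T (\<Omega>' ** transpose b ** \<Omega>)) = trace ((X ** Y ** \<Omega>') ** transpose \<Omega>)
      - trace ((X ** \<Omega>') ** transpose (\<Omega> ** Y)) - trace ((Y ** \<Omega>') ** transpose (\<Omega> ** X)) + trace (\<Omega>' ** transpose (\<Omega> ** Y ** X))"
      by (simp only: sum.distrib sum_subtractf trace_left_right)
    moreover have "(X ** Y ** \<Omega>') ** transpose \<Omega> = - (X ** Y)"
      by (simp add: skew matrix_ring_simps matrix_mul_assoc[symmetric] \<Omega>)
    moreover have t1: "(A ** \<Omega>') ** transpose (\<Omega> ** C) = A ** C" if "C \<in> symplectic_algebra \<Omega>" for A C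
    proof -
      have "transpose (\<Omega> ** C) = - (transpose C ** \<Omega>)" by (simp add: matrix_transpose_mul skew matrix_ring_simps)
      also have "\<dots> = \<Omega> ** C" by (simp add: tr[OF that])
      finally show ?thesis by (simp add: matrix_mul_assoc) (simp add: matrix_mul_assoc[symmetric] \<Omega>)
    qed
    moreover have "\<Omega>' ** transpose (\<Omega> ** Y ** X) = \<Omega>' ** transpose X ** \<Omega> ** Y"
    proof -
      have "transpose (\<Omega> ** Y ** X) = transpose X ** transpose (\<Omega> ** Y)" by (simp add: matrix_transpose_mul)
      also have "transpose (\<Omega> ** Y) = \<Omega> ** Y" by (simp add: matrix_transpose_mul skew matrix_ring_simps tr[OF Y])
      finally show ?thesis by (simp add: matrix_mul_assoc)
    qed
    moreover have "\<Omega>' ** transpose X ** \<Omega> = - X"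
      by (simp add: matrix_mul_assoc[symmetric] tr[OF X] matrix_ring_simps) (simp add: matrix_mul_assoc \<Omega>)
    ultimately show ?thesis
      by (simp add: t1[OF X] t1[OF Y] trace_mul_sym[of Y X] matrix_ring_simps trace_real_simps)
  qed
  finally show ?thesis by (simp add: T_def[abs_def] algebra_simps)
qed

lemma continuous_on_matrixI:
  fixes M :: "'b::topological_space \<Rightarrow> real^'k^'l"
  assumes "\<And>p q. continuous_on S (\<lambda>s. M s $ p $ q)"
  shows "continuous_on S M"
proof -
  have "continuous_on S (\<lambda>s. \<chi> p. M s $ p)"
    by (intro continuous_on_vec_lambda)
       (use continuous_on_vec_lambda[of S "\<lambda>q s. M s $ _ $ q"] assms in simp)
  then show ?thesis by simp
qed

lemma continuous_on_matrix_nth: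
  fixes M :: "'b::topological_space \<Rightarrow> real^'k^'l"
  assumes "continuous_on S M"
  shows "continuous_on S (\<lambda>s. M s $ p $ q)"
  using assms by (intro continuous_intros)

lemma continuous_on_det:
  fixes M :: "'b::topological_space \<Rightarrow> real^'k^'k"
  assumes "\<And>p q. continuous_on S (\<lambda>s. M s $ p $ q)"
  shows "continuous_on S (\<lambda>s. det (M s))"
  unfolding det_def by (intro continuous_intros assms)

lemma continuous_on_matrix_inv:
  fixes M :: "'b::topological_space \<Rightarrow> real^'k^'k"
  assumes M: "continuous_on S M" and "\<And>s. s \<in> S \<Longrightarrow> invertible (M s)"
  shows "continuous_on S (\<lambda>s. matrix_inv (M s))"
proof (rule continuous_on_matrixI)
  fix p q
  have d: "det (M s) \<noteq> 0" if "s \<in> S" for s using assms(2)[OF that] by (simp add: invertible_det_nz)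
  have "continuous_on S (\<lambda>s. det (\<chi> i j. if j = p then (axis q 1 :: real^'k) $ i else M s $ i $ j) / det (M s))"
  proof (intro continuous_on_divide continuous_on_det)
    fix i j
    show "continuous_on S (\<lambda>s. (\<chi> i j. if j = p then (axis q 1 :: real^'k) $ i else M s $ i $ j) $ i $ j)"
      using continuous_on_matrix_nth[OF M] by (cases "j = p") auto
  qed (use d continuous_on_matrix_nth[OF M] in auto)
  then show "continuous_on S (\<lambda>s. matrix_inv (M s) $ p $ q)"
    by (rule continuous_on_eq) (simp add: matrix_inv_cramer[OF d])
qed

lemma continuous_on_matrix_mult:
  fixes M N :: "'b::topological_space \<Rightarrow> real^'k^'k"
  assumes "continuous_on S M" "continuous_on S N"
  shows "continuous_on S (\<lambda>s. M s ** N s)"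
  by (rule continuous_on_matrixI)
     (unfold matrix_matrix_mult_def, simp, intro continuous_intros continuous_on_matrix_nth assms)

lemma matrix_sum_axis:
  fixes M :: "real^'m^'m"
  shows "M = (\<Sum>i\<in>UNIV. \<Sum>j\<in>UNIV. M $ i $ j *\<^sub>R axis i (axis j 1))"
proof -
  have "(\<Sum>i\<in>UNIV. \<Sum>j\<in>UNIV. M $ i $ j *\<^sub>R axis i (axis j 1)) $ p $ q = M $ p $ q" for p q
  proof -
    have "(\<Sum>i\<in>UNIV. \<Sum>j\<in>UNIV. M $ i $ j *\<^sub>R axis i (axis j 1)) $ p $ q
      = (\<Sum>i\<in>UNIV. \<Sum>j\<in>UNIV. if j = q then (if i = p then M $ i $ j else 0) else 0)"
      unfolding sum_component by (intro sum.cong refl) (auto simp: axis_def)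
    then show ?thesis by simp
  qed
  then show ?thesis by (simp add: vec_eq_iff)
qed

text \<open>A linear condition on the exponential need only be checked on powers. It serves for
  commutation with \<open>A\<close> and for the vanishing of blocks.\<close>

lemma mat_exp_linear_kernel:
  fixes L :: "real^'m^'m \<Rightarrow> real"
  assumes L: "linear L" and 0: "\<And>k. L (mat_power A k) = 0"
  shows "L (mat_exp A t) = 0"
proof -
  have L': "L M = (\<Sum>i\<in>UNIV. \<Sum>j\<in>UNIV. L (axis i (axis j 1)) * M $ i $ j)" for M
    by (subst matrix_sum_axis[of M]) (simp add: linear_sum[OF L] linear_scale[OF L] mult.commute)
  show ?thesis
    by (rule trans[OF L' mat_exp_linear_zero]) (rule trans[OF L'[symmetric] 0])
qed

lemma transpose_mult_mult_nth:
  fixes X G Y :: "real^'m^'m"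
  shows "(transpose X ** G ** Y) $ p $ q = (\<Sum>j\<in>UNIV. (\<Sum>i\<in>UNIV. X $ i $ p * G $ i $ j) * Y $ j $ q)"
  by (simp add: matrix_matrix_mult_def transpose_def)

lemma mat_power_commute: "A ** mat_power A k = mat_power A k ** A"
proof (induction k)
  case (Suc k)
  then show ?case by (simp only: mat_power.simps matrix_mul_assoc)
qed simp

lemma mat_exp_commute: "A ** mat_exp A t = mat_exp A t ** A"
proof -
  have "(A ** mat_exp A t) $ p $ q - (mat_exp A t ** A) $ p $ q = 0" for p q
  proof (rule mat_exp_linear_kernel[where L = "\<lambda>M. (A ** M) $ p $ q - (M ** A) $ p $ q"])
    show "linear (\<lambda>M. (A ** M) $ p $ q - (M ** A) $ p $ q)"
      by (rule linearI) (simp_all add: matrix_ring_simps algebra_simps)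
  qed (simp add: mat_power_commute)
  then show ?thesis by (simp add: vec_eq_iff)
qed

section \<open>The polarization as a real skew matrix\<close>

context polarized
begin

text \<open>Taking the real part loses nothing, since the coordinate vectors are fixed by
  conjugation (\<open>Q_axis\<close>). Membership in the group and in its Lie algebra becomes a
  matrix equation.\<close>

definition gram :: "real^'m^'m"
  where "gram = (\<chi> i j. Re (Q (axis i 1) (axis j 1)))"

lemma Q_axis: "Q (axis i 1) (axis j 1) = complex_of_real (gram $ i $ j)"
proof -
  have "cnj_vec (axis i 1) = axis i 1" for i :: 'm by (simp add: vec_eq_iff axis_def)
  then have "cnj (Q (axis i 1) (axis j 1)) = Q (axis i 1) (axis j 1)" using Q_cnj[of "axis i 1" "axis j 1"] by simp
  then show ?thesis by (simp add: gram_def complex_eq_iff)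
qed

lemma Q_gram: "Q u w = (\<Sum>i\<in>UNIV. \<Sum>j\<in>UNIV. u $ i * w $ j * complex_of_real (gram $ i $ j))"
proof -
  have e: "v = (\<Sum>i\<in>UNIV. v $ i *s axis i 1)" for v :: "complex^'m"
    by (simp add: vec_eq_iff axis_def if_distrib cong: if_cong)
  have "Q u w = (\<Sum>i\<in>UNIV. u $ i * Q (axis i 1) w)" by (subst e[of u]) (simp add: Q_sum Q_left)
  moreover have "Q (axis i 1) w = (\<Sum>j\<in>UNIV. w $ j * Q (axis i 1) (axis j 1))" for i
    by (subst e[of w]) (simp add: Q_sum Q_right)
  ultimately show ?thesis by (simp add: Q_axis sum_distrib_left mult.assoc)
qed

lemma gram_skew: "transpose gram = - gram"
proof -
  have "complex_of_real (gram $ j $ i) = - complex_of_real (gram $ i $ j)" for i j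
    using Q_skew[of "axis i 1" "axis j 1"] by (simp add: Q_axis)
  then have g: "gram $ j $ i = - gram $ i $ j" for i j
    by (metis of_real_eq_iff of_real_minus)
  have "transpose gram $ i $ j = (- gram) $ i $ j" for i j
  proof -
    have "transpose gram $ i $ j = gram $ j $ i" by (simp add: transpose_def)
    also have "\<dots> = - gram $ i $ j" by (rule g)
    also have "\<dots> = (- gram) $ i $ j" by simp
    finally show ?thesis .
  qed
  then show ?thesis by (simp only: vec_eq_iff simp_thms)
qed

lemma gram_inverse: "\<exists>\<Omega>'. \<Omega>' ** gram = mat 1 \<and> gram ** \<Omega>' = mat 1"
proof -
  have "a = 0" if "gram *v a = 0" for a
  proof -
    define c where "c = (\<chi> i. complex_of_real (a $ i))"
    have "Q c w = 0" for w
    proof -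
      have "Q w c = (\<Sum>i\<in>UNIV. w $ i * complex_of_real ((gram *v a) $ i))"
      proof -
        have "(\<Sum>j\<in>UNIV. w $ i * c $ j * complex_of_real (gram $ i $ j)) = w $ i * complex_of_real ((gram *v a) $ i)" for i
        proof -
          have "(\<Sum>j\<in>UNIV. w $ i * c $ j * complex_of_real (gram $ i $ j)) = (\<Sum>j\<in>UNIV. w $ i * complex_of_real (gram $ i $ j * a $ j))"
            by (intro sum.cong refl) (simp add: c_def)
          also have "\<dots> = w $ i * complex_of_real (\<Sum>j\<in>UNIV. gram $ i $ j * a $ j)"
            by (simp only: sum_distrib_left of_real_sum)
          finally show ?thesis by (simp add: matrix_vector_mult_def)
        qed
        then show ?thesis by (simp only: Q_gram)
      qed
      then have "Q w c = 0" by (simp add: that)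
      then show ?thesis by (subst Q_skew) simp
    qed
    then have "c = 0" by (rule Q_nondeg)
    then show "a = 0" by (simp add: c_def vec_eq_iff)
  qed
  then obtain B where "B ** gram = mat 1" using matrix_left_invertible_ker[of gram] by blast
  then show ?thesis using matrix_left_right_inverse by blast
qed

lemma Q_complexify:
  "Q (complexify A *v u) (complexify B *v w) =
    (\<Sum>i\<in>UNIV. \<Sum>j\<in>UNIV. u $ i * w $ j * complex_of_real ((transpose A ** gram ** B) $ i $ j))"
proof -
  have e: "v = (\<Sum>i\<in>UNIV. v $ i *s axis i 1)" for v :: "complex^'m"
    by (simp add: vec_eq_iff axis_def if_distrib cong: if_cong)
  have 1: "Q (complexify A *v axis i 1) (complexify B *v axis j 1) = complex_of_real ((transpose A ** gram ** B) $ i $ j)" for i j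
  proof -
    have "(complexify C *v axis i 1) $ k = complex_of_real (C $ k $ i)" for C :: "real^'m^'m" and i k
      by (simp add: matrix_vector_mult_def complexify_def axis_def if_distrib cong: if_cong)
    then have "Q (complexify A *v axis i 1) (complexify B *v axis j 1) =
       complex_of_real (\<Sum>k\<in>UNIV. \<Sum>l\<in>UNIV. A $ k $ i * B $ l $ j * gram $ k $ l)"
      by (simp only: Q_gram of_real_sum of_real_mult)
    also have "(\<Sum>k\<in>UNIV. \<Sum>l\<in>UNIV. A $ k $ i * B $ l $ j * gram $ k $ l) = (\<Sum>l\<in>UNIV. \<Sum>k\<in>UNIV. A $ k $ i * B $ l $ j * gram $ k $ l)"
      by (rule sum.swap)
    also have "\<dots> = (transpose A ** gram ** B) $ i $ j"
      unfolding transpose_mult_mult_nth sum_distrib_right by (intro sum.cong refl) simp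
    finally show ?thesis .
  qed
  have a: "Q (complexify A *v u) v = (\<Sum>i\<in>UNIV. u $ i * Q (complexify A *v axis i 1) v)" for v
    by (subst e[of u]) (simp add: mat_vec_linear Q_sum Q_left)
  have b: "Q v (complexify B *v w) = (\<Sum>j\<in>UNIV. w $ j * Q v (complexify B *v axis j 1))" for v
    by (subst e[of w]) (simp add: mat_vec_linear Q_sum Q_right)
  show ?thesis by (subst a) (simp only: b 1 sum_distrib_left mult.assoc)
qed

lemma bilinear_zero_iff:
  "(\<forall>u w. (\<Sum>i\<in>UNIV. \<Sum>j\<in>UNIV. u $ i * w $ j * complex_of_real (M $ i $ j)) = 0) \<longleftrightarrow> M = (0 :: real^'m^'m)"
proof
  assume A: "\<forall>u w. (\<Sum>i\<in>UNIV. \<Sum>j\<in>UNIV. u $ i * w $ j * complex_of_real (M $ i $ j)) = 0"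
  have "M $ p $ q = 0" for p q
  proof -
    have "(\<Sum>i\<in>UNIV. \<Sum>j\<in>UNIV. (axis p 1 :: complex^'m) $ i * (axis q 1 :: complex^'m) $ j * complex_of_real (M $ i $ j))
      = (\<Sum>i\<in>UNIV. \<Sum>j\<in>UNIV. if j = q then (if i = p then complex_of_real (M $ i $ j) else 0) else 0)"
      by (intro sum.cong refl) (auto simp: axis_def)
    then show ?thesis using A by simp
  qed
  then show "M = 0" by (simp add: vec_eq_iff)
qed simp

lemma infinitesimal_complexify: "infinitesimal Q (complexify A) \<longleftrightarrow> A \<in> symplectic_algebra gram"
proof -
  have "Q (complexify A *v u) w + Q u (complexify A *v w) =
     (\<Sum>i\<in>UNIV. \<Sum>j\<in>UNIV. u $ i * w $ j * complex_of_real ((transpose A ** gram + gram ** A) $ i $ j))" for u w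
    using Q_complexify[of A u "mat 1" w] Q_complexify[of "mat 1" u A w]
    by (simp add: complexify_simps sum.distrib distrib_left transpose_mat)
  then show ?thesis
    unfolding infinitesimal_def symplectic_algebra_def mem_Collect_eq by (simp only: bilinear_zero_iff)
qed

lemma aut_group_iff: "g \<in> aut_group Q \<longleftrightarrow> transpose g ** gram ** g = gram"
proof -
  have 1: "(\<forall>u w. Q (complexify g *v u) (complexify g *v w) = Q u w) \<longleftrightarrow> transpose g ** gram ** g - gram = 0"
  proof -
    have "Q (complexify g *v u) (complexify g *v w) - Q u w =
       (\<Sum>i\<in>UNIV. \<Sum>j\<in>UNIV. u $ i * w $ j * complex_of_real ((transpose g ** gram ** g - gram) $ i $ j))" for u w
      unfolding Q_complexify[of g u g w] Q_gram[of u w] by (simp add: sum_subtractf right_diff_distrib)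
    then have "(\<forall>u w. Q (complexify g *v u) (complexify g *v w) - Q u w = 0) \<longleftrightarrow> transpose g ** gram ** g - gram = 0"
      by (simp only: bilinear_zero_iff)
    then show ?thesis by (simp only: right_minus_eq)
  qed
  have "invertible g" if "transpose g ** gram ** g = gram"
  proof -
    obtain \<Omega>' where "\<Omega>' ** gram = mat 1" using gram_inverse by blast
    then have "(\<Omega>' ** transpose g ** gram) ** g = mat 1"
      using that by (simp add: matrix_mul_assoc[symmetric])
    then show ?thesis unfolding invertible_left_inverse by blast
  qed
  then show ?thesis using 1 by (auto simp: aut_group_def)
qed

end

section \<open>Groups of block matrices in a frame and their Lie algebras\<close>

context framed
begin

text \<open>Automorphisms with a prescribed block pattern. The full group, \<open>V\<close> and
  \<open>K\<close> all have this form, for the trivial relation, \<open>same_type\<close> and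
  \<open>same_side\<close>, so one argument finds all their Lie algebras.\<close>

definition rel_group :: "('n option \<times> bool \<Rightarrow> 'n option \<times> bool \<Rightarrow> bool) \<Rightarrow> (real^'m^'m) set"
  where "rel_group R = {g \<in> aut_group Q. \<forall>k l. \<not> R k l \<longrightarrow> ent (complexify g) k l = 0}"

definition rel_algebra :: "('n option \<times> bool \<Rightarrow> 'n option \<times> bool \<Rightarrow> bool) \<Rightarrow> (real^'m^'m) set"
  where "rel_algebra R = {A \<in> symplectic_algebra gram. \<forall>k l. \<not> R k l \<longrightarrow> ent (complexify A) k l = 0}"

lemma ent_mat_1: "ent (mat 1) k l = (if k = l then 1 else 0)"
  by (simp add: entry_def co_bv)

lemma ent_scaleR: "ent (complexify (c *\<^sub>R A)) k l = complex_of_real c * ent (complexify A) k l"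
proof -
  have "complexify (c *\<^sub>R A) *v u = complex_of_real c *s (complexify A *v u)" for u
    by (simp add: complexify_def vec_eq_iff matrix_vector_mult_def sum_distrib_left mult.assoc)
  then show ?thesis by (simp add: entry_def coord_linear)
qed

lemma linear_ent: "linear (\<lambda>A. ent (complexify A) k l)"
  by (rule linearI) (simp_all add: complexify_simps(3) ent_linear ent_scaleR scaleR_conv_of_real[where 'a=complex])

lemma gram_derivative:
  fixes \<gamma> :: "real \<Rightarrow> real^'m^'m"
  assumes "(\<gamma> has_vector_derivative D) (at t)"
  shows "((\<lambda>t. (transpose (\<gamma> t) ** gram ** \<gamma> t) $ p $ q) has_real_derivative
    (transpose D ** gram ** \<gamma> t + transpose (\<gamma> t) ** gram ** D) $ p $ q) (at t)"
proof -
  note d = has_vector_derivative_matrix_nth[OF assms]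
  have "((\<lambda>t. \<Sum>j\<in>UNIV. (\<Sum>i\<in>UNIV. \<gamma> t $ i $ p * gram $ i $ j) * \<gamma> t $ j $ q) has_real_derivative
    (\<Sum>j\<in>UNIV. (\<Sum>i\<in>UNIV. D $ i $ p * gram $ i $ j) * \<gamma> t $ j $ q + D $ j $ q * (\<Sum>i\<in>UNIV. \<gamma> t $ i $ p * gram $ i $ j))) (at t)"
    by (intro derivative_intros DERIV_cmult_right d)
  then show ?thesis
    unfolding vector_add_component transpose_mult_mult_nth by (simp add: sum.distrib mult.commute)
qed

text \<open>One inclusion differentiates the defining equations at \<open>0\<close>. For the other,
  reflexivity and transitivity of \<open>R\<close> make the powers of \<open>A\<close>, hence its
  exponential, keep the block pattern, and the form pulled back by the exponential has derivative
  zero.\<close>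

lemma lie_alg_rel_group:
  assumes R: "reflp R" "transp R"
  shows "lie_alg (rel_group R) = rel_algebra R"
proof (intro equalityI subsetI)
  fix A assume "A \<in> lie_alg (rel_group R)"
  then obtain \<gamma> where \<gamma>: "\<gamma> 0 = mat 1" "\<And>t. (\<gamma> has_vector_derivative \<gamma> t ** A) (at t)" "\<And>t. \<gamma> t \<in> rel_group R"
    unfolding lie_alg_def by blast
  have "(transpose A ** gram + gram ** A) $ p $ q = 0" for p q
  proof -
    have "transpose (\<gamma> t) ** gram ** \<gamma> t = gram" for t using \<gamma>(3)[of t] by (simp add: rel_group_def aut_group_iff)
    with gram_derivative[OF \<gamma>(2)[of 0], of p q]
    have "((\<lambda>t. gram $ p $ q) has_real_derivative (transpose A ** gram + gram ** A) $ p $ q) (at 0)"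
      by (simp add: \<gamma>(1) transpose_mat)
    then show ?thesis by (rule DERIV_unique) simp
  qed
  then have "A \<in> symplectic_algebra gram" by (simp add: symplectic_algebra_def vec_eq_iff)
  moreover have "ent (complexify A) k l = 0" if "\<not> R k l" for k l
  proof -
    have "bounded_linear (\<lambda>A. ent (complexify A) k l)"
      using linear_ent linear_conv_bounded_linear by blast
    from bounded_linear.has_vector_derivative[OF this \<gamma>(2)[of 0]]
    have "((\<lambda>t. ent (complexify (\<gamma> t)) k l) has_vector_derivative ent (complexify A) k l) (at 0)"
      by (simp add: \<gamma>(1))
    moreover have "ent (complexify (\<gamma> t)) k l = 0" for t using \<gamma>(3) that by (simp add: rel_group_def)
    ultimately have "((\<lambda>t. 0) has_vector_derivative ent (complexify A) k l) (at 0)" by simp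
    then show ?thesis using vector_derivative_unique_at[OF _ has_vector_derivative_const] by blast
  qed
  ultimately show "A \<in> rel_algebra R" by (simp add: rel_algebra_def)
next
  fix A assume A: "A \<in> rel_algebra R"
  then have sp: "transpose A ** gram + gram ** A = 0" by (simp add: rel_algebra_def symplectic_algebra_def)
  let ?g = "mat_exp A"
  have "transpose (?g t) ** gram ** ?g t = gram" for t
  proof -
    have "(transpose (?g t) ** gram ** ?g t) $ p $ q = (transpose (?g 0) ** gram ** ?g 0) $ p $ q" for p q
    proof (rule DERIV_isconst_all[where f = "\<lambda>t. (transpose (?g t) ** gram ** ?g t) $ p $ q"], intro allI)
      fix t
      have "transpose (?g t ** A) ** gram ** ?g t + transpose (?g t) ** gram ** (?g t ** A) = transpose (?g t) ** (transpose A ** gram + gram ** A) ** ?g t"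
        unfolding mat_exp_commute[symmetric]
        by (simp add: matrix_transpose_mul matrix_ring_simps matrix_mul_assoc)
      with gram_derivative[OF mat_exp_derivative[of A t], of p q]
      show "((\<lambda>t. (transpose (?g t) ** gram ** ?g t) $ p $ q) has_real_derivative 0) (at t)"
        by (simp add: sp)
    qed
    then show ?thesis by (simp add: vec_eq_iff mat_exp_0 transpose_mat)
  qed
  moreover have "ent (complexify (?g t)) k l = 0" if kl: "\<not> R k l" for k l t
  proof -
    have pw: "ent (complexify (mat_power A r)) k l = 0" if "\<not> R k l" for r k l
      using that
    proof (induction r arbitrary: k l)
      case 0 then show ?case using R(1) by (auto simp: complexify_simps ent_mat_1 reflp_def)
    next
      case (Suc r)
      have "ent (complexify (mat_power A r)) k j * ent (complexify A) j l = 0" for j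
      proof (cases "R k j")
        case True
        then have "\<not> R j l" using Suc R(2) by (meson transpE)
        then show ?thesis using A by (simp add: rel_algebra_def)
      next
        case False then show ?thesis using Suc by simp
      qed
      then show ?case by (simp only: mat_power.simps complexify_simps ent_mult sum.neutral_const)
    qed
    have "linear (\<lambda>A. Re (ent (complexify A) k l))" "linear (\<lambda>A. Im (ent (complexify A) k l))"
      using linear_ent[of k l] by (auto simp: linear_iff)
    from this[THEN mat_exp_linear_kernel] show ?thesis using pw[OF kl] by (simp add: complex_eq_iff)
  qed
  ultimately have "?g t \<in> rel_group R" for t by (simp add: rel_group_def aut_group_iff)
  then show "A \<in> lie_alg (rel_group R)"
    unfolding lie_alg_def using mat_exp_0 mat_exp_derivative by blast
qed

lemma lie_alg_aut_group: "lie_alg (aut_group Q) = symplectic_algebra gram"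
  using lie_alg_rel_group[of "\<lambda>k l. True"] by (simp add: rel_group_def rel_algebra_def reflp_def transp_def)

lemma killing_form_eq:
  assumes "X \<in> symplectic_algebra gram" "Y \<in> symplectic_algebra gram"
  shows "killing_form Q X Y = (real CARD('m) + 2) * trace (X ** Y)"
  using gram_inverse trace_ad_ad_symplectic[OF _ _ gram_skew assms]
  by (auto simp: killing_form_def lie_alg_aut_group)

lemma aut_inverse_adjoint:
  assumes g: "g \<in> aut_group Q"
  shows "Q (complexify (matrix_inv g) *v u) w = Q u (complexify g *v w)"
proof -
  have inv: "invertible g" and Qg: "\<And>u w. Q (complexify g *v u) (complexify g *v w) = Q u w"
    using g by (auto simp: aut_group_def)
  have "complexify g *v (complexify (matrix_inv g) *v u) = u"
    unfolding matrix_vector_mul_assoc complexify_simps(1)[symmetric] invertible_matrix_inv(2)[OF inv] complexify_simps(2) by simp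
  then show ?thesis using Qg[of "complexify (matrix_inv g) *v u" w] by simp
qed

text \<open>The inverse is the \<open>Q\<close>-adjoint, and \<open>Q\<close> pairs an index with
  its flip. A block group is therefore closed under inverses when its relation is stable under
  reversing and flipping a pair.\<close>

lemma ent_inverse:
  assumes g: "g \<in> aut_group Q"
  shows "ent (complexify (matrix_inv g)) k l = 0 \<longleftrightarrow> ent (complexify g) (flip l) (flip k) = 0"
proof -
  have "ent (complexify (matrix_inv g)) k l = (if snd k then - \<i> else \<i>) * Q (bv l) (complexify g *v bv (flip k))"
    by (simp add: entry_def coord_eq_Q aut_inverse_adjoint[OF g])
  moreover have "Q (bv l) v = (if snd l then \<i> else - \<i>) * co (flip l) v" for v
    using Q_skew[of "bv l" v] by (auto simp: coord_eq_Q)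
  ultimately show ?thesis by (simp add: entry_def)
qed

lemma aut_group_closed:
  assumes "g \<in> aut_group Q" "h \<in> aut_group Q"
  shows "g ** h \<in> aut_group Q" "matrix_inv g \<in> aut_group Q"
proof -
  have g: "invertible g" "\<And>u w. Q (complexify g *v u) (complexify g *v w) = Q u w"
    and h: "invertible h" "\<And>u w. Q (complexify h *v u) (complexify h *v w) = Q u w"
    using assms by (auto simp: aut_group_def)
  show "g ** h \<in> aut_group Q"
    using g h by (simp add: aut_group_def complexify_simps invertible_mult flip: matrix_vector_mul_assoc)
  have "invertible (matrix_inv g)" unfolding invertible_def using invertible_matrix_inv[OF g(1)] by blast
  moreover have "Q (complexify (matrix_inv g) *v u) (complexify (matrix_inv g) *v w) = Q u w" for u w
    using aut_inverse_adjoint[OF assms(1), of u "complexify (matrix_inv g) *v w"]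
    unfolding matrix_vector_mul_assoc complexify_simps(1)[symmetric] invertible_matrix_inv(2)[OF g(1)] complexify_simps(2)
    by simp
  ultimately show "matrix_inv g \<in> aut_group Q" by (simp add: aut_group_def)
qed

lemma rel_group_subgroup:
  assumes R: "reflp R" "transp R" "\<And>k l. R k l \<Longrightarrow> R (flip l) (flip k)"
  shows "matrix_subgroup (rel_group R)"
  unfolding matrix_subgroup_def
proof (intro conjI ballI)
  show "mat 1 \<in> rel_group R"
    using R(1) by (auto simp: rel_group_def aut_group_iff transpose_mat complexify_simps ent_mat_1 reflp_def)
  fix g assume g: "g \<in> rel_group R"
  then have ga: "g \<in> aut_group Q" by (simp add: rel_group_def)
  show "invertible g" using ga by (simp add: aut_group_def)
  have "\<not> R (flip l) (flip k)" if "\<not> R k l" for k l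
    using R(3)[of "flip l" "flip k"] that by auto
  then show "matrix_inv g \<in> rel_group R"
    using g aut_group_closed(2)[OF ga ga] by (simp add: rel_group_def ent_inverse[OF ga])
  fix h assume h: "h \<in> rel_group R"
  have "ent (complexify g) k j * ent (complexify h) j l = 0" if "\<not> R k l" for k l j
  proof (cases "R k j")
    case True
    then have "\<not> R j l" using that R(2) by (meson transpE)
    then show ?thesis using h by (simp add: rel_group_def)
  next
    case False then show ?thesis using g by (simp add: rel_group_def)
  qed
  then have "ent (complexify (g ** h)) k l = 0" if "\<not> R k l" for k l
    using that by (simp only: complexify_simps ent_mult sum.neutral_const not_False_eq_True)
  then show "g ** h \<in> rel_group R" using g h by (simp add: rel_group_def aut_group_closed)
qed

definition same_type :: "'n option \<times> bool \<Rightarrow> 'n option \<times> bool \<Rightarrow> bool"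
  where "same_type k l \<longleftrightarrow> hodge_type k = hodge_type l"

text \<open>The side separates types (3,0) and (1,2), the eigenspace of the Weil operator for
  \<open>\<i>\<close>, from their conjugates.\<close>

definition same_side :: "'n option \<times> bool \<Rightarrow> 'n option \<times> bool \<Rightarrow> bool"
  where "same_side k l \<longleftrightarrow> snd k = snd l"

lemma same_rel: "reflp same_type" "transp same_type" "\<And>k l. same_type k l \<Longrightarrow> same_type (flip l) (flip k)"
   "reflp same_side" "transp same_side" "\<And>k l. same_side k l \<Longrightarrow> same_side (flip l) (flip k)"
  by (auto simp: same_type_def same_side_def reflp_def transp_def hodge_type_flip)

lemma same_type_side: "same_type k l \<Longrightarrow> same_side k l"
  by (auto simp: same_type_def same_side_def hodge_type_def split: if_splits)

text \<open>An element of the block group maps each \<open>x p\<close> into itself, and even onto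
  itself because its inverse belongs to the block group too.\<close>

lemma stabilizer_eq: "stabilizer Q x = rel_group same_type"
proof (intro equalityI subsetI)
  fix g assume g: "g \<in> stabilizer Q x"
  then have "complexify g *v bv l \<in> x (hodge_type l)" for l
    using bv_mem[of l] unfolding stabilizer_def act_def by (metis (mono_tags, lifting) imageI mem_Collect_eq)
  then show "g \<in> rel_group same_type"
    using g by (auto simp: stabilizer_def rel_group_def same_type_def entry_def x_eq)
next
  fix g assume g: "g \<in> rel_group same_type"
  have sub: "(\<lambda>u. complexify h *v u) ` x p \<subseteq> x p" if h: "h \<in> rel_group same_type" for h p
  proof (intro image_subsetI)
    fix u assume u: "u \<in> x p"
    have "ent (complexify h) k l * co l u = 0" if "hodge_type k \<noteq> p" for k l
      using h u that by (cases "hodge_type l = p") (simp_all add: rel_group_def same_type_def x_eq)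
    then have "co k (complexify h *v u) = 0" if "hodge_type k \<noteq> p" for k
      using that by (simp only: co_mult sum.neutral_const simp_thms not_False_eq_True)
    then show "complexify h *v u \<in> x p" by (simp add: x_eq)
  qed
  have ga: "g \<in> aut_group Q" using g by (simp add: rel_group_def)
  have gi: "matrix_inv g \<in> rel_group same_type"
    using rel_group_subgroup[OF same_rel(1-3)] g by (simp add: matrix_subgroup_def)
  have inv: "invertible g" using ga by (simp add: aut_group_def)
  have "complexify g *v (complexify (matrix_inv g) *v u) = u" for u
    unfolding matrix_vector_mul_assoc complexify_simps(1)[symmetric] invertible_matrix_inv(2)[OF inv] complexify_simps(2) by simp
  then have "x p \<subseteq> (\<lambda>u. complexify g *v u) ` x p" for p
    using sub[OF gi, of p] by (metis image_subset_iff imageI subsetI)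
  then have "(\<lambda>u. complexify g *v u) ` x p = x p" for p using sub[OF g, of p] by (intro equalityI)
  then have "act g x = x" unfolding act_def by (rule ext)
  then show "g \<in> stabilizer Q x" using ga by (simp add: stabilizer_def)
qed

end

section \<open>The maximal compact subgroup\<close>

lemma norm_matrix_le:
  fixes M :: "real^'k^'l"
  shows "norm M \<le> (\<Sum>i\<in>UNIV. \<Sum>j\<in>UNIV. \<bar>M $ i $ j\<bar>)"
proof -
  have "norm M \<le> (\<Sum>i\<in>UNIV. norm (M $ i))" unfolding norm_vec_def by (rule L2_set_le_sum) auto
  also have "\<dots> \<le> (\<Sum>i\<in>UNIV. \<Sum>j\<in>UNIV. \<bar>M $ i $ j\<bar>)" by (intro sum_mono norm_le_l1_cart)
  finally show ?thesis .
qed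

lemma cmod_sum_mult_square:
  fixes a b :: "'k \<Rightarrow> complex"
  shows "(cmod (\<Sum>k\<in>S. a k * b k))\<^sup>2 \<le> (\<Sum>k\<in>S. (cmod (a k))\<^sup>2) * (\<Sum>k\<in>S. (cmod (b k))\<^sup>2)"
proof -
  have "cmod (\<Sum>k\<in>S. a k * b k) \<le> (\<Sum>k\<in>S. cmod (a k) * cmod (b k))"
    by (rule order_trans[OF norm_sum]) (simp add: norm_mult)
  then have "(cmod (\<Sum>k\<in>S. a k * b k))\<^sup>2 \<le> (\<Sum>k\<in>S. cmod (a k) * cmod (b k))\<^sup>2"
    by (intro power_mono) auto
  also have "\<dots> \<le> (\<Sum>k\<in>S. (cmod (a k))\<^sup>2) * (\<Sum>k\<in>S. (cmod (b k))\<^sup>2)" by (rule Cauchy_Schwarz_ineq_sum)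
  finally show ?thesis .
qed

text \<open>Eigenvalues of an isometry have modulus one and eigenvectors for different eigenvalues
  are orthogonal, hence independent, so the dimension bounds their number. This is used to find a
  rotation that avoids the eigenvalue \<open>-1\<close>.\<close>

lemma finite_eigenvalues_isometry:
  fixes h :: "complex^'m \<Rightarrow> complex^'m \<Rightarrow> complex" and M :: "complex^'m^'m"
  assumes add: "\<And>u v w. h (u + v) w = h u w + h v w" and scale: "\<And>c u w. h (c *s u) w = c * h u w"
    and sym: "\<And>u w. h w u = cnj (h u w)" and pos: "\<And>u. u \<noteq> 0 \<Longrightarrow> h u u \<noteq> 0"
    and iso: "\<And>u w. h (M *v u) (M *v w) = h u w"
  shows "finite {c. \<exists>v. v \<noteq> 0 \<and> M *v v = c *s v}" (is "finite ?E")
proof -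
  define v where "v c = (SOME v. v \<noteq> 0 \<and> M *v v = c *s v)" for c
  have v: "v c \<noteq> 0" "M *v v c = c *s v c" if "c \<in> ?E" for c
    using someI_ex[of "\<lambda>v. v \<noteq> 0 \<and> M *v v = c *s v"] that by (auto simp: v_def)
  have scale': "h w (c *s u) = cnj c * h w u" for c w u by (simp add: sym[of w] scale)
  have unit: "c * cnj c = 1" if "c \<in> ?E" for c
    using iso[of "v c" "v c"] v[OF that] pos[of "v c"] by (simp add: scale scale' mult.commute)
  have orth: "h (v c) (v d) = 0" if "c \<in> ?E" "d \<in> ?E" "c \<noteq> d" for c d
  proof (rule ccontr)
    assume nz: "h (v c) (v d) \<noteq> 0"
    have "c * cnj d * h (v c) (v d) = h (v c) (v d)"
      using iso[of "v c" "v d"] v[OF that(1)] v[OF that(2)] by (simp add: scale scale' mult_ac)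
    then have "c * cnj d = 1" using nz by simp
    then have "c * (cnj d * d) = d" by (simp add: mult.assoc[symmetric])
    then show False using unit[OF that(2)] that(3) by (simp add: mult.commute)
  qed
  have h0: "h 0 w = 0" for w using scale[of 0 0 w] by simp
  have hsum: "h (\<Sum>k\<in>S. g k) w = (\<Sum>k\<in>S. h (g k) w)" for S :: "(complex^'m) set" and g w
    by (induction S rule: infinite_finite_induct) (simp_all add: add h0)
  have ind: "vec.independent (v ` F)" if "finite F" "F \<subseteq> ?E" for F
    unfolding vec.independent_explicit_finite_subsets
  proof (intro allI impI ballI)
    fix S u w assume S: "S \<subseteq> v ` F" "finite S" "(\<Sum>w\<in>S. u w *s w) = 0" "w \<in> S"
    obtain c where c: "w = v c" "c \<in> F" using subsetD[OF S(1,4)] by (rule imageE)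
    have cE: "c \<in> ?E" using that(2) c(2) by (rule subsetD)
    have "0 = h (\<Sum>w\<in>S. u w *s w) w" by (simp add: S h0)
    also have "\<dots> = (\<Sum>y\<in>S. u y * h y w)" by (simp add: hsum scale)
    also have "\<dots> = (\<Sum>y\<in>S. if y = w then u w * h w w else 0)"
    proof (rule sum.cong)
      fix y assume "y \<in> S"
      with S(1) have "y \<in> v ` F" by (rule subsetD)
      then obtain d where d: "y = v d" "d \<in> F" by (rule imageE)
      have dE: "d \<in> ?E" using that(2) d(2) by (rule subsetD)
      have "d \<noteq> c" if "y \<noteq> w" using that c d by auto
      then show "u y * h y w = (if y = w then u w * h w w else 0)"
        using orth[OF dE cE] c d by auto
    qed simp
    also have "\<dots> = u w * h w w" using S by simp
    finally show "u w = 0" using pos[of w] v[OF cE] c(1) by simp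
  qed
  have inj: "inj_on v ?E"
  proof (rule inj_onI, rule ccontr)
    fix c d assume cd: "c \<in> ?E" "d \<in> ?E" "v c = v d" "c \<noteq> d"
    then show False using orth[OF cd(1,2,4)] pos[of "v c"] v[OF cd(1)] by simp
  qed
  show ?thesis
  proof (rule ccontr)
    assume "infinite ?E"
    then obtain F where F: "finite F" "card F = Suc (vec.dim (UNIV :: (complex^'m) set))" "F \<subseteq> ?E"
      using infinite_arbitrarily_large by blast
    have "card (v ` F) = card F" using inj F by (meson card_image inj_on_subset)
    moreover have "card (v ` F) \<le> vec.dim (UNIV :: (complex^'m) set)"
      by (rule vec.independent_card_le_dim[OF _ ind]) (use F in auto)
    ultimately show False using F by simp
  qed
qed

section \<open>The Weil operator, its positive form, and compact groups containing it\<close>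

context framed
begin

definition nrm :: "complex^'m \<Rightarrow> real"
  where "nrm u = (\<Sum>k\<in>UNIV. (cmod (co k u))\<^sup>2)"

text \<open>The positive form for which the basis \<open>bv\<close> is orthonormal;
  \<open>nrm\<close> is its squared norm.\<close>

definition hip :: "complex^'m \<Rightarrow> complex^'m \<Rightarrow> complex"
  where "hip u w = (\<Sum>k\<in>UNIV. co k u * cnj (co k w))"

lemma hip_self: "hip u u = complex_of_real (nrm u)"
  by (simp add: hip_def nrm_def complex_mult_cnj cmod_power2)

lemma nrm_nonneg: "0 \<le> nrm u" by (simp add: nrm_def sum_nonneg)

lemma nrm_eq_0: "nrm u = 0 \<longleftrightarrow> u = 0"
proof
  assume "nrm u = 0"
  then have "co k u = 0" for k by (simp add: nrm_def sum_nonneg_eq_0_iff)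
  then show "u = 0" by (intro co_eqI) (simp add: coord_linear)
qed (simp add: nrm_def coord_linear)

lemma hip_linear: "hip (u + v) w = hip u w + hip v w" "hip (c *s u) w = c * hip u w"
    "hip (u - v) w = hip u w - hip v w" "hip w (u - v) = hip w u - hip w v"
  by (simp_all add: hip_def coord_linear sum.distrib sum_distrib_left sum_subtractf algebra_simps)

lemma hip_cnj: "hip w u = cnj (hip u w)"
  by (simp add: hip_def mult.commute)

lemma hip_bound: "(cmod (hip u w))\<^sup>2 \<le> nrm u * nrm w"
  using cmod_sum_mult_square[of "\<lambda>k. co k u" "\<lambda>k. cnj (co k w)" UNIV] by (simp add: hip_def nrm_def)

definition side_sign :: "'n option \<times> bool \<Rightarrow> complex"
  where "side_sign k = (if snd k then \<i> else - \<i>)"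

definition weil_matrix :: "complex^'m^'m"
  where "weil_matrix = frame_matrix (\<lambda>k l. if k = l then side_sign k else 0)"

lemma co_weil_matrix: "co k (weil_matrix *v u) = side_sign k * co k u"
  by (simp add: weil_matrix_def frame_matrix_mult co_sum_bv if_distrib if_distribR cong: if_cong)

definition weil :: "real^'m^'m"
  where "weil = (SOME g. complexify g = weil_matrix)"

lemma complexify_weil: "complexify weil = weil_matrix"
proof -
  have "weil_matrix *v cnj_vec u = cnj_vec (weil_matrix *v u)" for u
    by (rule co_eqI) (simp add: co_weil_matrix coord_cnj_vec side_sign_def)
  from real_matrix_exists[OF this] show ?thesis unfolding weil_def by (rule someI_ex)
qed

lemma co_weil: "co k (complexify weil *v u) = side_sign k * co k u"
  by (simp add: complexify_weil co_weil_matrix)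

lemma ent_weil: "ent (complexify weil) k l = (if k = l then side_sign k else 0)"
  by (simp add: entry_def co_weil co_bv)

lemma weil_square: "weil ** weil = - mat 1"
proof -
  have "complexify (weil ** weil) *v u = complexify (- mat 1) *v u" for u
  proof (rule co_eqI)
    fix k
    have "(- mat 1 :: complex^'m^'m) *v u = - u"
      using matrix_vector_mult_diff_rdistrib[of 0 "mat 1 :: complex^'m^'m" u] by simp
    moreover have "side_sign k * (side_sign k * co k u) = - co k u" by (simp add: side_sign_def)
    ultimately show "co k (complexify (weil ** weil) *v u) = co k (complexify (- mat 1) *v u)"
      by (simp add: complexify_simps(1,2,5) matrix_vector_mul_assoc[symmetric] co_weil coord_linear)
  qed
  then have "complexify (weil ** weil) = complexify (- mat 1)" unfolding matrix_eq by blast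
  then show ?thesis by (simp only: complexify_inject)
qed

lemma ent_weil_mult: "ent (complexify weil ** Y) k l = side_sign k * ent Y k l"
   "ent (Y ** complexify weil) k l = ent Y k l * side_sign l"
proof -
  show "ent (complexify weil ** Y) k l = side_sign k * ent Y k l"
    by (simp add: entry_def matrix_vector_mul_assoc[symmetric] co_weil)
  have "complexify weil *v bv l = side_sign l *s bv l"
    by (rule co_eqI) (simp add: co_weil coord_linear co_bv)
  then show "ent (Y ** complexify weil) k l = ent Y k l * side_sign l"
    by (simp add: entry_def matrix_vector_mul_assoc[symmetric] mat_vec_linear coord_linear)
qed

lemma weil_rel_group: "weil \<in> rel_group same_type" "weil \<in> aut_group Q"
proof -
  have Qw: "Q (complexify weil *v u) (complexify weil *v w) = Q u w" for u w
    by (simp only: Q_expand[of "complexify weil *v u" "complexify weil *v w"] Q_expand[of u w] co_weil)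
       (intro sum.cong refl, auto simp: side_sign_def)
  have "(- weil) ** weil = mat 1" by (simp add: matrix_ring_simps weil_square)
  then have "invertible weil" unfolding invertible_left_inverse by blast
  with Qw show "weil \<in> aut_group Q" by (simp add: aut_group_def)
  then show "weil \<in> rel_group same_type" by (auto simp: rel_group_def ent_weil same_type_def)
qed

text \<open>On each side the conjugated eigenvalue of \<open>weil\<close>, multiplied by
  \<open>\<i>\<close>, is the sign of \<open>herm Q\<close> there, so the signature is
  compensated.\<close>

lemma hip_herm: "hip u w = \<i> * herm Q u (complexify weil *v w)"
  unfolding herm_expand hip_def co_weil sum_distrib_left
  by (intro sum.cong refl) (auto simp: side_sign_def)

text \<open>The adjoint for \<open>hip\<close>: the inverse is the adjoint for \<open>Q\<close>, and
  conjugation by \<open>weil\<close> passes from \<open>Q\<close> to \<open>hip\<close>. As a word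
  in \<open>g\<close> and \<open>weil\<close> it stays in every group containing both.\<close>

definition adj :: "real^'m^'m \<Rightarrow> real^'m^'m"
  where "adj g = matrix_inv weil ** matrix_inv g ** weil"

lemma hip_adj:
  assumes g: "g \<in> aut_group Q"
  shows "hip (complexify g *v u) w = hip u (complexify (adj g) *v w)"
proof -
  let ?J = "complexify weil"
  have inv: "invertible g" "invertible weil" using g weil_rel_group(2) by (auto simp: aut_group_def)
  have c: "complexify a *v (complexify b *v v) = complexify (a ** b) *v v" for a b v
    by (simp add: complexify_simps matrix_vector_mul_assoc)
  have "Q (complexify g *v u) v = Q u (complexify (matrix_inv g) *v v)" for v
    using g unfolding aut_group_def mem_Collect_eq
    by (metis c invertible_matrix_inv(2)[OF inv(1)] complexify_simps(2) matrix_vector_mul_lid)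
  then have "herm Q (complexify g *v u) (?J *v w) = herm Q u (complexify (matrix_inv g) *v (?J *v w))"
    by (simp add: herm_def complexify_cnj_vec[symmetric])
  also have "complexify (matrix_inv g) *v (?J *v w) = ?J *v (complexify (adj g) *v w)"
    by (simp add: c adj_def matrix_mul_assoc invertible_matrix_inv[OF inv(2)])
  finally show ?thesis by (simp add: hip_herm)
qed

text \<open>Commuting with an operator whose eigenspaces are the two sides means preserving both of
  them.\<close>

lemma aut_group_same_side:
  assumes "g \<in> aut_group Q" "weil ** g = g ** weil"
  shows "g \<in> rel_group same_side"
proof -
  have "ent (complexify weil ** complexify g) k l = ent (complexify g ** complexify weil) k l" for k l
    using assms(2) by (simp add: complexify_simps(1)[symmetric])
  then have c: "side_sign k * ent (complexify g) k l = ent (complexify g) k l * side_sign l" for k l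
    by (simp only: ent_weil_mult)
  have "ent (complexify g) k l = 0" if "\<not> same_side k l" for k l
    using c[of k l] that by (auto simp: same_side_def side_sign_def split: if_splits)
  then show ?thesis using assms(1) by (simp add: rel_group_def)
qed

lemma same_side_commutes:
  assumes "g \<in> rel_group same_side"
  shows "weil ** g = g ** weil"
proof -
  have "side_sign k * ent (complexify g) k l = ent (complexify g) k l * side_sign l" for k l
    using assms by (cases "same_side k l") (auto simp: rel_group_def same_side_def side_sign_def)
  then have "complexify (weil ** g) = complexify (g ** weil)"
    by (intro ent_eqI) (simp only: complexify_simps(1) ent_weil_mult)
  then show ?thesis by (simp only: complexify_inject)
qed

lemma nrm_bound_compact:
  assumes "compact S"
  shows "\<exists>M>0. \<forall>g\<in>S. \<forall>u. nrm (complexify g *v u) \<le> M * nrm u"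
proof -
  have "\<exists>C. \<forall>g\<in>S. cmod (ent (complexify g) k l) \<le> C" for k l
  proof -
    have "bounded_linear (\<lambda>A. ent (complexify A) k l)" using linear_ent linear_conv_bounded_linear by blast
    then have "bounded ((\<lambda>A. ent (complexify A) k l) ` S)"
      using compact_imp_bounded[OF assms] bounded_linear_image by blast
    then show ?thesis by (auto simp: bounded_iff)
  qed
  then obtain C where C: "\<And>k l g. g \<in> S \<Longrightarrow> cmod (ent (complexify g) k l) \<le> C k l" by metis
  define M where "M = 1 + (\<Sum>k\<in>UNIV. \<Sum>l\<in>UNIV. (C k l)\<^sup>2)"
  have "nrm (complexify g *v u) \<le> M * nrm u" if g: "g \<in> S" for g u
  proof -
    have "nrm (complexify g *v u) \<le> (\<Sum>k\<in>UNIV. (\<Sum>l\<in>UNIV. (C k l)\<^sup>2) * nrm u)"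
      unfolding nrm_def[of "complexify g *v u"]
    proof (rule sum_mono)
      fix k
      have "(cmod (co k (complexify g *v u)))\<^sup>2 \<le> (\<Sum>l\<in>UNIV. (cmod (ent (complexify g) k l))\<^sup>2) * nrm u"
        unfolding co_mult nrm_def by (rule cmod_sum_mult_square)
      also have "\<dots> \<le> (\<Sum>l\<in>UNIV. (C k l)\<^sup>2) * nrm u"
        by (intro mult_right_mono sum_mono power_mono C g nrm_nonneg) auto
      finally show "(cmod (co k (complexify g *v u)))\<^sup>2 \<le> (\<Sum>l\<in>UNIV. (C k l)\<^sup>2) * nrm u" .
    qed
    also have "\<dots> = (M - 1) * nrm u" by (simp add: M_def sum_distrib_right)
    also have "\<dots> \<le> M * nrm u" using nrm_nonneg[of u] by (simp add: algebra_simps)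
    finally show ?thesis .
  qed
  moreover have "M > 0" unfolding M_def by (intro add_pos_nonneg sum_nonneg) auto
  ultimately show ?thesis by blast
qed

text \<open>If \<open>M\<close> bounds the squared norms of all elements of the group, so does \<open>sqrt M\<close>, because
  the group contains the adjoint of each of its elements.  Hence all elements are isometries.\<close>

lemma compact_group_same_side:
  assumes S: "matrix_subgroup S" "compact S" "S \<subseteq> aut_group Q" "weil \<in> S"
  shows "S \<subseteq> rel_group same_side"
proof -
  obtain M where M: "M > 0" "\<And>g u. g \<in> S \<Longrightarrow> nrm (complexify g *v u) \<le> M * nrm u"
    using nrm_bound_compact[OF S(2)] by blast
  have adjS: "adj g ** g \<in> S" if "g \<in> S" for g
    using S(1,4) that by (simp add: adj_def matrix_subgroup_def)
  have c: "complexify a *v (complexify b *v v) = complexify (a ** b) *v v" for a b v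
    by (simp add: complexify_simps matrix_vector_mul_assoc)
  have iter: "nrm (complexify g *v u) \<le> M powr (1 / 2 ^ j) * nrm u" if "g \<in> S" for g u j
    using that
  proof (induction j arbitrary: g u)
    case 0 then show ?case using M by simp
  next
    case (Suc j)
    have ga: "g \<in> aut_group Q" using Suc S by blast
    let ?n = "nrm (complexify g *v u)"
    have e: "hip u (complexify (adj g ** g) *v u) = complex_of_real ?n"
      using hip_adj[OF ga, of u "complexify g *v u"] by (simp add: hip_self c)
    \<comment> \<open>Cauchy-Schwarz for \<open>u\<close> and its image under
      \<open>adj g ** g\<close>, again an element of the group. Since the left-hand side is squared,
      a factor bounding \<open>nrm\<close> for all elements may be replaced by its square
      root.\<close>
    have "?n\<^sup>2 = (cmod (hip u (complexify (adj g ** g) *v u)))\<^sup>2" unfolding e by simp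
    also have "\<dots> \<le> nrm u * nrm (complexify (adj g ** g) *v u)" by (rule hip_bound)
    also have "\<dots> \<le> nrm u * (M powr (1 / 2 ^ j) * nrm u)"
      by (intro mult_left_mono Suc.IH adjS Suc.prems nrm_nonneg)
    also have "\<dots> = (M powr (1 / 2 ^ Suc j) * nrm u)\<^sup>2"
    proof -
      have "M powr (1 / 2 ^ j) = (M powr (1 / 2 ^ Suc j))\<^sup>2"
        using M(1) by (simp add: power2_eq_square powr_add[symmetric])
      then show ?thesis by (simp add: power2_eq_square)
    qed
    finally show ?case by (rule power2_le_imp_le) (intro mult_nonneg_nonneg nrm_nonneg, simp)
  qed
  have le: "nrm (complexify g *v u) \<le> nrm u" if "g \<in> S" for g u
  proof (rule LIMSEQ_le_const)
    have "(\<lambda>j. M powr ((1 / 2) ^ j) * nrm u) \<longlonglongrightarrow> M powr 0 * nrm u"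
      using M(1) by (intro tendsto_intros LIMSEQ_realpow_zero) auto
    then show "(\<lambda>j. M powr (1 / 2 ^ j) * nrm u) \<longlonglongrightarrow> nrm u" using M(1) by (simp add: power_one_over)
  qed (use iter[OF that] in blast)
  have eq: "nrm (complexify g *v u) = nrm u" if g: "g \<in> S" for g u
  proof -
    have inv: "invertible g" and gi: "matrix_inv g \<in> S" using S(1) g by (auto simp: matrix_subgroup_def)
    have "nrm (complexify (matrix_inv g) *v (complexify g *v u)) \<le> nrm (complexify g *v u)" by (rule le[OF gi])
    then have "nrm u \<le> nrm (complexify g *v u)" by (simp add: c invertible_matrix_inv[OF inv] complexify_simps)
    then show ?thesis using le[OF g, of u] by simp
  qed
  show ?thesis
  proof
    fix g assume g: "g \<in> S"
    have ga: "g \<in> aut_group Q" using g S by blast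
    \<comment> \<open>Both \<open>g\<close> and \<open>adj g ** g\<close> preserve
      \<open>nrm\<close>, and the product of \<open>u\<close> with its image under the latter is
      \<open>nrm u\<close>. This is the case of equality: the difference of the two vectors has norm
      zero.\<close>
    have "complexify (adj g ** g) *v u = u" for u
    proof -
      let ?v = "complexify (adj g ** g) *v u"
      have "hip u ?v = complex_of_real (nrm u)"
        using hip_adj[OF ga, of u "complexify g *v u"] eq[OF g, of u] by (simp add: hip_self c)
      moreover then have "hip ?v u = complex_of_real (nrm u)" using hip_cnj[of ?v u] by simp
      ultimately have "hip (?v - u) (?v - u) = 0"
        using eq[OF adjS[OF g], of u] by (simp only: hip_linear(3,4)) (simp add: hip_self)
      then show ?thesis by (simp add: hip_self nrm_eq_0)
    qed
    then have "complexify (adj g ** g) = complexify (mat 1)" by (simp add: matrix_eq complexify_simps)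
    then have "adj g ** g = mat 1" by (simp only: complexify_inject)
    then have a: "matrix_inv weil ** matrix_inv g ** weil ** g = mat 1" by (simp add: adj_def)
    have inv: "invertible g" "invertible weil" using ga weil_rel_group(2) by (auto simp: aut_group_def)
    have "g ** weil = g ** weil ** (matrix_inv weil ** matrix_inv g ** weil ** g)" by (simp add: a)
    also have "\<dots> = g ** (weil ** matrix_inv weil) ** matrix_inv g ** weil ** g" by (simp add: matrix_mul_assoc)
    also have "\<dots> = weil ** g" by (simp add: invertible_matrix_inv[OF inv(2)] invertible_matrix_inv[OF inv(1)])
    finally show "g \<in> rel_group same_side" using aut_group_same_side[OF ga] by simp
  qed
qed

lemma hip_same_side:
  assumes g: "g \<in> rel_group same_side"
  shows "hip (complexify g *v u) (complexify g *v w) = hip u w"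
proof -
  have "complexify weil *v (complexify g *v w) = complexify g *v (complexify weil *v w)"
    using same_side_commutes[OF g] by (simp add: matrix_vector_mul_assoc complexify_simps(1)[symmetric])
  moreover have "herm Q (complexify g *v u) (complexify g *v v) = herm Q u v" for v
    using g by (simp add: rel_group_def aut_group_def herm_def complexify_cnj_vec[symmetric])
  ultimately show ?thesis by (simp add: hip_herm)
qed

text \<open>Isometries of \<open>hip\<close> have bounded entries, and the group is cut out by
  polynomial equations.\<close>

lemma same_side_compact: "compact (rel_group same_side)"
  unfolding compact_eq_bounded_closed
proof
  have "\<exists>C. \<forall>g\<in>rel_group same_side. \<bar>g $ i $ j\<bar> \<le> C" for i j
  proof (intro exI ballI)
    fix g assume g: "g \<in> rel_group same_side"
    let ?u = "complexify g *v axis j 1"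
    have n: "nrm ?u = nrm (axis j 1)"
      using hip_same_side[OF g, of "axis j 1" "axis j 1"] by (simp add: hip_self)
    have "?u $ i = complex_of_real (g $ i $ j)"
      by (simp add: matrix_vector_mult_def complexify_def axis_def if_distrib cong: if_cong)
    then have "(g $ i $ j)\<^sup>2 = (cmod (?u $ i))\<^sup>2" by simp
    also have "?u $ i = (\<Sum>k\<in>UNIV. co k ?u * bv k $ i)"
      by (subst expand[of ?u]) simp
    also have "(cmod (\<Sum>k\<in>UNIV. co k ?u * bv k $ i))\<^sup>2 \<le> nrm (axis j 1) * (\<Sum>k\<in>UNIV. (cmod (bv k $ i))\<^sup>2)"
      by (subst n[symmetric]) (unfold nrm_def, rule cmod_sum_mult_square)
    finally show "\<bar>g $ i $ j\<bar> \<le> sqrt (nrm (axis j 1) * (\<Sum>k\<in>UNIV. (cmod (bv k $ i))\<^sup>2))"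
      using real_le_rsqrt by (metis abs_le_iff power2_minus minus_le_iff)
  qed
  then obtain C where C: "\<And>i j g. g \<in> rel_group same_side \<Longrightarrow> \<bar>g $ i $ j\<bar> \<le> C i j" by metis
  have "norm g \<le> (\<Sum>i\<in>UNIV. \<Sum>j\<in>UNIV. C i j)" if "g \<in> rel_group same_side" for g
    by (rule order_trans[OF norm_matrix_le]) (intro sum_mono C that)
  then show "bounded (rel_group same_side)" by (auto simp: bounded_iff)
  have 1: "closed {g. transpose g ** gram ** g = gram}"
  proof -
    have t: "continuous_on UNIV (\<lambda>g :: real^'m^'m. transpose g)"
      by (rule continuous_on_matrixI) (simp add: transpose_def, intro continuous_intros)
    have "continuous_on UNIV (\<lambda>g :: real^'m^'m. transpose g ** gram ** g)"
      by (rule continuous_on_matrix_mult[OF continuous_on_matrix_mult[OF t continuous_on_const] continuous_on_id])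
    then show ?thesis by (intro closed_Collect_eq continuous_intros)
  qed
  have 2: "closed {g. ent (complexify g) k l = 0}" for k l
    by (intro closed_Collect_eq continuous_intros linear_continuous_on linear_ent[THEN linear_conv_bounded_linear[THEN iffD1]])
  have "rel_group same_side = {g. transpose g ** gram ** g = gram} \<inter> (\<Inter>(k, l)\<in>{(k, l). \<not> same_side k l}. {g. ent (complexify g) k l = 0})"
    by (auto simp: rel_group_def aut_group_iff)
  then show "closed (rel_group same_side)" using 1 2 by (auto intro!: closed_Int closed_INT)
qed

lemma hip_infinitesimal:
  assumes "transpose A ** gram + gram ** A = 0" "weil ** A = A ** weil"
  shows "hip (complexify A *v u) w = - hip u (complexify A *v w)"
proof -
  have "infinitesimal Q (complexify A)" using assms(1) by (simp add: infinitesimal_complexify symplectic_algebra_def)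
  then have i: "Q (complexify A *v u) v = - Q u (complexify A *v v)" for v
    by (simp add: infinitesimal_def eq_neg_iff_add_eq_0)
  have "complexify A *v (complexify weil *v w) = complexify weil *v (complexify A *v w)"
    using assms(2) by (simp add: matrix_vector_mul_assoc complexify_simps(1)[symmetric])
  moreover have "herm Q (complexify A *v u) v = - herm Q u (complexify A *v v)" for v
    by (simp add: herm_def i complexify_cnj_vec[symmetric])
  ultimately show ?thesis by (simp add: hip_herm)
qed

text \<open>\<open>A\<close> is skew-adjoint for \<open>hip\<close>, so a vector that it maps to its
  negative satisfies \<open>hip w w = - hip w w\<close>.\<close>

lemma invertible_one_plus_skew:
  assumes "transpose A ** gram + gram ** A = 0" "weil ** A = A ** weil"
  shows "invertible (mat 1 + A)"
proof -
  have "u = 0" if "(mat 1 + A) *v u = 0" for u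
  proof -
    define w where "w = (\<chi> i. complex_of_real (u $ i))"
    have "complexify (mat 1 + A) *v w = 0"
      using that by (simp add: vec_eq_iff w_def matrix_vector_mult_def complexify_def flip: of_real_mult of_real_sum of_real_add)
    then have "complexify A *v w = - w"
      by (simp add: complexify_simps matrix_vector_mult_add_rdistrib eq_neg_iff_add_eq_0 add.commute)
    then have "hip (- w) w = - hip w (- w)" using hip_infinitesimal[OF assms, of w w] by simp
    moreover have "hip (- w) w = - hip w w" "hip w (- w) = - hip w w"
      using hip_linear(3,4)[of 0 w w] hip_linear(3,4)[of w w w] by (simp_all add: hip_linear hip_def coord_linear)
    ultimately have "hip w w = 0" by simp
    then have "w = 0" by (simp add: hip_self nrm_eq_0)
    then show ?thesis by (simp add: w_def vec_eq_iff)
  qed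
  then show ?thesis using matrix_left_invertible_ker[of "mat 1 + A"] by (simp add: invertible_left_inverse)
qed

end

section \<open>Connectedness of the centraliser and identification of \<open>K\<close>\<close>

context framed
begin

text \<open>The Cayley transform \<open>A\<close> of \<open>g\<close> lies in the Lie algebra of the
  group. Scaling it by \<open>s\<close> and transforming back gives a path in the group from the
  identity to \<open>g\<close>, defined throughout because \<open>mat 1 + s *\<^sub>R A\<close> is
  always invertible.\<close>

lemma cayley_path:
  assumes g: "g \<in> rel_group same_side" and inv: "invertible (mat 1 + g)"
  shows "path_component (rel_group same_side) (mat 1) g"
proof -
  define p where "p = matrix_inv (mat 1 + g)"
  have p: "p ** (mat 1 + g) = mat 1" "(mat 1 + g) ** p = mat 1" using invertible_matrix_inv[OF inv] by (auto simp: p_def)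
  define A where "A = (mat 1 - g) ** p"
  have gg: "transpose g ** gram ** g = gram" using g by (simp add: rel_group_def aut_group_iff)
  have gw: "weil ** g = g ** weil" by (rule same_side_commutes[OF g])
  have sp: "transpose A ** gram + gram ** A = 0"
  proof -
    have 1: "transpose (mat 1 - g) ** gram ** (mat 1 + g) + transpose (mat 1 + g) ** gram ** (mat 1 - g) = 0"
      by (simp add: transpose_simps transpose_mat matrix_ring_simps gg)
    have tp: "transpose p ** transpose (mat 1 + g) = mat 1"
      using arg_cong[OF p(2), of transpose] by (simp add: matrix_transpose_mul transpose_mat)
    have "transpose A ** gram + gram ** A =
       transpose p ** (transpose (mat 1 - g) ** gram ** (mat 1 + g) + transpose (mat 1 + g) ** gram ** (mat 1 - g)) ** p"
    proof -
      have a: "transpose A ** gram = transpose p ** (transpose (mat 1 - g) ** gram ** (mat 1 + g)) ** p"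
      proof -
        have "transpose p ** (transpose (mat 1 - g) ** gram ** (mat 1 + g)) ** p = transpose p ** transpose (mat 1 - g) ** gram ** ((mat 1 + g) ** p)"
          by (simp only: matrix_mul_assoc)
        then show ?thesis by (simp only: p(2) matrix_mul_rid A_def matrix_transpose_mul)
      qed
      have b: "gram ** A = transpose p ** (transpose (mat 1 + g) ** gram ** (mat 1 - g)) ** p"
      proof -
        have "transpose p ** (transpose (mat 1 + g) ** gram ** (mat 1 - g)) ** p = (transpose p ** transpose (mat 1 + g)) ** gram ** ((mat 1 - g) ** p)"
          by (simp only: matrix_mul_assoc)
        then show ?thesis by (simp only: tp matrix_mul_lid A_def)
      qed
      show ?thesis unfolding a b by (simp only: matrix_ring_simps(1,2))
    qed
    then show ?thesis unfolding 1 by (simp add: vec_eq_iff matrix_matrix_mult_def)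
  qed
  have pw: "weil ** p = p ** weil"
  proof -
    have "p ** (weil ** (mat 1 + g)) ** p = p ** ((mat 1 + g) ** weil) ** p" by (simp add: matrix_ring_simps gw)
    then have "(p ** weil) ** ((mat 1 + g) ** p) = (p ** (mat 1 + g)) ** (weil ** p)" by (simp only: matrix_mul_assoc)
    then show ?thesis by (simp only: p matrix_mul_lid matrix_mul_rid)
  qed
  have Aw: "weil ** A = A ** weil"
  proof -
    have "weil ** A = (weil ** (mat 1 - g)) ** p" by (simp add: A_def matrix_mul_assoc)
    also have "weil ** (mat 1 - g) = (mat 1 - g) ** weil" by (simp add: matrix_ring_simps gw)
    also have "(mat 1 - g) ** weil ** p = (mat 1 - g) ** (weil ** p)" by (simp only: matrix_mul_assoc)
    finally show ?thesis by (simp only: pw A_def matrix_mul_assoc)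
  qed
  have spc: "transpose (s *\<^sub>R A) ** gram + gram ** (s *\<^sub>R A) = 0" for s
  proof -
    have "transpose (s *\<^sub>R A) ** gram + gram ** (s *\<^sub>R A) = s *\<^sub>R (transpose A ** gram + gram ** A)"
      by (simp add: transpose_simps matrix_ring_simps scaleR_add_right)
    then show ?thesis by (simp add: sp)
  qed
  have Awc: "weil ** (s *\<^sub>R A) = (s *\<^sub>R A) ** weil" for s by (simp add: matrix_ring_simps Aw)
  have iA: "invertible (mat 1 + s *\<^sub>R A)" for s by (rule invertible_one_plus_skew[OF spc Awc])
  define q where "q s = matrix_inv (mat 1 + s *\<^sub>R A)" for s
  have q: "q s ** (mat 1 + s *\<^sub>R A) = mat 1" "(mat 1 + s *\<^sub>R A) ** q s = mat 1" for s
    using invertible_matrix_inv[OF iA] by (auto simp: q_def)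
  define \<gamma> where "\<gamma> s = (mat 1 - s *\<^sub>R A) ** q s" for s
  have cont: "continuous_on {0..1} \<gamma>"
    unfolding \<gamma>_def[abs_def] q_def
    by (intro continuous_on_matrix_mult continuous_on_matrix_inv continuous_intros iA)
  have mem: "\<gamma> s \<in> rel_group same_side" for s
  proof -
    define B where "B = s *\<^sub>R A"
    have tB: "transpose B ** gram = - (gram ** B)" using spc[of s] by (simp add: B_def eq_neg_iff_add_eq_0)
    have Bw: "weil ** B = B ** weil" using Awc[of s] by (simp only: B_def)
    note qB = q[of s, folded B_def] and \<gamma>B = \<gamma>_def[of s, folded B_def]
    have m: "transpose (mat 1 - B) ** gram = gram ** (mat 1 + B)" "transpose (mat 1 + B) ** gram = gram ** (mat 1 - B)"
      by (simp_all only: transpose_simps transpose_mat matrix_ring_simps tB matrix_mul_lid matrix_mul_rid) simp_all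
    have tq: "transpose (q s) ** transpose (mat 1 + B) = mat 1"
      using arg_cong[OF qB(2), of transpose] by (simp add: matrix_transpose_mul transpose_mat)
    have "transpose (\<gamma> s) ** gram ** \<gamma> s = transpose (q s) ** (transpose (mat 1 - B) ** gram) ** (mat 1 - B) ** q s"
      by (simp only: \<gamma>B matrix_transpose_mul matrix_mul_assoc)
    also have "\<dots> = transpose (q s) ** gram ** ((mat 1 + B) ** (mat 1 - B)) ** q s"
      by (simp only: m matrix_mul_assoc)
    also have "(mat 1 + B) ** (mat 1 - B) = (mat 1 - B) ** (mat 1 + B)" by (simp add: matrix_ring_simps)
    also have "transpose (q s) ** gram ** ((mat 1 - B) ** (mat 1 + B)) ** q s = transpose (q s) ** (gram ** (mat 1 - B)) ** ((mat 1 + B) ** q s)"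
      by (simp only: matrix_mul_assoc)
    also have "\<dots> = (transpose (q s) ** transpose (mat 1 + B)) ** gram"
      by (simp only: m(2)[symmetric] qB matrix_mul_rid matrix_mul_assoc)
    also have "\<dots> = gram" by (simp only: tq matrix_mul_lid)
    finally have au: "\<gamma> s \<in> aut_group Q" by (simp add: aut_group_iff)
    have qw: "weil ** q s = q s ** weil"
    proof -
      have "q s ** (weil ** (mat 1 + B)) ** q s = q s ** ((mat 1 + B) ** weil) ** q s" by (simp add: matrix_ring_simps Bw)
      then have "(q s ** weil) ** ((mat 1 + B) ** q s) = (q s ** (mat 1 + B)) ** (weil ** q s)" by (simp only: matrix_mul_assoc)
      then show ?thesis by (simp only: qB matrix_mul_lid matrix_mul_rid)
    qed
    have "weil ** \<gamma> s = (weil ** (mat 1 - B)) ** q s" by (simp add: \<gamma>B matrix_mul_assoc)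
    also have "weil ** (mat 1 - B) = (mat 1 - B) ** weil" by (simp add: matrix_ring_simps Bw)
    also have "(mat 1 - B) ** weil ** q s = (mat 1 - B) ** (weil ** q s)" by (simp only: matrix_mul_assoc)
    finally have "weil ** \<gamma> s = \<gamma> s ** weil" by (simp only: qw \<gamma>B matrix_mul_assoc)
    then show ?thesis by (rule aut_group_same_side[OF au])
  qed
  have "q 0 = mat 1" using q(1)[of 0] by simp
  then have g0: "\<gamma> 0 = mat 1" by (simp add: \<gamma>_def)
  \<comment> \<open>\<open>mat 1 + A\<close> is twice \<open>p\<close> and \<open>mat 1 - A\<close>
    is twice \<open>g ** p\<close>, so the inverse transform returns \<open>g\<close>.\<close>
  have g1: "\<gamma> 1 = g"
  proof -
    have "mat 1 + A = (mat 1 + g) ** p + (mat 1 - g) ** p" by (simp only: p A_def)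
    also have "\<dots> = ((mat 1 + g) + (mat 1 - g)) ** p" by (rule matrix_ring_simps(2)[symmetric])
    also have "(mat 1 + g) + (mat 1 - g) = mat 1 + mat 1" by (simp add: algebra_simps)
    also have "(mat 1 + mat 1) ** p = p + p" by (simp only: matrix_ring_simps(2) matrix_mul_lid)
    finally have 1: "mat 1 + A = p + p" .
    have "mat 1 - A = (mat 1 + g) ** p - (mat 1 - g) ** p" by (simp only: p A_def)
    also have "\<dots> = ((mat 1 + g) - (mat 1 - g)) ** p" by (rule matrix_ring_simps(4)[symmetric])
    also have "(mat 1 + g) - (mat 1 - g) = g + g" by (simp add: algebra_simps)
    also have "(g + g) ** p = g ** (p + p)" by (simp only: matrix_ring_simps(1,2))
    finally have 2: "mat 1 - A = g ** (mat 1 + A)" by (simp only: 1)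
    have "\<gamma> 1 = g ** ((mat 1 + A) ** q 1)" by (simp add: \<gamma>_def 2 matrix_mul_assoc)
    also have "\<dots> = g" using q(2)[of 1] by simp
    finally show ?thesis .
  qed
  show ?thesis unfolding path_component_def path_def pathstart_def pathfinish_def path_image_def
    using cont mem g0 g1 by (intro exI[of _ \<gamma>]) auto
qed

text \<open>The exponential of \<open>s\<close> times \<open>weil\<close>, whose square is
  \<open>-1\<close>. It acts by \<open>cis s\<close> on one side and by \<open>cis (- s)\<close> on
  the other, and commutes with every element of \<open>rel_group same_side\<close>.\<close>

definition rotation :: "real \<Rightarrow> real^'m^'m"
  where "rotation s = cos s *\<^sub>R mat 1 + sin s *\<^sub>R weil"

lemma co_rotation: "co k (complexify (rotation s) *v u) = cis (if snd k then s else - s) * co k u"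
proof -
  have e: "complexify (c *\<^sub>R A) *v v = complex_of_real c *s (complexify A *v v)" for c A v
    by (simp add: complexify_def vec_eq_iff matrix_vector_mult_def sum_distrib_left mult.assoc)
  show ?thesis
    by (simp only: rotation_def complexify_simps(3) matrix_vector_mult_add_rdistrib e coord_linear co_weil complexify_simps(2) matrix_vector_mul_lid)
       (simp add: side_sign_def complex_eq_iff algebra_simps)
qed

lemma rotation_mem: "rotation s \<in> rel_group same_side"
proof -
  have Qr: "Q (complexify (rotation s) *v u) (complexify (rotation s) *v w) = Q u w" for u w
    unfolding Q_expand[of "complexify (rotation s) *v u" "complexify (rotation s) *v w"] Q_expand[of u w] co_rotation
  proof (intro sum.cong refl)
    fix k :: "'n option \<times> bool"
    have one: "cis (if snd (flip k) then s else - s) * cis (if snd k then s else - s) = 1" by (simp add: cis_mult)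
    have "a * (c * b) * (d * e) = a * b * e * (c * d)" for a b c d e :: complex by (simp only: mult_ac)
    from this[of "if snd k then - \<i> else \<i>" "cis (if snd (flip k) then s else - s)" _ "cis (if snd k then s else - s)"]
    show "(if snd k then - \<i> else \<i>) * (cis (if snd (flip k) then s else - s) * co (flip k) u) * (cis (if snd k then s else - s) * co k w)
      = (if snd k then - \<i> else \<i>) * co (flip k) u * co k w"
      unfolding one mult_1_right .
  qed
  have "rotation s ** rotation (- s) = mat 1"
  proof -
    have "complexify (rotation s ** rotation (- s)) *v u = complexify (mat 1) *v u" for u
      by (rule co_eqI) (simp add: complexify_simps(1,2) matrix_vector_mul_assoc[symmetric] co_rotation mult.assoc[symmetric] cis_mult)
    then have "complexify (rotation s ** rotation (- s)) = complexify (mat 1)" unfolding matrix_eq by blast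
    then show ?thesis by (simp only: complexify_inject)
  qed
  then have "invertible (rotation s)" unfolding invertible_right_inverse by blast
  then have "rotation s \<in> aut_group Q" using Qr by (simp add: aut_group_def)
  moreover have "weil ** rotation s = rotation s ** weil" by (simp add: rotation_def matrix_ring_simps)
  ultimately show ?thesis by (rule aut_group_same_side)
qed

text \<open>The Cayley transform joins \<open>g\<close> to the identity unless \<open>-1\<close> is an eigenvalue; a rotation in the centre
  of the group moves the finitely many eigenvalues away from \<open>-1\<close>.\<close>

lemma same_side_connected: "connected (rel_group same_side)"
proof -
  have prod: "g ** h \<in> rel_group same_side" if "g \<in> rel_group same_side" "h \<in> rel_group same_side" for g h
    using rel_group_subgroup[OF same_rel(4-6)] that by (simp add: matrix_subgroup_def)
  have "path_component (rel_group same_side) (mat 1) g" if g: "g \<in> rel_group same_side" for g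
  proof -
    define E where "E = {c. \<exists>v. v \<noteq> 0 \<and> complexify g *v v = c *s v}"
    have fin: "finite E" unfolding E_def
      by (rule finite_eigenvalues_isometry[where h = hip])
         (auto simp: hip_linear hip_self nrm_eq_0 hip_same_side[OF g] intro: hip_cnj)
    \<comment> \<open>On an interval of length \<open>2 * pi\<close> the values
      \<open>- cis s\<close> are infinitely many, too many to be all eigenvalues.\<close>
    have "\<not> (\<lambda>s. - cis s) ` {-pi<..pi} \<subseteq> E"
    proof
      assume "(\<lambda>s. - cis s) ` {-pi<..pi} \<subseteq> E"
      then have "finite ((\<lambda>s. - cis s) ` {-pi<..pi})" using fin finite_subset by blast
      moreover have "inj_on (\<lambda>s. - cis s) {-pi<..pi}"
        by (rule inj_on_inverseI[where g = "\<lambda>c. Arg (- c)"]) (simp add: Arg_cis)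
      ultimately have "finite {-pi<..pi}" using finite_imageD by blast
      then show False using infinite_Ioc[of "- pi" pi] by simp
    qed
    then obtain s where s: "- cis s \<notin> E" by blast
    \<comment> \<open>The rotation has conjugate factors on the two sides. Since \<open>g\<close> is
      real, its eigenvalues come in conjugate pairs, so one choice of \<open>s\<close> serves both
      sides.\<close>
    have sb: "cnj c \<in> E" if "c \<in> E" for c
    proof -
      from that[unfolded E_def mem_Collect_eq] obtain v where "v \<noteq> 0" "complexify g *v v = c *s v" by (elim exE conjE)
      then have "complexify g *v cnj_vec v = cnj c *s cnj_vec v" by (simp add: complexify_cnj_vec)
      moreover have "cnj_vec v \<noteq> 0" using \<open>v \<noteq> 0\<close> by (metis cnj_vec_simps(1,2))
      ultimately show ?thesis by (auto simp: E_def)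
    qed
    have co_g: "co k (complexify g *v u) = 0" if "\<And>l. snd l = snd k \<Longrightarrow> co l u = 0" for k u
    proof -
      have "ent (complexify g) k l * co l u = 0" for l
        using g that[of l] by (cases "snd l = snd k") (auto simp: rel_group_def same_side_def)
      then show ?thesis by (simp only: co_mult sum.neutral_const)
    qed
    let ?h = "rotation s ** g"
    have inv: "invertible (mat 1 + ?h)"
    proof -
      have "u = 0" if u: "(mat 1 + ?h) *v u = 0" for u
      proof -
        define w where "w = (\<chi> i. complex_of_real (u $ i))"
        have "complexify (mat 1 + ?h) *v w = 0"
          using u by (simp add: vec_eq_iff w_def matrix_vector_mult_def complexify_def flip: of_real_mult of_real_sum of_real_add)
        then have "complexify (rotation s) *v (complexify g *v w) = - w"
          by (simp add: complexify_simps matrix_vector_mult_add_rdistrib eq_neg_iff_add_eq_0 add.commute matrix_vector_mul_assoc)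
        then have c: "cis (if snd k then s else - s) * co k (complexify g *v w) = - co k w" for k
          using co_rotation[of k s "complexify g *v w"] by (simp add: coord_linear)
        \<comment> \<open>\<open>g\<close> preserves the two sides, so each component of a kernel
          vector is either zero or an eigenvector of \<open>g\<close> for one of the excluded
          values.\<close>
        define side where "side b = (\<Sum>k\<in>UNIV. (if snd k = b then co k w else 0) *s bv k)" for b
        have cs: "co k (side b) = (if snd k = b then co k w else 0)" for k b unfolding side_def by (rule co_sum_bv)
        have w: "w = side True + side False" by (rule co_eqI) (simp add: coord_linear cs)
        have ev: "complexify g *v side b = (- cis (if b then - s else s)) *s side b" for b
        proof (rule co_eqI)
          fix k
          have other: "co k (complexify g *v side (\<not> snd k)) = 0" by (rule co_g) (auto simp: cs)
          have own: "co k (complexify g *v side (snd k)) = co k (complexify g *v w)"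
            using other by (cases "snd k") (simp_all add: w mat_vec_linear coord_linear)
          have "cis (- (if snd k then s else - s)) * (cis (if snd k then s else - s) * co k (complexify g *v w)) = co k (complexify g *v w)"
            by (simp add: mult.assoc[symmetric] cis_mult)
          then have "co k (complexify g *v w) = - cis (if snd k then - s else s) * co k w"
            unfolding c by (cases "snd k") simp_all
          then show "co k (complexify g *v side b) = co k ((- cis (if b then - s else s)) *s side b)"
            using other own by (cases "b = snd k") (auto simp: coord_linear cs)
        qed
        have "side b = 0" for b
        proof (rule ccontr)
          assume "side b \<noteq> 0"
          then have "- cis (if b then - s else s) \<in> E" using ev[of b] by (auto simp: E_def)
          then show False using s sb[of "- cis (- s)"] by (auto simp: cis_cnj split: if_splits)
        qed
        then have "w = 0" using w by simp
        then show ?thesis by (simp add: w_def vec_eq_iff)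
      qed
      then show ?thesis using matrix_left_invertible_ker[of "mat 1 + ?h"] by (simp add: invertible_left_inverse)
    qed
    have 1: "path_component (rel_group same_side) (mat 1) ?h"
      by (rule cayley_path[OF prod[OF rotation_mem g] inv])
    have 2: "path_component (rel_group same_side) g ?h"
      unfolding path_component_def path_def pathstart_def pathfinish_def path_image_def
    proof (intro exI[of _ "\<lambda>t. rotation (t * s) ** g"] conjI)
      show "continuous_on {0..1} (\<lambda>t. rotation (t * s) ** g)"
        unfolding rotation_def by (intro continuous_on_matrix_mult continuous_intros)
      show "(\<lambda>t. rotation (t * s) ** g) ` {0..1} \<subseteq> rel_group same_side"
        using prod[OF rotation_mem g] by blast
    qed (simp_all add: rotation_def)
    show ?thesis using path_component_trans[OF 1 path_component_sym[OF 2]] .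
  qed
  then have "path_connected (rel_group same_side)"
    unfolding path_connected_component by (meson path_component_sym path_component_trans)
  then show ?thesis by (rule path_connected_imp_connected)
qed

text \<open>The block group is a candidate that contains every other candidate, which gives
  existence and uniqueness for the definite description at once.\<close>

lemma max_compact_eq: "max_compact Q x = rel_group same_side"
proof -
  define cc where "cc = {K. matrix_subgroup K \<and> compact K \<and> connected K \<and> stabilizer Q x \<subseteq> K \<and> K \<subseteq> aut_group Q}"
  have K: "rel_group same_side \<in> cc"
    unfolding cc_def mem_Collect_eq stabilizer_eq
  proof (intro conjI)
    show "rel_group same_type \<subseteq> rel_group same_side" "rel_group same_side \<subseteq> aut_group Q"
      using same_type_side unfolding rel_group_def by blast+
  qed (use rel_group_subgroup[OF same_rel(4-6)] same_side_compact same_side_connected in auto)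
  have top: "K' \<subseteq> rel_group same_side" if "K' \<in> cc" for K'
    using that weil_rel_group(1) by (intro compact_group_same_side) (auto simp: cc_def stabilizer_eq)
  have "(THE K. K \<in> cc \<and> (\<forall>K'\<in>cc. K \<subseteq> K' \<longrightarrow> K' = K)) = rel_group same_side"
    by (rule the_equality) (use K top in blast)+
  then show ?thesis by (simp add: max_compact_def cc_def[symmetric] Let_def)
qed

lemma cartan_k_eq: "cartan_k Q x = rel_algebra same_side"
  unfolding cartan_k_def max_compact_eq by (rule lie_alg_rel_group[OF same_rel(4,5)])

lemma lie_alg_stabilizer: "lie_alg (stabilizer Q x) = rel_algebra same_type"
  unfolding stabilizer_eq by (rule lie_alg_rel_group[OF same_rel(1,2)])

end

context framed
begin

section \<open>The invariant metric on horizontal vectors\<close>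

lemma trace_mult_complexify:
  "complex_of_real (trace (X ** Y)) = (\<Sum>k\<in>UNIV. \<Sum>l\<in>UNIV. ent (complexify X) k l * ent (complexify Y) l k)"
  by (simp only: trace_complexify[symmetric] complexify_simps(1) trace_mult_ent)

lemma ent_complexify_flip: "ent (complexify A) (flip k) (flip l) = cnj (ent (complexify A) k l)"
  using ent_cnj_mat[of "complexify A" k l] by (simp add: cnj_mat_complexify)

lemma infinitesimal_ent:
  assumes "infinitesimal Q Y"
  shows "(if snd k then \<i> else - \<i>) * ent Y k l = (if snd l then - \<i> else \<i>) * ent Y (flip l) (flip k)"
proof -
  have "(if snd (flip k) then - \<i> else \<i>) * ent Y (flip (flip k)) l + (if snd l then \<i> else - \<i>) * ent Y (flip l) (flip k) = 0"
    using assms unfolding infinitesimal_iff by blast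
  then show ?thesis by (auto simp: eq_neg_iff_add_eq_0 split: if_splits)
qed

text \<open>In the frame an element of the Lie algebra of \<open>K\<close> is skew-Hermitian, so the
  trace of its square is minus the sum of the squared moduli of its entries. The uniqueness of
  \<open>k_part\<close> and of \<open>real_tangent\<close> rests on this definiteness.\<close>

lemma trace_square_zero:
  assumes D: "D \<in> rel_algebra same_side" and 0: "trace (D ** D) = 0"
  shows "D = 0"
proof -
  have inf: "infinitesimal Q (complexify D)" using D by (simp add: rel_algebra_def infinitesimal_complexify)
  have lk: "ent (complexify D) l k = - cnj (ent (complexify D) k l)" for k l
  proof (cases "same_side k l")
    case True
    then have "ent (complexify D) l k = - ent (complexify D) (flip k) (flip l)"
      using infinitesimal_ent[OF inf, of l k] by (auto simp: same_side_def complex_eq_iff split: if_splits)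
    then show ?thesis by (simp add: ent_complexify_flip)
  next
    case False
    then have "\<not> same_side l k" by (simp add: same_side_def)
    then show ?thesis using D False by (simp add: rel_algebra_def)
  qed
  have "complex_of_real (trace (D ** D)) = - complex_of_real (\<Sum>k\<in>UNIV. \<Sum>l\<in>UNIV. (cmod (ent (complexify D) k l))\<^sup>2)"
    unfolding trace_mult_complexify of_real_sum sum_negf[symmetric]
  proof (intro sum.cong refl)
    fix k l
    show "ent (complexify D) k l * ent (complexify D) l k = - complex_of_real ((cmod (ent (complexify D) k l))\<^sup>2)"
      unfolding lk[of l k] by (simp add: complex_mult_cnj cmod_power2)
  qed
  then have "(\<Sum>k\<in>UNIV. \<Sum>l\<in>UNIV. (cmod (ent (complexify D) k l))\<^sup>2) = 0"
    using 0 by (metis neg_equal_0_iff_equal of_real_0 of_real_eq_0_iff)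
  then have "ent (complexify D) k l = 0" for k l
    by (simp add: sum_nonneg_eq_0_iff sum_nonneg)
  then have "complexify D = complexify 0" by (intro ent_eqI) (simp add: complexify_simps ent_linear)
  then show ?thesis by (simp only: complexify_inject)
qed

lemma rel_algebra_diff:
  assumes "A \<in> rel_algebra R" "C \<in> rel_algebra R"
  shows "A - C \<in> rel_algebra R"
proof -
  have "transpose (A - C) ** gram + gram ** (A - C) = (transpose A ** gram + gram ** A) - (transpose C ** gram + gram ** C)"
    by (simp add: transpose_simps matrix_ring_simps)
  then show ?thesis using assms by (simp add: rel_algebra_def symplectic_algebra_def complexify_simps(4) ent_linear)
qed

lemma symplectic_diff: "A \<in> symplectic_algebra gram \<Longrightarrow> C \<in> symplectic_algebra gram \<Longrightarrow> A - C \<in> symplectic_algebra gram"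
  using rel_algebra_diff[of A "\<lambda>k l. True" C] by (simp add: rel_algebra_def)

lemma trace_off_diagonal:
  assumes "\<And>k l. ent (complexify X) k l \<noteq> 0 \<Longrightarrow> \<not> R k l" "A \<in> rel_algebra R" "symp R"
  shows "trace (X ** A) = 0"
proof -
  have "ent (complexify X) k l * ent (complexify A) l k = 0" for k l
  proof (cases "R l k")
    case True
    then have "R k l" using assms(3) by (meson sympD)
    then show ?thesis using assms(1)[of k l] by auto
  next
    case False then show ?thesis using assms(2) by (simp add: rel_algebra_def)
  qed
  then have "complex_of_real (trace (X ** A)) = 0" by (simp only: trace_mult_complexify sum.neutral_const)
  then show ?thesis by simp
qed

lemma symp_rel: "symp same_side" "symp same_type"
  by (auto simp: symp_def same_side_def same_type_def)

text \<open>Reality and infinitesimal invariance relate entries within the sides only to entries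
  within the sides, so cutting away the other blocks preserves both properties.\<close>

lemma same_side_part_exists:
  assumes X: "X \<in> symplectic_algebra gram"
  shows "\<exists>A\<in>rel_algebra same_side. \<forall>k l. ent (complexify (X - A)) k l \<noteq> 0 \<longrightarrow> \<not> same_side k l"
proof -
  define M where "M = frame_matrix (\<lambda>k l. if same_side k l then ent (complexify X) k l else 0)"
  have eM: "ent M k l = (if same_side k l then ent (complexify X) k l else 0)" for k l
    unfolding M_def by (rule ent_frame_matrix)
  have "cnj_mat M = M"
    by (rule ent_eqI) (simp add: ent_cnj_mat eM ent_complexify_flip, simp add: same_side_def)
  then have "M *v cnj_vec u = cnj_vec (M *v u)" for u using cnj_mat_mult_vec[of M u] by simp
  then obtain A where A: "complexify A = M" using real_matrix_exists by blast
  have iX: "infinitesimal Q (complexify X)" using X by (simp add: infinitesimal_complexify)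
  have "infinitesimal Q M"
    unfolding infinitesimal_iff
  proof (intro allI)
    fix k l
    have s: "same_side (flip k) l \<longleftrightarrow> same_side (flip l) k" by (auto simp: same_side_def)
    show "(if snd k then - \<i> else \<i>) * ent M (flip k) l + (if snd l then \<i> else - \<i>) * ent M (flip l) k = 0"
      using iX[unfolded infinitesimal_iff, THEN spec, THEN spec, of k l] unfolding eM s by (cases "same_side (flip l) k") auto
  qed
  then have "A \<in> rel_algebra same_side"
    by (simp add: rel_algebra_def A eM flip: infinitesimal_complexify)
  moreover have "ent (complexify (X - A)) k l \<noteq> 0 \<longrightarrow> \<not> same_side k l" for k l
    by (simp add: complexify_simps(4) ent_linear A eM)
  ultimately show ?thesis by blast
qed

lemma rel_algebra_symplectic: "A \<in> rel_algebra R \<Longrightarrow> A \<in> symplectic_algebra gram"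
  by (simp add: rel_algebra_def)

lemma cartan_pI:
  assumes "X \<in> symplectic_algebra gram" "\<And>k l. ent (complexify X) k l \<noteq> 0 \<Longrightarrow> \<not> same_side k l"
  shows "X \<in> cartan_p Q x"
  unfolding cartan_p_def cartan_k_eq lie_alg_aut_group mem_Collect_eq
  using assms(1) trace_off_diagonal[OF assms(2) _ symp_rel(1)]
  by (auto simp: killing_form_eq rel_algebra_symplectic)

text \<open>Two candidates differ by an element of the Lie algebra of \<open>K\<close> that is
  trace-orthogonal to itself, hence zero by \<open>trace_square_zero\<close>.\<close>

lemma k_part_eqI:
  assumes A: "A \<in> rel_algebra same_side" and XA: "X - A \<in> cartan_p Q x"
  shows "k_part Q x X = A"
  unfolding k_part_def cartan_k_eq
proof (rule the_equality)
  show "A \<in> rel_algebra same_side \<and> X - A \<in> cartan_p Q x" using assms by blast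
  fix C assume C: "C \<in> rel_algebra same_side \<and> X - C \<in> cartan_p Q x"
  have "trace ((X - B) ** (C - A)) = 0" if "X - B \<in> cartan_p Q x" for B
  proof -
    have "X - B \<in> symplectic_algebra gram" "killing_form Q (X - B) (C - A) = 0"
      using that rel_algebra_diff[of C same_side A] A C by (auto simp: cartan_p_def cartan_k_eq lie_alg_aut_group)
    then have "(real CARD('m) + 2) * trace ((X - B) ** (C - A)) = 0"
      using killing_form_eq rel_algebra_symplectic[OF rel_algebra_diff[of C same_side A]] A C by simp
    then show ?thesis by simp
  qed
  from this[of A] this[of C] have "trace ((X - A) ** (C - A)) - trace ((X - C) ** (C - A)) = 0" using XA C by simp
  then have "trace ((C - A) ** (C - A)) = 0"
    by (simp add: trace_sub[symmetric] matrix_ring_simps(4)[symmetric])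
  then have "C - A = 0" using trace_square_zero rel_algebra_diff C A by blast
  then show "C = A" by simp
qed

lemma k_part_mem:
  assumes X: "X \<in> symplectic_algebra gram"
  shows "k_part Q x X \<in> rel_algebra same_side"
    "\<And>k l. ent (complexify (X - k_part Q x X)) k l \<noteq> 0 \<Longrightarrow> \<not> same_side k l"
    "X - k_part Q x X \<in> symplectic_algebra gram"
proof -
  obtain A where A: "A \<in> rel_algebra same_side" "\<And>k l. ent (complexify (X - A)) k l \<noteq> 0 \<Longrightarrow> \<not> same_side k l"
    using same_side_part_exists[OF X] by blast
  have s: "X - A \<in> symplectic_algebra gram" by (rule symplectic_diff[OF X rel_algebra_symplectic[OF A(1)]])
  have "k_part Q x X = A" by (rule k_part_eqI[OF A(1) cartan_pI[OF s A(2)]])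
  then show "k_part Q x X \<in> rel_algebra same_side"
    "\<And>k l. ent (complexify (X - k_part Q x X)) k l \<noteq> 0 \<Longrightarrow> \<not> same_side k l"
    "X - k_part Q x X \<in> symplectic_algebra gram" using A s by auto
qed

lemma k_part_same_side: "A \<in> rel_algebra same_side \<Longrightarrow> k_part Q x A = A"
  by (rule k_part_eqI) (auto intro!: cartan_pI simp: complexify_simps ent_linear symplectic_diff[of 0 0, simplified] rel_algebra_symplectic symplectic_algebra_def transpose_def matrix_matrix_mult_def vec_eq_iff)

lemma k_part_off_side:
  assumes "X \<in> symplectic_algebra gram" "\<And>k l. ent (complexify X) k l \<noteq> 0 \<Longrightarrow> \<not> same_side k l"
  shows "k_part Q x X = 0"
proof (rule k_part_eqI)
  show "X - 0 \<in> cartan_p Q x" using cartan_pI[OF assms] by simp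
  show "0 \<in> rel_algebra same_side"
    using rel_algebra_diff[of "k_part Q x X" same_side "k_part Q x X"] k_part_mem[OF assms(1)] by simp
qed

lemma cartan_inner_k:
  assumes \<xi>: "\<xi> \<in> symplectic_algebra gram" and A: "A \<in> rel_algebra same_side"
  shows "cartan_inner Q x \<xi> A = - (real CARD('m) + 2) * trace (\<xi> ** A)"
proof -
  have "trace ((\<xi> - k_part Q x \<xi>) ** A) = 0"
    by (rule trace_off_diagonal[OF k_part_mem(2)[OF \<xi>] A symp_rel(1)])
  then have "trace (k_part Q x \<xi> ** A) = trace (\<xi> ** A)" by (simp add: matrix_ring_simps(4) trace_sub)
  moreover have "killing_form Q (\<xi> - k_part Q x \<xi>) 0 = 0"
    using killing_form_eq[OF k_part_mem(3)[OF \<xi>], of 0] rel_algebra_symplectic[OF rel_algebra_diff[OF A A]]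
    by (simp add: trace_def matrix_matrix_mult_def)
  ultimately show ?thesis
    using killing_form_eq[OF rel_algebra_symplectic[OF k_part_mem(1)[OF \<xi>]] rel_algebra_symplectic[OF A]]
    by (simp add: cartan_inner_def k_part_same_side[OF A] algebra_simps)
qed

lemma cartan_inner_p:
  assumes "X \<in> symplectic_algebra gram" "\<And>k l. ent (complexify X) k l \<noteq> 0 \<Longrightarrow> \<not> same_side k l"
    and "Y \<in> symplectic_algebra gram" "\<And>k l. ent (complexify Y) k l \<noteq> 0 \<Longrightarrow> \<not> same_side k l"
  shows "cartan_inner Q x X Y = (real CARD('m) + 2) * trace (X ** Y)"
proof -
  have "0 \<in> symplectic_algebra gram" using symplectic_diff[OF assms(1,1)] by simp
  then have "killing_form Q 0 0 = 0" using killing_form_eq[of 0 0] by (simp add: trace_def matrix_matrix_mult_def)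
  then show ?thesis
    by (simp add: cartan_inner_def k_part_off_side[OF assms(1,2)] k_part_off_side[OF assms(3,4)] killing_form_eq[OF assms(1,3)])
qed

lemma same_type_same_side: "A \<in> rel_algebra same_type \<Longrightarrow> A \<in> rel_algebra same_side"
  using same_type_side unfolding rel_algebra_def by blast

text \<open>Against an element of the Lie algebra of \<open>V\<close>, which lies in that of
  \<open>K\<close>, the Cartan inner product is a nonzero multiple of the trace form.\<close>

lemma v_perp_iff:
  "\<xi> \<in> v_perp Q x \<longleftrightarrow> \<xi> \<in> symplectic_algebra gram \<and> (\<forall>A\<in>rel_algebra same_type. trace (\<xi> ** A) = 0)"
proof -
  have "(real CARD('m) + 2) \<noteq> 0" by linarith
  then have "cartan_inner Q x \<xi> A = 0 \<longleftrightarrow> trace (\<xi> ** A) = 0"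
    if "\<xi> \<in> symplectic_algebra gram" "A \<in> rel_algebra same_type" for A
    using cartan_inner_k[OF that(1) same_type_same_side[OF that(2)]] by simp
  then show ?thesis unfolding v_perp_def lie_alg_aut_group lie_alg_stabilizer by auto
qed

section \<open>Lifting tangent vectors to the real Lie algebra\<close>

lemma infinitesimal_real_part:
  assumes "infinitesimal Q Y"
  shows "infinitesimal Q (Y + cnj_mat Y)"
  unfolding infinitesimal_def
proof (intro allI)
  fix u w
  have 1: "Q (Y *v u) w + Q u (Y *v w) = 0" for u w using assms by (simp add: infinitesimal_def)
  have "cnj (Q (Y *v cnj_vec u) (cnj_vec w) + Q (cnj_vec u) (Y *v cnj_vec w)) = 0" by (simp add: 1)
  then have "Q (cnj_mat Y *v u) w + Q u (cnj_mat Y *v w) = 0" by (simp add: Q_cnj[symmetric] cnj_mat_mult_vec')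
  with 1[of u w] have "(Q (Y *v u) w + Q u (Y *v w)) + (Q (cnj_mat Y *v u) w + Q u (cnj_mat Y *v w)) = 0" by simp
  then show "Q ((Y + cnj_mat Y) *v u) w + Q u ((Y + cnj_mat Y) *v w) = 0"
    by (simp add: matrix_vector_mult_add_rdistrib Q_left Q_right algebra_simps)
qed

text \<open>\<open>cnj_mat Y\<close> raises types, so it preserves the filtration and the sum
  induces the same maps as \<open>Y\<close>; having no diagonal blocks, the sum is orthogonal to the
  Lie algebra of \<open>V\<close>. The difference of two lifts preserves the filtration and is real,
  hence block diagonal and orthogonal to itself.\<close>

lemma real_tangent_eqI:
  assumes Y: "Y \<in> tangent_space Q x" and \<xi>: "complexify \<xi> = Y + cnj_mat Y"
  shows "real_tangent Q x Y = \<xi>"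
proof -
  have Yi: "infinitesimal Q Y" and Ye: "\<And>k l. hodge_type l \<le> hodge_type k \<Longrightarrow> ent Y k l = 0"
    using Y by (auto simp only: tangent_iff)
  have Ye': "ent (cnj_mat Y) k l = 0" if "hodge_type k \<le> hodge_type l" for k l
    using that Ye[of "flip l" "flip k"] hodge_type_le[of k] hodge_type_le[of l]
    by (simp add: ent_cnj_mat Ye hodge_type_flip)
  have \<xi>s: "\<xi> \<in> symplectic_algebra gram"
    using infinitesimal_real_part[OF Yi] by (simp add: \<xi>[symmetric] infinitesimal_complexify)
  have "ent (complexify \<xi>) k l \<noteq> 0 \<Longrightarrow> \<not> same_type k l" for k l
    using Ye[of l k] Ye'[of k l] by (auto simp: \<xi> ent_linear same_type_def)
  then have \<xi>v: "\<xi> \<in> v_perp Q x"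
    unfolding v_perp_iff using \<xi>s trace_off_diagonal[OF _ _ symp_rel(2)] by blast
  have raise: "(complexify \<xi> - Y) *v u \<in> Fil x p" if u: "u \<in> Fil x p" for u p
  proof -
    have "ent (cnj_mat Y) k l * co l u = 0" if "hodge_type k < p" for k l
      using Ye'[of k l] u that by (cases "hodge_type k \<le> hodge_type l") (auto simp: Fil_eq)
    then have "co k (cnj_mat Y *v u) = 0" if "hodge_type k < p" for k
      using that by (simp only: co_mult sum.neutral_const not_False_eq_True)
    then show ?thesis by (simp add: \<xi> Fil_eq)
  qed
  show ?thesis
    unfolding real_tangent_def
  proof (rule the_equality)
    show "\<xi> \<in> v_perp Q x \<and> (\<forall>p\<in>{1..3}. \<forall>u\<in>Fil x p. (complexify \<xi> - Y) *v u \<in> Fil x p)"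
      using \<xi>v raise by blast
    fix \<eta> assume \<eta>: "\<eta> \<in> v_perp Q x \<and> (\<forall>p\<in>{1..3}. \<forall>u\<in>Fil x p. (complexify \<eta> - Y) *v u \<in> Fil x p)"
    define D where "D = \<eta> - \<xi>"
    have e0: "ent (complexify D) k l = 0" if "hodge_type k < hodge_type l" for k l
    proof -
      have b: "bv l \<in> Fil x (hodge_type l)" by (auto simp: Fil_eq co_bv)
      have p: "hodge_type l \<in> {1..3}" using that hodge_type_le[of l] by auto
      have "(complexify \<eta> - Y) *v bv l \<in> Fil x (hodge_type l)" using \<eta> b p by blast
      then have "co k ((complexify \<eta> - Y) *v bv l) = 0" "co k ((complexify \<xi> - Y) *v bv l) = 0"
        using raise[OF b] that by (auto simp: Fil_eq)
      then have "ent (complexify \<eta> - Y) k l = 0" "ent (complexify \<xi> - Y) k l = 0" by (simp_all add: entry_def)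
      then show ?thesis by (simp add: D_def complexify_simps(4) ent_linear)
    qed
    have e1: "ent (complexify D) k l = 0" if "hodge_type l < hodge_type k" for k l
    proof -
      have "hodge_type (flip k) < hodge_type (flip l)"
        using that hodge_type_le[of k] by (simp add: hodge_type_flip)
      from e0[OF this] show ?thesis by (simp add: ent_complexify_flip)
    qed
    have "D \<in> symplectic_algebra gram" using \<eta> \<xi>s symplectic_diff by (simp add: D_def v_perp_iff)
    then have D: "D \<in> rel_algebra same_type"
      using e0 e1 by (auto simp: rel_algebra_def same_type_def) (meson linorder_neqE_nat)
    then have "trace (D ** D) = 0"
      using \<eta> \<xi>v by (simp add: D_def v_perp_iff matrix_ring_simps(4) trace_sub)
    then have "D = 0" using trace_square_zero same_type_same_side[OF D] by blast
    then show "\<eta> = \<xi>" by (simp add: D_def)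
  qed
qed

lemma real_tangent_exists: "\<exists>\<xi>. complexify \<xi> = Y + cnj_mat Y"
proof (rule real_matrix_exists)
  fix u show "(Y + cnj_mat Y) *v cnj_vec u = cnj_vec ((Y + cnj_mat Y) *v u)"
    by (simp add: matrix_vector_mult_add_rdistrib cnj_mat_mult_vec cnj_mat_mult_vec'[of Y u] add.commute)
qed

lemma mat_i_mult: "(mat \<i> ** Y) *v u = \<i> *s (Y *v u)" for Y :: "complex^'m^'m"
  by (simp add: matrix_vector_mul_assoc[symmetric])
     (simp add: vec_eq_iff matrix_vector_mult_def mat_def if_distrib if_distribR cong: if_cong)

lemma cnj_mat_mult: "cnj_mat (Y ** Z) = cnj_mat Y ** cnj_mat Z" for Y Z :: "complex^'m^'m"
  by (simp add: cnj_mat_def vec_eq_iff matrix_matrix_mult_def)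

text \<open>A drop of the type by one always changes the side, which puts the lifts of horizontal
  vectors into the Killing complement of the Lie algebra of \<open>K\<close>. Products of two
  lowering maps have trace zero and the two mixed products are conjugate: this is the source of the
  factor \<open>2\<close> and of the real part.\<close>

lemma cartan_inner_horizontal:
  assumes Y: "Y \<in> horizontal_space Q x" and Z: "Z \<in> horizontal_space Q x"
  shows "cartan_inner Q x (real_tangent Q x Y) (real_tangent Q x Z) = 2 * (real CARD('m) + 2) * Re (trace (Y ** cnj_mat Z))"
proof -
  have tan: "W \<in> tangent_space Q x" if "W \<in> horizontal_space Q x" for W
    using that by (simp add: horizontal_space_def)
  obtain \<xi> \<eta> where \<xi>: "complexify \<xi> = Y + cnj_mat Y" and \<eta>: "complexify \<eta> = Z + cnj_mat Z"
    using real_tangent_exists by metis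
  have rt: "real_tangent Q x Y = \<xi>" "real_tangent Q x Z = \<eta>"
    by (rule real_tangent_eqI[OF tan[OF Y] \<xi>], rule real_tangent_eqI[OF tan[OF Z] \<eta>])
  have hor: "\<And>k l. ent W k l \<noteq> 0 \<Longrightarrow> hodge_type l = Suc (hodge_type k)" if "W \<in> horizontal_space Q x" for W
    using that by (auto simp only: horizontal_iff)
  have side: "\<not> same_side k l" if W: "W \<in> horizontal_space Q x" and "ent (W + cnj_mat W) k l \<noteq> 0" for W k l
  proof -
    have "ent W k l \<noteq> 0 \<or> ent W (flip k) (flip l) \<noteq> 0" using that(2) by (auto simp: ent_linear ent_cnj_mat)
    then have "hodge_type l = Suc (hodge_type k) \<or> hodge_type (flip l) = Suc (hodge_type (flip k))"
      using hor[OF W] by blast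
    then show ?thesis by (auto simp: same_side_def hodge_type_def split: if_splits)
  qed
  have symp: "\<zeta> \<in> symplectic_algebra gram" if "complexify \<zeta> = W + cnj_mat W" "W \<in> horizontal_space Q x" for \<zeta> W
  proof -
    have "infinitesimal Q W" using that(2) by (simp only: horizontal_iff)
    from infinitesimal_real_part[OF this] show ?thesis by (simp add: that(1)[symmetric] infinitesimal_complexify)
  qed
  have "cartan_inner Q x \<xi> \<eta> = (real CARD('m) + 2) * trace (\<xi> ** \<eta>)"
    by (rule cartan_inner_p) (use symp[OF \<xi> Y] symp[OF \<eta> Z] side[OF Y] side[OF Z] \<xi> \<eta> in auto)
  moreover have "complex_of_real (trace (\<xi> ** \<eta>)) = complex_of_real (2 * Re (trace (Y ** cnj_mat Z)))"
  proof -
    have nil: "trace (W ** W') = 0" if "W \<in> horizontal_space Q x" "W' \<in> horizontal_space Q x" for W W'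
    proof -
      have "ent W k l * ent W' l k = 0" for k l
      proof (rule ccontr)
        assume "ent W k l * ent W' l k \<noteq> 0"
        then have "ent W k l \<noteq> 0" "ent W' l k \<noteq> 0" by auto
        from hor[OF that(1) this(1)] hor[OF that(2) this(2)] show False by linarith
      qed
      then show ?thesis by (simp only: trace_mult_ent sum.neutral_const)
    qed
    have cn: "trace (cnj_mat W) = cnj (trace W)" for W :: "complex^'m^'m" by (simp add: trace_def cnj_mat_def)
    have "complex_of_real (trace (\<xi> ** \<eta>)) = trace ((Y + cnj_mat Y) ** (Z + cnj_mat Z))"
      by (simp only: trace_complexify[symmetric] complexify_simps(1) \<xi> \<eta>)
    also have "\<dots> = trace (Y ** Z) + trace (Y ** cnj_mat Z) + trace (cnj_mat Y ** Z) + trace (cnj_mat Y ** cnj_mat Z)"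
      by (simp add: trace_def matrix_matrix_mult_def algebra_simps sum.distrib)
    also have "cnj_mat Y ** cnj_mat Z = cnj_mat (Y ** Z)" by (simp only: cnj_mat_mult)
    also have "cnj_mat Y ** Z = cnj_mat (Y ** cnj_mat Z)" by (simp only: cnj_mat_mult) (simp add: cnj_mat_def)
    also have "trace (Y ** Z) + trace (Y ** cnj_mat Z) + trace (cnj_mat (Y ** cnj_mat Z)) + trace (cnj_mat (Y ** Z))
      = complex_of_real (2 * Re (trace (Y ** cnj_mat Z)))"
      unfolding cn nil[OF Y Z] by (simp add: complex_eq_iff)
    finally show ?thesis .
  qed
  ultimately show ?thesis unfolding rt by (simp only: of_real_eq_iff)
qed

text \<open>Moving back to the base point conjugates by a real matrix, which is compatible with
  \<open>cnj_mat\<close> and leaves the trace unchanged. Multiplication by \<open>\<i>\<close> turns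
  the real part into minus the imaginary part.\<close>

lemma omega_D_horizontal:
  assumes x': "\<exists>f' :: 'n option \<Rightarrow> complex^'m. hodge_frame Q x' f'"
    and Y: "Y \<in> horizontal_space Q x'" and Z: "Z \<in> horizontal_space Q x'"
  shows "omega_D Q x x' Y Z = - 2 * (real CARD('m) + 2) * Im (trace (Y ** cnj_mat Z))"
proof -
  define g where "g = (SOME g. g \<in> aut_group Q \<and> act g x = x')"
  have "\<exists>g. g \<in> aut_group Q \<and> act g x = x'" using x' transitive by blast
  then have g: "g \<in> aut_group Q" "act g x = x'" unfolding g_def by (metis (mono_tags, lifting) someI_ex)+
  have inv: "invertible g" using g by (simp add: aut_group_def)
  define M where "M = complexify g"
  define N where "N = complexify (matrix_inv g)"
  have MN: "M ** N = mat 1" "N ** M = mat 1"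
    by (simp_all only: M_def N_def complexify_simps(1)[symmetric] invertible_matrix_inv[OF inv] complexify_simps(2))
  interpret F: framed Q x' "\<lambda>a. complexify g *v f a"
    by unfold_locales (use frame_act[OF g(1)] g(2) in simp)
  have QM: "Q (M *v u) (M *v w) = Q u w" for u w using g(1) unfolding aut_group_def M_def by blast
  have bM: "F.bv k = M *v bv k" for k by (simp add: basis_vec_def complexify_cnj_vec M_def)
  have cM: "F.co k (M *v u) = co k u" for k u by (simp only: coord_eq_Q bM QM)
  have MNu: "M *v (N *v u) = u" for u by (simp add: matrix_vector_mul_assoc MN)
  have ent: "ent (N ** W ** M) k l = F.ent W k l" for W k l
    using cM[of k "N *v (W *v (M *v bv l))"] by (simp add: entry_def matrix_vector_mul_assoc[symmetric] MNu bM)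
  have pull: "N ** W ** M \<in> horizontal_space Q x" if W: "W \<in> horizontal_space Q x'" for W
    unfolding horizontal_iff
  proof (intro conjI)
    have iW: "infinitesimal Q W" using W by (simp only: F.horizontal_iff)
    show "infinitesimal Q (N ** W ** M)"
      unfolding infinitesimal_def
    proof (intro allI)
      fix u w
      have "Q (M *v ((N ** W ** M) *v u)) (M *v w) + Q (M *v u) (M *v ((N ** W ** M) *v w)) = 0"
        using iW by (simp add: matrix_vector_mul_assoc[symmetric] MNu infinitesimal_def)
      then show "Q ((N ** W ** M) *v u) w + Q u ((N ** W ** M) *v w) = 0" by (simp only: QM)
    qed
    show "\<forall>k l. ent (N ** W ** M) k l \<noteq> 0 \<longrightarrow> hodge_type l = Suc (hodge_type k)"
      unfolding ent using W unfolding F.horizontal_iff by (rule conjunct2)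
  qed
  have iY: "mat \<i> ** Y \<in> horizontal_space Q x'"
    unfolding F.horizontal_iff
  proof (intro conjI)
    show "infinitesimal Q (mat \<i> ** Y)"
      unfolding infinitesimal_def
    proof (intro allI)
      fix u w
      have "\<i> * (Q (Y *v u) w + Q u (Y *v w)) = 0" using Y by (simp only: F.horizontal_iff infinitesimal_def) simp
      then show "Q ((mat \<i> ** Y) *v u) w + Q u ((mat \<i> ** Y) *v w) = 0"
        by (simp only: mat_i_mult Q_left Q_right distrib_left)
    qed
    have "F.ent (mat \<i> ** Y) k l = \<i> * F.ent Y k l" for k l by (simp add: entry_def mat_i_mult coord_linear)
    then show "\<forall>k l. F.ent (mat \<i> ** Y) k l \<noteq> 0 \<longrightarrow> hodge_type l = Suc (hodge_type k)"
      using Y by (simp add: F.horizontal_iff)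
  qed
  have "omega_D Q x x' Y Z = cartan_inner Q x (real_tangent Q x (N ** (mat \<i> ** Y) ** M)) (real_tangent Q x (N ** Z ** M))"
    by (simp only: omega_D_def invariant_metric_def Let_def g_def[symmetric] M_def N_def)
  also have "\<dots> = 2 * (real CARD('m) + 2) * Re (trace ((N ** (mat \<i> ** Y) ** M) ** cnj_mat (N ** Z ** M)))"
    by (rule cartan_inner_horizontal[OF pull[OF iY] pull[OF Z]])
  also have "cnj_mat (N ** Z ** M) = N ** cnj_mat Z ** M"
    by (simp only: cnj_mat_mult) (simp only: M_def N_def cnj_mat_complexify)
  also have "(N ** (mat \<i> ** Y) ** M) ** (N ** cnj_mat Z ** M) = N ** ((mat \<i> ** Y) ** (M ** N) ** cnj_mat Z) ** M"
    by (simp only: matrix_mul_assoc)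
  also have "trace \<dots> = trace (M ** (N ** ((mat \<i> ** Y) ** (M ** N) ** cnj_mat Z)))" by (rule trace_mul_sym)
  also have "\<dots> = trace (mat \<i> ** (Y ** cnj_mat Z))"
    by (simp only: MN matrix_mul_rid matrix_mul_assoc matrix_mul_lid)
  also have "\<dots> = \<i> * trace (Y ** cnj_mat Z)"
  proof -
    have "(mat \<i> ** W) $ i $ i = \<i> * W $ i $ i" for W :: "complex^'m^'m" and i
      by (simp add: matrix_matrix_mult_def mat_def if_distrib if_distribR cong: if_cong)
    then show ?thesis by (simp add: trace_def sum_distrib_left)
  qed
  finally show ?thesis by (simp add: algebra_simps)
qed

end

section \<open>Sections and the differential\<close>

lemma holo_onD:
  fixes s :: "complex^'a \<Rightarrow> complex^'b"
  assumes "holo_on s N" "z \<in> N"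
  shows "(s has_derivative frechet_derivative s (at z)) (at z)"
    and "frechet_derivative s (at z) (c *s v) = c *s frechet_derivative s (at z) v"
    and "frechet_derivative s (at z) (v + w) = frechet_derivative s (at z) v + frechet_derivative s (at z) w"
    and "frechet_derivative s (at z) 0 = 0"
proof -
  obtain f' where f': "(s has_derivative f') (at z)" "Vector_Spaces.linear (*s) (*s) f'"
    using assms unfolding holo_on_def by blast
  have e: "frechet_derivative s (at z) = f'" using f'(1) frechet_derivative_at by metis
  show "(s has_derivative frechet_derivative s (at z)) (at z)" using f' e by simp
  show "frechet_derivative s (at z) (c *s v) = c *s frechet_derivative s (at z) v"
    "frechet_derivative s (at z) (v + w) = frechet_derivative s (at z) v + frechet_derivative s (at z) w"
    using f'(2) unfolding e by (auto simp: Vector_Spaces.linear_iff)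
  show "frechet_derivative s (at z) 0 = 0" unfolding e by (rule linear_0[OF has_derivative_linear[OF f'(1)]])
qed

lemma holo_onI:
  fixes s :: "complex^'a \<Rightarrow> complex^'b"
  assumes "\<And>z. z \<in> N \<Longrightarrow> (s has_derivative f' z) (at z)" "\<And>z c v. z \<in> N \<Longrightarrow> f' z (c *s v) = c *s f' z v"
  shows "holo_on s N"
  unfolding holo_on_def
proof
  fix z assume z: "z \<in> N"
  have "linear (f' z)" using assms(1)[OF z] has_derivative_linear by blast
  then have "Vector_Spaces.linear (*s) (*s) (f' z)"
    using assms(2)[OF z] by (simp add: Vector_Spaces.linear_iff vec.vector_space_axioms linear_add)
  then show "\<exists>f'. (s has_derivative f') (at z) \<and> Vector_Spaces.linear (*s) (*s) f'"
    using assms(1)[OF z] by blast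
qed

lemma has_derivative_vec_nthI:
  fixes s :: "'x::real_normed_vector \<Rightarrow> complex^'b"
  assumes "\<And>k. ((\<lambda>w. s w $ k) has_derivative (\<lambda>v. f' v $ k)) (at z)"
  shows "(s has_derivative f') (at z)"
  unfolding has_derivative_componentwise_within[of s]
  using assms by (auto simp: Basis_vec_def inner_axis intro!: has_derivative_inner_left)

lemma holo_on_iff:
  fixes s :: "complex^'a \<Rightarrow> complex^'b"
  shows "holo_on s N \<longleftrightarrow> (\<forall>z\<in>N. \<forall>k. cdiff (\<lambda>w. s w $ k) z)"
proof
  assume h: "holo_on s N"
  show "\<forall>z\<in>N. \<forall>k. cdiff (\<lambda>w. s w $ k) z"
  proof (intro ballI allI)
    fix z k assume z: "z \<in> N"
    have "((\<lambda>w. s w $ k) has_derivative (\<lambda>v. frechet_derivative s (at z) v $ k)) (at z)"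
      by (rule bounded_linear.has_derivative[OF bounded_linear_vec_nth holo_onD(1)[OF h z]])
    then show "cdiff (\<lambda>w. s w $ k) z"
      unfolding cdiff_def using holo_onD(2)[OF h z] by (intro exI[of _ "\<lambda>v. frechet_derivative s (at z) v $ k"]) simp
  qed
next
  assume c: "\<forall>z\<in>N. \<forall>k. cdiff (\<lambda>w. s w $ k) z"
  show "holo_on s N"
  proof (rule holo_onI)
    fix z assume z: "z \<in> N"
    show "(s has_derivative (\<lambda>v. \<chi> k. frechet_derivative (\<lambda>w. s w $ k) (at z) v)) (at z)"
      by (rule has_derivative_vec_nthI) (use c z cdiffD(1) in auto)
  next
    fix z c' v assume "z \<in> N"
    then show "(\<chi> k. frechet_derivative (\<lambda>w. s w $ k) (at z) (c' *s v)) = c' *s (\<chi> k. frechet_derivative (\<lambda>w. s w $ k) (at z) v)"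
      using c cdiffD(2) by (fastforce simp: vec_eq_iff)
  qed
qed

lemma frechet_derivative_nth:
  fixes s :: "complex^'a \<Rightarrow> complex^'b"
  assumes "holo_on s N" "z \<in> N"
  shows "frechet_derivative s (at z) v $ k = frechet_derivative (\<lambda>w. s w $ k) (at z) v"
proof -
  have "((\<lambda>w. s w $ k) has_derivative (\<lambda>v. frechet_derivative s (at z) v $ k)) (at z)"
    by (rule bounded_linear.has_derivative[OF bounded_linear_vec_nth holo_onD(1)[OF assms]])
  then have "frechet_derivative (\<lambda>w. s w $ k) (at z) = (\<lambda>v. frechet_derivative s (at z) v $ k)"
    using frechet_derivative_at by metis
  then show ?thesis by simp
qed

lemma cdiff_transform:
  assumes "cdiff f z" "open N" "z \<in> N" "\<And>w. w \<in> N \<Longrightarrow> f w = g w"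
  shows "cdiff g z"
  using assms(1) has_derivative_transform_within_open[OF _ assms(2,3), of f _ UNIV g] assms(4)
  unfolding cdiff_def by blast

text \<open>Coordinate derivatives of sections are treated as sections and differentiated again;
  componentwise this is \<open>cdiff_frechet_derivative\<close>.\<close>

lemma holo_on_derivative:
  fixes s :: "complex^'a \<Rightarrow> complex^'b"
  assumes N: "open N" and s: "holo_on s N"
  shows "holo_on (\<lambda>z. frechet_derivative s (at z) v) N"
  unfolding holo_on_iff
proof (intro ballI allI)
  fix z k assume z: "z \<in> N"
  have "cdiff (\<lambda>z. frechet_derivative (\<lambda>w. s w $ k) (at z) v) z"
    by (rule cdiff_frechet_derivative[OF N _ z]) (use s holo_on_iff in blast)
  then show "cdiff (\<lambda>w. frechet_derivative s (at w) v $ k) z"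
    by (rule cdiff_transform[OF _ N z]) (simp add: frechet_derivative_nth[OF s])
qed

lemma holo_on_subset: "holo_on s N \<Longrightarrow> N' \<subseteq> N \<Longrightarrow> holo_on s N'"
  unfolding holo_on_def by blast

lemma bounded_linear_smult_right: "bounded_linear (\<lambda>v::complex^'b. c *s v)"
  by (rule bounded_linear_intro[where K = "cmod c"])
     (auto simp: vec_eq_iff algebra_simps norm_smult_vec mult.commute)

lemma bounded_bilinear_smult: "bounded_bilinear (\<lambda>(c::complex) (v::complex^'b). c *s v)"
proof
  show "\<exists>K. \<forall>a b. norm (a *s b :: complex^'b) \<le> norm a * norm b * K"
    by (intro exI[of _ 1]) (simp add: norm_smult_vec)
qed (auto simp: vec_eq_iff algebra_simps scaleR_conv_of_real[where 'a=complex])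

lemma holo_on_sum:
  fixes s :: "'i \<Rightarrow> complex^'a \<Rightarrow> complex^'b"
  assumes "\<And>i. i \<in> I \<Longrightarrow> holo_on (s i) N"
  shows "holo_on (\<lambda>w. \<Sum>i\<in>I. c i *s s i w) N"
    and "z \<in> N \<Longrightarrow> frechet_derivative (\<lambda>w. \<Sum>i\<in>I. c i *s s i w) (at z) v = (\<Sum>i\<in>I. c i *s frechet_derivative (s i) (at z) v)"
proof -
  have d: "((\<lambda>w. \<Sum>i\<in>I. c i *s s i w) has_derivative (\<lambda>v. \<Sum>i\<in>I. c i *s frechet_derivative (s i) (at z) v)) (at z)" if "z \<in> N" for z
    by (intro has_derivative_sum bounded_linear.has_derivative[OF bounded_linear_smult_right] holo_onD(1)[OF assms that])
  show "holo_on (\<lambda>w. \<Sum>i\<in>I. c i *s s i w) N"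
    by (rule holo_onI[OF d]) (auto simp: holo_onD(2)[OF assms] vec.scale_sum_right mult.commute intro!: sum.cong)
  show "frechet_derivative (\<lambda>w. \<Sum>i\<in>I. c i *s s i w) (at z) v = (\<Sum>i\<in>I. c i *s frechet_derivative (s i) (at z) v)" if "z \<in> N"
    by (rule fun_cong[OF frechet_derivative_at[OF d[OF that]], symmetric])
qed

lemma holo_on_diff:
  fixes s t :: "complex^'a \<Rightarrow> complex^'b"
  assumes "holo_on s N" "holo_on t N"
  shows "holo_on (\<lambda>w. s w - t w) N"
    and "z \<in> N \<Longrightarrow> frechet_derivative (\<lambda>w. s w - t w) (at z) v = frechet_derivative s (at z) v - frechet_derivative t (at z) v"
proof -
  have d: "((\<lambda>w. s w - t w) has_derivative (\<lambda>v. frechet_derivative s (at z) v - frechet_derivative t (at z) v)) (at z)" if "z \<in> N" for z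
    by (intro has_derivative_diff holo_onD(1)[OF assms(1) that] holo_onD(1)[OF assms(2) that])
  show "holo_on (\<lambda>w. s w - t w) N"
    by (rule holo_onI[OF d]) (auto simp: holo_onD(2)[OF assms(1)] holo_onD(2)[OF assms(2)] vec.scale_right_diff_distrib)
  show "frechet_derivative (\<lambda>w. s w - t w) (at z) v = frechet_derivative s (at z) v - frechet_derivative t (at z) v" if "z \<in> N"
    by (rule fun_cong[OF frechet_derivative_at[OF d[OF that]], symmetric])
qed

lemma holo_on_smult:
  fixes s :: "complex^'a \<Rightarrow> complex^'b"
  assumes g: "\<And>z. z \<in> N \<Longrightarrow> cdiff g z" and s: "holo_on s N"
  shows "holo_on (\<lambda>w. g w *s s w) N"
proof (rule holo_onI)
  fix z assume z: "z \<in> N"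
  show "((\<lambda>w. g w *s s w) has_derivative
      (\<lambda>v. g z *s frechet_derivative s (at z) v + frechet_derivative g (at z) v *s s z)) (at z)"
    by (rule bounded_bilinear.FDERIV[OF bounded_bilinear_smult cdiffD(1)[OF g[OF z]] holo_onD(1)[OF s z]])
qed (simp add: holo_onD(2)[OF s] cdiffD(2)[OF g] vec.scale_right_distrib mult_ac)

lemma cdiff_inverse:
  assumes "cdiff g z" "g z \<noteq> 0"
  shows "cdiff (\<lambda>w. inverse (g w)) z"
proof -
  obtain g' where g': "(g has_derivative g') (at z)" "\<And>c v. g' (c *s v) = c * g' v"
    using assms(1) unfolding cdiff_def by blast
  have "((\<lambda>w. inverse (g w)) has_derivative (\<lambda>h. - (inverse (g z) * g' h * inverse (g z)))) (at z)"
    by (rule Deriv.has_derivative_inverse[OF assms(2) g'(1)])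
  then show ?thesis unfolding cdiff_def using g'(2) by (auto simp: mult_ac)
qed

context polarized
begin

lemma scaleR_smult: "r *\<^sub>R v = complex_of_real r *s v" for v :: "complex^'b"
  by (simp add: vec_eq_iff scaleR_conv_of_real[where 'a=complex])

lemma bounded_bilinear_Q: "bounded_bilinear Q"
  unfolding bilinear_conv_bounded_bilinear[symmetric] bilinear_def
  by (auto intro!: linearI simp: Q_left Q_right scaleR_smult scaleR_conv_of_real[where 'a=complex])

lemma bounded_bilinear_herm: "bounded_bilinear (herm Q)"
  unfolding bilinear_conv_bounded_bilinear[symmetric] bilinear_def
  by (auto intro!: linearI simp: herm_left herm_right scaleR_smult scaleR_conv_of_real[where 'a=complex])

lemma Q_derivative_zero:
  assumes s: "holo_on s N" and t: "holo_on t N" and N: "open N" "z \<in> N"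
    and 0: "\<And>w. w \<in> N \<Longrightarrow> Q (s w) (t w) = 0"
  shows "Q (frechet_derivative s (at z) v) (t z) + Q (s z) (frechet_derivative t (at z) v) = 0"
proof -
  have d: "((\<lambda>w. Q (s w) (t w)) has_derivative
      (\<lambda>v. Q (s z) (frechet_derivative t (at z) v) + Q (frechet_derivative s (at z) v) (t z))) (at z)"
    by (rule bounded_bilinear.FDERIV[OF bounded_bilinear_Q holo_onD(1)[OF s N(2)] holo_onD(1)[OF t N(2)]])
  have "((\<lambda>w. 0) has_derivative (\<lambda>v. Q (s z) (frechet_derivative t (at z) v) + Q (frechet_derivative s (at z) v) (t z))) (at z)"
    by (rule has_derivative_transform_within_open[OF d N 0])
  then have "(\<lambda>v. Q (s z) (frechet_derivative t (at z) v) + Q (frechet_derivative s (at z) v) (t z)) = (\<lambda>v. 0)"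
    using has_derivative_unique has_derivative_const by blast
  then show ?thesis by (metis add.commute)
qed

text \<open>\<open>herm Q\<close> is conjugate-linear in its second argument, so for holomorphic
  \<open>s\<close> and \<open>t\<close> the holomorphic derivatives fall on \<open>s\<close> and the
  antiholomorphic ones on \<open>t\<close>.\<close>

lemma has_wirt_herm:
  assumes s: "holo_on s N" and t: "holo_on t N" and z: "z \<in> N"
  shows "has_wirt (\<lambda>w. herm Q (s w) (t w)) (\<lambda>i. herm Q (frechet_derivative s (at z) (axis i 1)) (t z))
    (\<lambda>i. herm Q (s z) (frechet_derivative t (at z) (axis i 1))) z"
proof -
  have d: "((\<lambda>w. herm Q (s w) (t w)) has_derivative
      (\<lambda>v. herm Q (s z) (frechet_derivative t (at z) v) + herm Q (frechet_derivative s (at z) v) (t z))) (at z)"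
    by (rule bounded_bilinear.FDERIV[OF bounded_bilinear_herm holo_onD(1)[OF s z] holo_onD(1)[OF t z]])
  have a: "axis i \<i> = \<i> *s axis i 1" for i :: 'a by (simp add: vec_eq_iff axis_def)
  show ?thesis unfolding has_wirt_def
    by (intro exI conjI allI, rule d) (simp_all add: a holo_onD(2)[OF s z] holo_onD(2)[OF t z] herm_left herm_right algebra_simps)
qed

end

context framed
begin

lemma Fil_orthogonal:
  assumes "u \<in> Fil x p" "w \<in> Fil x q" "p + q \<ge> 4"
  shows "Q u w = 0"
proof -
  have "co (flip k) u * co k w = 0" for k
  proof (cases "hodge_type k < q")
    case True then show ?thesis using assms(2) by (simp add: Fil_eq)
  next
    case False
    then have "hodge_type (flip k) < p" using assms(3) hodge_type_le[of k] by (simp add: hodge_type_flip)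
    then show ?thesis using assms(1) by (simp add: Fil_eq)
  qed
  then show ?thesis by (simp only: Q_expand mult.assoc mult_zero_right sum.neutral_const)
qed

lemma Fil_orthogonalD:
  assumes "\<And>w. w \<in> Fil x (4 - p) \<Longrightarrow> Q u w = 0" "p \<le> 3"
  shows "u \<in> Fil x p"
  unfolding Fil_eq mem_Collect_eq
proof (intro allI impI)
  fix k :: "'n option \<times> bool" assume k: "hodge_type k < p"
  have "bv (flip k) \<in> Fil x (4 - p)" using k assms(2) by (auto simp: Fil_eq co_bv hodge_type_flip)
  then have "Q u (bv (flip k)) = 0" by (rule assms(1))
  then show "co k u = 0" by (simp add: coord_eq_Q)
qed

lemma Fil_subspace: "vec.subspace (Fil x p)"
  unfolding Fil_eq by (rule subspace_co)

end

lemma hol_section_subset: "hol_section \<phi> p N s \<Longrightarrow> open N' \<Longrightarrow> N' \<subseteq> N \<Longrightarrow> hol_section \<phi> p N' s"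
  unfolding hol_section_def using holo_on_subset by blast

section \<open>Charts of a slice: local sections and velocities\<close>

locale hodge_chart = polarized Q for Q :: "complex^'m \<Rightarrow> complex^'m \<Rightarrow> complex" +
  fixes n :: nat and W :: "(complex^'n::finite) set" and \<phi> :: "complex^'n \<Rightarrow> 'm::finite hodge"
  assumes dim: "CARD('n) = n" and chart: "horizontal_chart n Q W \<phi>"
begin

lemma frame_ex:
  assumes z: "z \<in> W"
  shows "\<exists>f :: 'n option \<Rightarrow> complex^'m. hodge_frame Q (\<phi> z) f"
proof -
  have "\<phi> ` W \<subseteq> classifying_space n Q"
    using chart unfolding horizontal_chart_def holo_into_D_def by (elim conjE)
  then have "\<phi> z \<in> classifying_space n Q" using imageI[OF z] by (rule subsetD)
  then show ?thesis using dim by (rule hodge_frame_exists)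
qed

lemma Fil_sub: "z \<in> W \<Longrightarrow> vec.subspace (Fil (\<phi> z) p)"
proof -
  assume "z \<in> W"
  then obtain f :: "'n option \<Rightarrow> complex^'m" where "hodge_frame Q (\<phi> z) f" using frame_ex by blast
  then interpret framed Q "\<phi> z" f by unfold_locales
  show ?thesis by (rule Fil_subspace)
qed

lemma hol_section_sum:
  assumes "finite I" "\<And>i. i \<in> I \<Longrightarrow> c i = 0 \<or> hol_section \<phi> p N (s i)" "\<And>i. i \<in> I \<Longrightarrow> holo_on (s i) N" "open N" "N \<subseteq> W"
  shows "hol_section \<phi> p N (\<lambda>w. \<Sum>i\<in>I. c i *s s i w)"
  unfolding hol_section_def
proof (intro conjI ballI)
  show "holo_on (\<lambda>w. \<Sum>i\<in>I. c i *s s i w) N" by (rule holo_on_sum(1)) (use assms in auto)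
  fix w assume w: "w \<in> N"
  have sub: "vec.subspace (Fil (\<phi> w) p)" using Fil_sub w assms by blast
  show "(\<Sum>i\<in>I. c i *s s i w) \<in> Fil (\<phi> w) p"
  proof (rule vec.subspace_sum[OF sub])
    fix i assume "i \<in> I"
    then show "c i *s s i w \<in> Fil (\<phi> w) p"
      using assms(2)[of i] w vec.subspace_scale[OF sub] vec.subspace_0[OF sub] by (auto simp: hol_section_def)
  qed
qed (use assms in auto)

text \<open>Combinations of the local generators with constant coefficients are again sections, and
  at \<open>z\<close> they already reach every vector of the fibre.\<close>

lemma section_exists:
  assumes z: "z \<in> W" and p: "p \<in> {1..3}" and u: "u \<in> Fil (\<phi> z) p"
  shows "\<exists>N s. z \<in> N \<and> N \<subseteq> W \<and> hol_section \<phi> p N s \<and> s z = u"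
proof -
  obtain N S where N: "z \<in> N" "N \<subseteq> W" "finite S" "\<forall>s\<in>S. hol_section \<phi> p N s" "open N"
    "\<forall>w\<in>N. Fil (\<phi> w) p = vec.span ((\<lambda>s. s w) ` S)"
    using bspec[OF bspec[OF chart[unfolded horizontal_chart_def holo_into_D_def,
      THEN conjunct2, THEN conjunct2, THEN conjunct1, THEN conjunct2] z] p] by (elim exE conjE)
  define V where "V = {u. \<exists>c. u = (\<Sum>s\<in>S. c s *s s z)}"
  have "vec.subspace V"
    unfolding vec.subspace_def
  proof (intro conjI ballI allI)
    show "0 \<in> V" unfolding V_def mem_Collect_eq by (intro exI[of _ "\<lambda>_. 0"]) simp
  next
    fix a b assume "a \<in> V" "b \<in> V"
    then obtain c d where "a = (\<Sum>s\<in>S. c s *s s z)" "b = (\<Sum>s\<in>S. d s *s s z)" unfolding V_def by blast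
    then show "a + b \<in> V" unfolding V_def mem_Collect_eq
      by (intro exI[of _ "\<lambda>s. c s + d s"]) (simp add: vec.scale_left_distrib sum.distrib)
  next
    fix r a assume "a \<in> V"
    then obtain c where "a = (\<Sum>s\<in>S. c s *s s z)" unfolding V_def by blast
    then show "r *s a \<in> V" unfolding V_def mem_Collect_eq
      by (intro exI[of _ "\<lambda>s. r * c s"]) (simp add: vec.scale_sum_right)
  qed
  moreover have "(\<lambda>s. s z) ` S \<subseteq> V"
  proof (intro image_subsetI)
    fix t assume t: "t \<in> S"
    have "(\<Sum>s\<in>S. (if s = t then 1 else 0) *s s z) = (\<Sum>s\<in>S. if s = t then t z else 0)"
      by (intro sum.cong) auto
    then have "t z = (\<Sum>s\<in>S. (if s = t then 1 else 0) *s s z)" using t N(3) by simp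
    then show "t z \<in> V" unfolding V_def mem_Collect_eq by (intro exI[of _ "\<lambda>s. if s = t then 1 else 0"])
  qed
  ultimately have "vec.span ((\<lambda>s. s z) ` S) \<subseteq> V" by (intro vec.span_minimal)
  then have "u \<in> V" using N(1,6) u by blast
  then obtain c where c: "u = (\<Sum>s\<in>S. c s *s s z)" unfolding V_def by blast
  have "hol_section \<phi> p N (\<lambda>w. \<Sum>s\<in>S. c s *s s w)"
    by (rule hol_section_sum[OF N(3)]) (use N in \<open>auto simp: hol_section_def\<close>)
  then show ?thesis using N(1,2) c by blast
qed

lemma sections_orthogonal:
  assumes s: "hol_section \<phi> p N s" and t: "hol_section \<phi> q N' t" and z: "z \<in> N" "z \<in> N'" "N \<subseteq> W" and pq: "p + q \<ge> 4"
  shows "Q (frechet_derivative s (at z) v) (t z) + Q (s z) (frechet_derivative t (at z) v) = 0"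
proof (rule Q_derivative_zero[where N = "N \<inter> N'"])
  show "holo_on s (N \<inter> N')" "holo_on t (N \<inter> N')" "open (N \<inter> N')" "z \<in> N \<inter> N'"
    using s t z by (auto simp: hol_section_def intro: holo_on_subset)
  fix w assume w: "w \<in> N \<inter> N'"
  then obtain f :: "'n option \<Rightarrow> complex^'m" where "hodge_frame Q (\<phi> w) f" using frame_ex z by blast
  then interpret framed Q "\<phi> w" f by unfold_locales
  show "Q (s w) (t w) = 0" using Fil_orthogonal[OF _ _ pq] s t w by (simp add: hol_section_def)
qed

text \<open>\<open>F\<^sup>p\<close> is the \<open>Q\<close>-orthogonal complement of \<open>F\<^sup>4\<^sup>-\<^sup>p\<close>, so it suffices to differentiate \<open>Q s t = 0\<close>.\<close>

lemma vanishing_section: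
  assumes s: "hol_section \<phi> p N s" and z: "z \<in> N" "N \<subseteq> W" and p: "p \<in> {1..3}" and 0: "s z = 0"
  shows "frechet_derivative s (at z) v \<in> Fil (\<phi> z) p"
proof -
  have zW: "z \<in> W" using z by blast
  then obtain f :: "'n option \<Rightarrow> complex^'m" where "hodge_frame Q (\<phi> z) f" using frame_ex by blast
  then interpret framed Q "\<phi> z" f by unfold_locales
  show ?thesis
  proof (rule Fil_orthogonalD)
    fix w assume "w \<in> Fil (\<phi> z) (4 - p)"
    then obtain N' t where t: "z \<in> N'" "N' \<subseteq> W" "hol_section \<phi> (4 - p) N' t" "t z = w"
      using section_exists[OF zW, of "4 - p"] p by force
    have "Q (frechet_derivative s (at z) v) (t z) + Q (s z) (frechet_derivative t (at z) v) = 0"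
      by (rule sections_orthogonal[OF s t(3) z(1) t(1) z(2)]) (use p in auto)
    then show "Q (frechet_derivative s (at z) v) w = 0" by (simp add: 0 t(4))
  qed (use p in auto)
qed

text \<open>The property that \<open>differential\<close> describes, kept apart so that existence
  and uniqueness can be proved before the description is used.\<close>

definition velocity :: "complex^'n \<Rightarrow> complex^'n \<Rightarrow> complex^'m^'m \<Rightarrow> bool"
  where "velocity z v Y \<longleftrightarrow> Y \<in> tangent_space Q (\<phi> z) \<and>
    (\<forall>p\<in>{1..3}. \<forall>N s. z \<in> N \<and> N \<subseteq> W \<and> hol_section \<phi> p N s \<longrightarrow>
       frechet_derivative s (at z) v - Y *v s z \<in> Fil (\<phi> z) p)"

text \<open>A lowering entry in column \<open>l\<close> is read off from a section through the basis
  vector \<open>bv l\<close>; the remaining entries of a tangent vector are zero.\<close>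

lemma velocity_unique:
  assumes z: "z \<in> W" and Y: "velocity z v Y" and Y': "velocity z v Y'"
  shows "Y = Y'"
proof -
  obtain f :: "'n option \<Rightarrow> complex^'m" where "hodge_frame Q (\<phi> z) f" using frame_ex z by blast
  then interpret framed Q "\<phi> z" f by unfold_locales
  show ?thesis
  proof (rule ent_eqI)
    fix k l
    show "ent Y k l = ent Y' k l"
    proof (cases "hodge_type k < hodge_type l")
      case True
      then have p: "hodge_type l \<in> {1..3}" using hodge_type_le[of l] by auto
      have "bv l \<in> Fil (\<phi> z) (hodge_type l)" by (auto simp: Fil_eq co_bv)
      then obtain N s where s: "z \<in> N" "N \<subseteq> W" "hol_section \<phi> (hodge_type l) N s" "s z = bv l"
        using section_exists[OF z p] by blast
      have "frechet_derivative s (at z) v - Y *v bv l \<in> Fil (\<phi> z) (hodge_type l)"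
        "frechet_derivative s (at z) v - Y' *v bv l \<in> Fil (\<phi> z) (hodge_type l)"
        using Y Y' p s unfolding velocity_def by metis+
      then have "co k (frechet_derivative s (at z) v - Y *v bv l) = 0" "co k (frechet_derivative s (at z) v - Y' *v bv l) = 0"
        using True by (auto simp: Fil_eq)
      then show ?thesis by (simp add: coord_linear entry_def)
    next
      case False
      then show ?thesis using Y Y' unfolding velocity_def tangent_iff by (simp add: not_less)
    qed
  qed
qed

text \<open>The lowering entries of \<open>Y\<close> are prescribed by the derivatives of sections
  through the basis vectors. Differentiating the vanishing pairing under \<open>Q\<close> of two
  such sections makes \<open>Y\<close> infinitesimal.\<close>

lemma velocity_exists:
  assumes z: "z \<in> W"
  shows "\<exists>Y. velocity z v Y"
proof -
  obtain f :: "'n option \<Rightarrow> complex^'m" where "hodge_frame Q (\<phi> z) f" using frame_ex z by blast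
  then interpret framed Q "\<phi> z" f by unfold_locales
  \<comment> \<open>Type 0 is left out: no type lies below it, so its columns of \<open>Y\<close>
    are zero.\<close>
  have "\<exists>N s. z \<in> N \<and> N \<subseteq> W \<and> hol_section \<phi> (hodge_type k) N s \<and> s z = bv k" if "hodge_type k \<noteq> 0" for k
    by (rule section_exists[OF z]) (use that hodge_type_le[of k] in \<open>auto simp: Fil_eq co_bv\<close>)
  then obtain M t where t: "\<And>k. hodge_type k \<noteq> 0 \<Longrightarrow>
      z \<in> M k \<and> M k \<subseteq> W \<and> hol_section \<phi> (hodge_type k) (M k) (t k) \<and> t k z = bv k"
    by metis
  define Y where "Y = frame_matrix (\<lambda>k l. if hodge_type k < hodge_type l then co k (frechet_derivative (t l) (at z) v) else 0)"
  have eY: "ent Y k l = (if hodge_type k < hodge_type l then co k (frechet_derivative (t l) (at z) v) else 0)" for k l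
    unfolding Y_def by (rule ent_frame_matrix)
  have "infinitesimal Q Y"
    unfolding infinitesimal_iff
  proof (intro allI)
    fix k l :: "'n option \<times> bool"
    \<comment> \<open>Both terms involve a lowering entry under one condition, that the types add up
      to at least 4. Under this condition the corresponding steps of the filtration are
      orthogonal.\<close>
    have c: "hodge_type (flip k) < hodge_type l \<longleftrightarrow> hodge_type k + hodge_type l \<ge> 4"
      "hodge_type (flip l) < hodge_type k \<longleftrightarrow> hodge_type k + hodge_type l \<ge> 4"
      using hodge_type_le[of k] hodge_type_le[of l] by (auto simp: hodge_type_flip)
    show "(if snd k then - \<i> else \<i>) * ent Y (flip k) l + (if snd l then \<i> else - \<i>) * ent Y (flip l) k = 0"
    proof (cases "hodge_type k + hodge_type l \<ge> 4")
      case True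
      then have nz: "hodge_type k \<noteq> 0" "hodge_type l \<noteq> 0" using hodge_type_le[of k] hodge_type_le[of l] by auto
      have "Q (frechet_derivative (t l) (at z) v) (t k z) + Q (t l z) (frechet_derivative (t k) (at z) v) = 0"
        by (rule sections_orthogonal[where p = "hodge_type l" and q = "hodge_type k" and N = "M l" and N' = "M k"])
           (use t[OF nz(1)] t[OF nz(2)] True in auto)
      then have "Q (frechet_derivative (t l) (at z) v) (bv k) + Q (bv l) (frechet_derivative (t k) (at z) v) = 0"
        using t[OF nz(1)] t[OF nz(2)] by simp
      moreover have "Q u (bv k) = (if snd k then - \<i> else \<i>) * co (flip k) u" for u by (simp add: coord_eq_Q)
      moreover have "Q (bv l) u = (if snd l then \<i> else - \<i>) * co (flip l) u" for u
        using Q_skew[of "bv l" u] by (auto simp: coord_eq_Q)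
      ultimately show ?thesis using True by (simp add: eY c)
    next
      case False
      then show ?thesis by (simp add: eY c)
    qed
  qed
  then have tan: "Y \<in> tangent_space Q (\<phi> z)" by (simp add: tangent_iff eY)
  have "frechet_derivative s (at z) v - Y *v s z \<in> Fil (\<phi> z) p"
    if p: "p \<in> {1..3}" and N: "z \<in> N" "N \<subseteq> W" and s: "hol_section \<phi> p N s" for p N s
  proof -
    define I where "I = {k :: 'n option \<times> bool. p \<le> hodge_type k}"
    define c where "c k = co k (s z)" for k
    define N' where "N' = N \<inter> (\<Inter>k\<in>I. M k)"
    have nz: "hodge_type k \<noteq> 0" if "k \<in> I" for k using that p by (auto simp: I_def)
    have "open (M k)" if "k \<in> I" for k using t[OF nz[OF that]] by (simp add: hol_section_def)
    then have N'o: "open N'" using s unfolding N'_def by (intro open_Int open_INT) (auto simp: hol_section_def)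
    have zN': "z \<in> N'" using N t nz by (auto simp: N'_def)
    have tk: "hol_section \<phi> p N' (t k)" if "k \<in> I" for k
    proof -
      have h: "hol_section \<phi> (hodge_type k) N' (t k)"
        by (rule hol_section_subset[OF _ N'o]) (use t[OF nz[OF that]] that in \<open>auto simp: N'_def\<close>)
      have "Fil (\<phi> w) (hodge_type k) \<subseteq> Fil (\<phi> w) p" for w
        unfolding Fil_def using that by (intro vec.span_mono UN_mono) (auto simp: I_def)
      then show ?thesis using h by (auto simp: hol_section_def)
    qed
    have sN': "hol_section \<phi> p N' s" by (rule hol_section_subset[OF s N'o]) (auto simp: N'_def)
    have N'W: "N' \<subseteq> W" using N by (auto simp: N'_def)
    \<comment> \<open>A combination with constant coefficients that agrees with \<open>s\<close> at
      \<open>z\<close>. By \<open>vanishing_section\<close> the derivative of the difference lies in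
      the fibre, so it suffices to treat the sections \<open>t k\<close>.\<close>
    define r where "r w = (\<Sum>k\<in>I. c k *s t k w)" for w
    have r: "hol_section \<phi> p N' r"
      unfolding r_def[abs_def] by (rule hol_section_sum[OF _ _ _ N'o N'W]) (use tk in \<open>auto simp: hol_section_def\<close>)
    have sz: "s z = (\<Sum>k\<in>I. c k *s bv k)"
    proof -
      have "s z \<in> Fil (\<phi> z) p" using s N by (simp add: hol_section_def)
      then have z0: "c k = 0" if "k \<notin> I" for k using that by (auto simp: Fil_eq I_def c_def)
      have "s z = (\<Sum>k\<in>UNIV. c k *s bv k)" unfolding c_def by (rule expand)
      also have "\<dots> = (\<Sum>k\<in>I. c k *s bv k)" by (rule sum.mono_neutral_right) (auto simp: z0)
      finally show ?thesis .
    qed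
    have rz: "r z = s z" unfolding sz r_def using t nz by (intro sum.cong) auto
    have "hol_section \<phi> p N' (\<lambda>w. s w - r w)"
      unfolding hol_section_def
    proof (intro conjI ballI)
      show "open N'" by (rule N'o)
      show "holo_on (\<lambda>w. s w - r w) N'" using sN' r by (intro holo_on_diff) (auto simp: hol_section_def)
      fix w assume "w \<in> N'"
      then show "s w - r w \<in> Fil (\<phi> w) p"
        using sN' r N'W by (intro vec.subspace_diff Fil_sub) (auto simp: hol_section_def)
    qed
    then have "frechet_derivative (\<lambda>w. s w - r w) (at z) v \<in> Fil (\<phi> z) p"
      by (rule vanishing_section[OF _ zN' N'W p]) (simp add: rz)
    then have 1: "frechet_derivative s (at z) v - (\<Sum>k\<in>I. c k *s frechet_derivative (t k) (at z) v) \<in> Fil (\<phi> z) p"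
      using holo_on_diff(2)[of s N' r z v] holo_on_sum(2)[of I t N' z c v] sN' r tk zN'
      by (simp add: hol_section_def r_def[abs_def])
    have 2: "(\<Sum>k\<in>I. c k *s (frechet_derivative (t k) (at z) v - Y *v bv k)) \<in> Fil (\<phi> z) p"
    proof (intro vec.subspace_sum[OF Fil_subspace] vec.subspace_scale[OF Fil_subspace])
      fix k assume k: "k \<in> I"
      show "frechet_derivative (t k) (at z) v - Y *v bv k \<in> Fil (\<phi> z) p"
        unfolding Fil_eq mem_Collect_eq
      proof (intro allI impI)
        fix j :: "'n option \<times> bool" assume "hodge_type j < p"
        then have "hodge_type j < hodge_type k" using k by (simp add: I_def)
        then have "co j (Y *v bv k) = co j (frechet_derivative (t k) (at z) v)" using eY[of j k] by (simp add: entry_def)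
        then show "co j (frechet_derivative (t k) (at z) v - Y *v bv k) = 0" by (simp add: coord_linear)
      qed
    qed
    have "Y *v s z = (\<Sum>k\<in>I. c k *s (Y *v bv k))" by (simp add: sz mat_vec_linear)
    then have e: "frechet_derivative s (at z) v - Y *v s z =
       (frechet_derivative s (at z) v - (\<Sum>k\<in>I. c k *s frechet_derivative (t k) (at z) v))
       + (\<Sum>k\<in>I. c k *s (frechet_derivative (t k) (at z) v - Y *v bv k))"
      by (simp add: vec.scale_right_diff_distrib sum_subtractf)
    show ?thesis unfolding e by (rule vec.subspace_add[OF Fil_subspace 1 2])
  qed
  then show ?thesis using tan unfolding velocity_def by blast
qed

lemma differential_velocity:
  assumes "z \<in> W"
  shows "velocity z v (differential Q W \<phi> z v)"
proof -
  have e: "differential Q W \<phi> z v = (THE Y. velocity z v Y)"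
    by (simp add: differential_def velocity_def)
  obtain Y where Y: "velocity z v Y" using velocity_exists[OF assms] by blast
  show ?thesis unfolding e by (rule theI[of "velocity z v" Y, OF Y]) (rule velocity_unique[OF assms _ Y])
qed

lemma differential_horizontal:
  assumes "z \<in> W" shows "differential Q W \<phi> z v \<in> horizontal_space Q (\<phi> z)"
  using bspec[OF chart[unfolded horizontal_chart_def, THEN conjunct2, THEN conjunct2, THEN conjunct2] assms]
  by (meson range_subsetD)

lemma differential_section:
  assumes "z \<in> N" "N \<subseteq> W" "hol_section \<phi> p N s" "p \<in> {1..3}"
  shows "frechet_derivative s (at z) v - differential Q W \<phi> z v *v s z \<in> Fil (\<phi> z) p"
  using differential_velocity[of z v] assms unfolding velocity_def by blast

text \<open>The differential is a separate description for each direction, so linearity comes from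
  uniqueness: the combination of the coordinate velocities has the defining property.\<close>

lemma differential_linear:
  assumes z: "z \<in> W"
  shows "differential Q W \<phi> z v *v u = (\<Sum>i\<in>UNIV. v $ i *s (differential Q W \<phi> z (axis i 1) *v u))"
proof -
  define Y where "Y = (\<chi> a b. \<Sum>i\<in>UNIV. v $ i * differential Q W \<phi> z (axis i 1) $ a $ b)"
  have Yu: "Y *v u = (\<Sum>i\<in>UNIV. v $ i *s (differential Q W \<phi> z (axis i 1) *v u))" for u
    by (simp add: Y_def vec_eq_iff matrix_vector_mult_def sum_distrib_right sum_distrib_left mult.assoc) (intro allI sum.swap)
  have t: "differential Q W \<phi> z w \<in> tangent_space Q (\<phi> z)" for w
    using differential_velocity[OF z] by (simp add: velocity_def)
  have "velocity z v Y"
    unfolding velocity_def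
  proof (intro conjI ballI allI impI)
    show "Y \<in> tangent_space Q (\<phi> z)"
      unfolding tangent_space_def mem_Collect_eq
    proof (intro conjI allI impI ballI)
      fix u w
      have "Q (Y *v u) w + Q u (Y *v w) = (\<Sum>i\<in>UNIV. v $ i * (Q (differential Q W \<phi> z (axis i 1) *v u) w + Q u (differential Q W \<phi> z (axis i 1) *v w)))"
        by (simp add: Yu Q_sum Q_left Q_right sum.distrib distrib_left)
      also have "\<dots> = 0" using t by (simp add: tangent_space_def)
      finally show "Q (Y *v u) w + Q u (Y *v w) = 0" .
    next
      fix p u assume "p \<le> 3" "u \<in> \<phi> z p"
      then show "Y *v u \<in> vec.span (\<Union>r\<in>{..<p}. \<phi> z r)"
        unfolding Yu using t by (intro vec.span_sum vec.span_scale) (auto simp: tangent_space_def)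
    qed
    fix p N s assume p: "p \<in> {1..3}" and N: "z \<in> N \<and> N \<subseteq> W \<and> hol_section \<phi> p N s"
    have h: "holo_on s N" "z \<in> N" using N by (auto simp: hol_section_def)
    have lin: "Vector_Spaces.linear (*s) (*s) (frechet_derivative s (at z))"
      by (simp add: Vector_Spaces.linear_iff vec.vector_space_axioms holo_onD[OF h])
    have "v = (\<Sum>i\<in>UNIV. v $ i *s axis i 1)"
      by (simp add: vec_eq_iff axis_def if_distrib cong: if_cong)
    then have "frechet_derivative s (at z) v = frechet_derivative s (at z) (\<Sum>i\<in>UNIV. v $ i *s axis i 1)" by simp
    also have "\<dots> = (\<Sum>i\<in>UNIV. v $ i *s frechet_derivative s (at z) (axis i 1))"
      by (simp add: vec.linear_sum[OF lin] holo_onD(2)[OF h])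
    finally have "frechet_derivative s (at z) v - Y *v s z =
        (\<Sum>i\<in>UNIV. v $ i *s (frechet_derivative s (at z) (axis i 1) - differential Q W \<phi> z (axis i 1) *v s z))"
      by (simp add: Yu sum_subtractf vec.scale_right_diff_distrib)
    also have "\<dots> \<in> Fil (\<phi> z) p"
      using differential_section[OF _ _ _ p] N by (intro vec.subspace_sum vec.subspace_scale Fil_sub z) auto
    finally show "frechet_derivative s (at z) v - Y *v s z \<in> Fil (\<phi> z) p" .
  qed
  then have "differential Q W \<phi> z v = Y" using velocity_unique[OF z differential_velocity[OF z]] by blast
  then show ?thesis by (simp add: Yu)
qed

end

context framed
begin

section \<open>The Weil-Petersson metric and its Ricci form\<close>

lemma sum_frame_index:
  fixes g :: "'n option \<times> bool \<Rightarrow> 'b::comm_monoid_add"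
  shows "(\<Sum>k\<in>UNIV. g k) = g (None, True) + g (None, False) + (\<Sum>i\<in>UNIV. g (Some i, True)) + (\<Sum>i\<in>UNIV. g (Some i, False))"
proof -
  have o: "(\<Sum>a\<in>UNIV. h a) = h None + (\<Sum>i\<in>UNIV. h (Some i))" for h :: "'n option \<Rightarrow> 'b"
  proof -
    have "(\<Sum>a\<in>UNIV. h a) = h None + (\<Sum>a\<in>range Some. h a)"
      unfolding UNIV_option_conv by (subst sum.insert) auto
    then show ?thesis by (simp add: sum.reindex)
  qed
  have "(\<Sum>k\<in>UNIV. g k) = (\<Sum>a\<in>UNIV. \<Sum>b\<in>UNIV. g (a, b))"
    by (simp add: sum.cartesian_product)
  also have "\<dots> = (\<Sum>a\<in>UNIV. g (a, True) + g (a, False))"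
    by (simp add: UNIV_bool add.commute)
  finally show ?thesis by (simp add: o sum.distrib add_ac)
qed

lemma hodge_type_simps:
  "hodge_type (None :: 'n option, True) = 3" "hodge_type (None :: 'n option, False) = 0"
  "hodge_type (Some i, True) = 1" "hodge_type (Some i, False) = 2"
  by (simp_all add: hodge_type_def)

text \<open>For a horizontal vector the entries at \<open>(k, l)\<close> and
  \<open>(flip l, flip k)\<close> agree, so the blocks out of types 3 and 1 give equal sums; the
  sign appears because \<open>herm Q\<close> is negative on type (2,1). The middle block lands in
  type (1,2), where the form is positive.\<close>

lemma trace_cnj_horizontal:
  assumes Y: "Y \<in> horizontal_space Q x" and Z: "Z \<in> horizontal_space Q x"
  shows "trace (Y ** cnj_mat Z) = - 2 * herm Q (Y *v f None) (Z *v f None)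
    + (\<Sum>i\<in>UNIV. herm Q (Y *v bv (Some i, False)) (Z *v bv (Some i, False)))"
proof -
  have hor: "ent Y' k l = 0" if "Y' \<in> horizontal_space Q x" "hodge_type l \<noteq> Suc (hodge_type k)" for Y' k l
    using that unfolding horizontal_iff by blast
  have inf: "infinitesimal Q Y'" if "Y' \<in> horizontal_space Q x" for Y'
    using that unfolding horizontal_iff by blast
  have fl: "ent Y' (flip l) (flip k) = ent Y' k l" if Y': "Y' \<in> horizontal_space Q x" for Y' k l
  proof (cases "hodge_type l = Suc (hodge_type k)")
    case True
    then have "snd l = (\<not> snd k)" by (auto simp: hodge_type_def split: if_splits)
    then show ?thesis using infinitesimal_ent[OF inf[OF Y'], of k l] by (cases "snd k") auto
  next
    case False
    then have "hodge_type (flip k) \<noteq> Suc (hodge_type (flip l))"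
      using hodge_type_le[of k] hodge_type_le[of l] by (auto simp: hodge_type_flip)
    then show ?thesis using hor[OF Y' False] hor[OF Y', of "flip k" "flip l"] by simp
  qed
  define t where "t k l = ent Y k l * cnj (ent Z k l)" for k l
  have t0: "t k l = 0" if "hodge_type l \<noteq> Suc (hodge_type k)" for k l
    using hor[OF Y that] by (simp add: t_def)
  have "trace (Y ** cnj_mat Z) = (\<Sum>k\<in>UNIV. \<Sum>l\<in>UNIV. t k l)"
    unfolding trace_mult_ent t_def by (simp add: ent_cnj_mat fl[OF Z])
  also have "\<dots> = (\<Sum>i\<in>UNIV. t (Some i, False) (None, True)) + (\<Sum>i\<in>UNIV. \<Sum>j\<in>UNIV. t (Some i, True) (Some j, False))
      + (\<Sum>j\<in>UNIV. t (None, False) (Some j, True))"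
    by (simp add: sum_frame_index t0 hodge_type_simps)
  also have "(\<Sum>j\<in>UNIV. t (None, False) (Some j, True)) = (\<Sum>i\<in>UNIV. t (Some i, False) (None, True))"
  proof (intro sum.cong refl)
    fix i :: 'n
    have "flip (None :: 'n option, True) = (None, False)" "flip (Some i, False) = (Some i, True)" by (simp_all add: flip_def)
    then show "t (None, False) (Some i, True) = t (Some i, False) (None, True)"
      unfolding t_def using fl[OF Y, of "(None, True)" "(Some i, False)"] fl[OF Z, of "(None, True)" "(Some i, False)"] by simp
  qed
  finally have 1: "trace (Y ** cnj_mat Z) = 2 * (\<Sum>i\<in>UNIV. t (Some i, False) (None, True)) + (\<Sum>i\<in>UNIV. \<Sum>j\<in>UNIV. t (Some i, True) (Some j, False))"
    by simp
  have h: "herm Q (Y *v bv l) (Z *v bv l) = (\<Sum>k\<in>UNIV. (if snd k then 1 else - 1) * t k l)" for l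
    by (simp add: herm_expand t_def entry_def mult.assoc)
  have "herm Q (Y *v bv (None, True)) (Z *v bv (None, True)) = - (\<Sum>i\<in>UNIV. t (Some i, False) (None, True))"
    unfolding h by (simp add: sum_frame_index t0 hodge_type_simps sum_negf)
  moreover have "bv (None, True) = f None" by (simp add: basis_vec_def)
  moreover have "herm Q (Y *v bv (Some j, False)) (Z *v bv (Some j, False)) = (\<Sum>i\<in>UNIV. t (Some i, True) (Some j, False))" for j
    unfolding h by (simp add: sum_frame_index t0 hodge_type_simps)
  moreover have "(\<Sum>i\<in>UNIV. \<Sum>j\<in>UNIV. t (Some i, True) (Some j, False)) = (\<Sum>j\<in>UNIV. \<Sum>i\<in>UNIV. t (Some i, True) (Some j, False))"
    by (rule sum.swap)
  ultimately show ?thesis using 1 by simp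
qed

lemma herm_H3: "u \<in> x 3 \<Longrightarrow> u = co (None, True) u *s f None"
proof -
  assume "u \<in> x 3"
  then have "co k u = 0" if "hodge_type k \<noteq> 3" for k using that by (simp add: x_eq)
  then have "co k u = co k (co (None, True) u *s bv (None, True))" for k
  proof (cases "k = (None, True)")
    case False
    then have "hodge_type k \<noteq> 3" by (cases k) (auto simp: hodge_type_def split: if_splits)
    then show ?thesis using \<open>\<And>k. hodge_type k \<noteq> 3 \<Longrightarrow> co k u = 0\<close> False by (simp add: coord_linear co_bv)
  qed (simp add: coord_linear co_bv)
  then have "u = co (None, True) u *s bv (None, True)" by (rule co_eqI)
  then show ?thesis by (simp add: basis_vec_def)
qed

lemma Fil_3: "Fil x 3 = x 3"
  unfolding Fil_eq x_eq using hodge_type_le by (metis (no_types, opaque_lifting) le_neq_implies_less less_irrefl)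

lemma herm_f_None: "herm Q (f None) (f None) = 1"
  using co_bv[of "(None, True)" "(None, True)"] by (simp add: coord_def basis_vec_def)

lemma herm_H2_H3: "u \<in> x 2 \<Longrightarrow> w \<in> x 3 \<Longrightarrow> herm Q u w = 0"
proof -
  assume u: "u \<in> x 2" and w: "w \<in> x 3"
  have "co k u * cnj (co k w) = 0" for k
    using u w by (cases "hodge_type k = 2") (auto simp: x_eq)
  then show ?thesis by (simp only: herm_expand mult.assoc mult_zero_right sum.neutral_const)
qed

lemma horizontal_maps:
  assumes Y: "Y \<in> horizontal_space Q x" and u: "u \<in> x (Suc p)"
  shows "Y *v u \<in> x p"
  unfolding x_eq mem_Collect_eq
proof (intro allI impI)
  fix k :: "'n option \<times> bool" assume k: "hodge_type k \<noteq> p"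
  have "ent Y k l * co l u = 0" for l
  proof (cases "hodge_type l = Suc p")
    case True
    then have "hodge_type l \<noteq> Suc (hodge_type k)" using k by simp
    then have "ent Y k l = 0" using Y unfolding horizontal_iff by blast
    then show ?thesis by simp
  next
    case False then show ?thesis using u by (simp add: x_eq)
  qed
  then show "co k (Y *v u) = 0" by (simp only: co_mult sum.neutral_const)
qed

end

section \<open>The metric expressed through the velocity\<close>

context hodge_chart
begin

abbreviation "vel z i \<equiv> differential Q W \<phi> z (axis i 1)"

definition nonvanishing_section :: "(complex^'n) set \<Rightarrow> (complex^'n \<Rightarrow> complex^'m) \<Rightarrow> bool"
  where "nonvanishing_section N s \<longleftrightarrow> N \<subseteq> W \<and> hol_section \<phi> 3 N s \<and> (\<forall>w\<in>N. s w \<noteq> 0)"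

lemma section_H3:
  assumes "nonvanishing_section N s" "w \<in> N" and f: "hodge_frame Q (\<phi> w) (f :: 'n option \<Rightarrow> complex^'m)"
  shows "\<exists>c. c \<noteq> 0 \<and> s w = c *s f None" "herm Q (s w) (s w) \<notin> \<real>\<^sub>\<le>\<^sub>0"
    "complex_of_real (cmod (Q (s w) (cnj_vec (s w)))) = herm Q (s w) (s w)"
proof -
  interpret framed Q "\<phi> w" f by unfold_locales (rule f)
  have "s w \<in> Fil (\<phi> w) 3" "s w \<noteq> 0" using assms(1,2) by (auto simp: nonvanishing_section_def hol_section_def)
  then obtain c where c: "s w = c *s f None" unfolding Fil_3 using herm_H3 by blast
  then have c0: "c \<noteq> 0" using \<open>s w \<noteq> 0\<close> by auto
  then show "\<exists>c. c \<noteq> 0 \<and> s w = c *s f None" using c by blast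
  have h: "herm Q (s w) (s w) = complex_of_real ((cmod c)\<^sup>2)"
    by (simp only: c herm_left herm_right herm_f_None mult_1_right) (simp add: complex_mult_cnj cmod_power2 mult.commute)
  then show "herm Q (s w) (s w) \<notin> \<real>\<^sub>\<le>\<^sub>0" using c0 by (simp add: complex_nonpos_Reals_iff del: of_real_power)
  have "Q (s w) (cnj_vec (s w)) = \<i> * herm Q (s w) (s w)" by (simp add: herm_def)
  then have "cmod (Q (s w) (cnj_vec (s w))) = cmod (herm Q (s w) (s w))" by (simp add: norm_mult)
  then show "complex_of_real (cmod (Q (s w) (cnj_vec (s w)))) = herm Q (s w) (s w)"
    unfolding h by (simp only: norm_of_real abs_power2 power_abs abs_norm_cancel)
qed

text \<open>The mixed second derivative of minus the logarithm of \<open>herm Q (s w) (s w)\<close>,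
  written out with the holomorphic derivatives of \<open>s\<close>.\<close>

definition gram_WP :: "(complex^'n \<Rightarrow> complex^'m) \<Rightarrow> complex^'n \<Rightarrow> 'n \<Rightarrow> 'n \<Rightarrow> complex"
  where "gram_WP s w i j = (let u = (\<lambda>i. frechet_derivative s (at w) (axis i 1)) in
     - herm Q (u i) (u j) * inverse (herm Q (s w) (s w))
     + herm Q (u i) (s w) * herm Q (s w) (u j) * (inverse (herm Q (s w) (s w)))\<^sup>2)"

lemma levi_log_norm:
  assumes s: "nonvanishing_section N s" and w: "w \<in> N"
  shows "levi (\<lambda>w. complex_of_real (ln (cmod (Q (s w) (cnj_vec (s w)))))) w $ i $ j = - gram_WP s w i j"
proof -
  have N: "open N" "holo_on s N" "N \<subseteq> W" using s by (auto simp: nonvanishing_section_def hol_section_def)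
  define h where "h y = herm Q (s y) (s y)" for y
  define u where "u i y = frechet_derivative s (at y) (axis i 1)" for i y
  have fr: "h y \<notin> \<real>\<^sub>\<le>\<^sub>0" "complex_of_real (ln (cmod (Q (s y) (cnj_vec (s y))))) = ln (h y)" if y: "y \<in> N" for y
  proof -
    obtain f :: "'n option \<Rightarrow> complex^'m" where f: "hodge_frame Q (\<phi> y) f" using frame_ex N(3) y by blast
    show nr: "h y \<notin> \<real>\<^sub>\<le>\<^sub>0" unfolding h_def by (rule section_H3(2)[OF s y f])
    have e: "complex_of_real (cmod (Q (s y) (cnj_vec (s y)))) = h y" unfolding h_def by (rule section_H3(3)[OF s y f])
    then have "cmod (Q (s y) (cnj_vec (s y))) > 0" using nr by (metis norm_le_zero_iff norm_of_real not_less of_real_0 abs_norm_cancel complex_nonpos_Reals_iff Im_complex_of_real Re_complex_of_real)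
    then show "complex_of_real (ln (cmod (Q (s y) (cnj_vec (s y))))) = ln (h y)"
      unfolding e[symmetric] by (simp add: Ln_of_real)
  qed
  have hw: "has_wirt h (\<lambda>i. herm Q (u i y) (s y)) (\<lambda>i. herm Q (s y) (u i y)) y" if "y \<in> N" for y
    unfolding h_def[abs_def] u_def by (rule has_wirt_herm[OF N(2) N(2) that])
  have 1: "has_wirt (\<lambda>w. complex_of_real (ln (cmod (Q (s w) (cnj_vec (s w))))))
      (\<lambda>i. herm Q (u i y) (s y) / h y) (\<lambda>j. herm Q (s y) (u j y) / h y) y" if y: "y \<in> N" for y
    by (rule has_wirt_transform[OF has_wirt_ln[OF hw[OF y] fr(1)[OF y]] N(1) y]) (simp add: fr)
  have hu: "holo_on (u j) N" for j unfolding u_def[abs_def] by (rule holo_on_derivative[OF N(1,2)])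
  have nz: "h w \<noteq> 0" using fr(1)[OF w] by auto
  have 2: "has_wirt (\<lambda>y. herm Q (s y) (u j y) * inverse (h y))
      (\<lambda>i. herm Q (u i w) (u j w) * inverse (h w) + herm Q (s w) (u j w) * - (herm Q (u i w) (s w) / (h w)\<^sup>2))
      (\<lambda>i. herm Q (s w) (frechet_derivative (u j) (at w) (axis i 1)) * inverse (h w) + herm Q (s w) (u j w) * - (herm Q (s w) (u i w) / (h w)\<^sup>2)) w" for j
    by (rule has_wirt_mult[OF _ has_wirt_inverse[OF hw[OF w] nz]])
       (use has_wirt_herm[OF N(2) hu w] in \<open>simp add: u_def\<close>)
  have "levi (\<lambda>w. complex_of_real (ln (cmod (Q (s w) (cnj_vec (s w)))))) w $ i $ j =
    herm Q (u i w) (u j w) * inverse (h w) + herm Q (s w) (u j w) * - (herm Q (u i w) (s w) / (h w)\<^sup>2)"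
    by (rule levi_eqI[OF N(1) w 1]) (use 2 in \<open>simp_all add: divide_inverse\<close>)
  then show ?thesis by (simp add: gram_WP_def Let_def u_def h_def divide_inverse power_inverse)
qed

text \<open>Modulo \<open>F\<^sup>3\<close>, the line spanned by \<open>s w\<close>, the derivative
  is the velocity applied to \<open>s w\<close>, and horizontality puts the latter into type
  (2,1).\<close>

lemma section_derivative:
  assumes s: "nonvanishing_section N s" and w: "w \<in> N"
  shows "\<exists>c. frechet_derivative s (at w) v = differential Q W \<phi> w v *v s w + c *s s w"
    "differential Q W \<phi> w v *v s w \<in> \<phi> w 2" "s w \<in> \<phi> w 3"
proof -
  have sec: "hol_section \<phi> 3 N s" "N \<subseteq> W" using s by (auto simp: nonvanishing_section_def)
  have wW: "w \<in> W" using sec w by blast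
  obtain f :: "'n option \<Rightarrow> complex^'m" where f: "hodge_frame Q (\<phi> w) f" using frame_ex wW by blast
  interpret framed Q "\<phi> w" f by unfold_locales (rule f)
  obtain c where c: "c \<noteq> 0" "s w = c *s f None" using section_H3(1)[OF s w f] by blast
  show s3: "s w \<in> \<phi> w 3" using sec w by (auto simp: hol_section_def Fil_3)
  have "frechet_derivative s (at w) v - differential Q W \<phi> w v *v s w \<in> \<phi> w 3"
    using differential_section[OF w sec(2,1)] by (simp add: Fil_3)
  then have "frechet_derivative s (at w) v - differential Q W \<phi> w v *v s w = (co (None, True) (frechet_derivative s (at w) v - differential Q W \<phi> w v *v s w) / c) *s s w"
    using herm_H3 c by simp
  then show "\<exists>c. frechet_derivative s (at w) v = differential Q W \<phi> w v *v s w + c *s s w"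
    by (metis add.commute diff_add_cancel)
  show "differential Q W \<phi> w v *v s w \<in> \<phi> w 2"
    by (rule horizontal_maps[OF differential_horizontal[OF wW]]) (use s3 in \<open>simp add: numeral_3_eq_3 numeral_2_eq_2\<close>)
qed

text \<open>The multiples of \<open>s\<close> in the derivatives cancel between the two summands of
  \<open>gram_WP\<close>. What is left is unchanged when \<open>s\<close> is rescaled.\<close>

lemma gram_WP_velocity:
  assumes s: "nonvanishing_section N s" and w: "w \<in> N"
  shows "gram_WP s w i j = - herm Q (vel w i *v s w) (vel w j *v s w) / herm Q (s w) (s w)"
proof -
  have wW: "w \<in> W" using s w by (auto simp: nonvanishing_section_def)
  obtain f :: "'n option \<Rightarrow> complex^'m" where f: "hodge_frame Q (\<phi> w) f" using frame_ex wW by blast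
  interpret framed Q "\<phi> w" f by unfold_locales (rule f)
  have nz: "herm Q (s w) (s w) \<noteq> 0" using section_H3(2)[OF s w f] by auto
  have "\<forall>i. \<exists>c. frechet_derivative s (at w) (axis i 1) = vel w i *v s w + c *s s w"
    using section_derivative(1)[OF s w] by blast
  from choice[OF this] obtain c where "\<forall>i. frechet_derivative s (at w) (axis i 1) = vel w i *v s w + c i *s s w"
    by blast
  note c = spec[OF this]
  have o: "herm Q (vel w i *v s w) (s w) = 0" "herm Q (s w) (vel w i *v s w) = 0" for i
    using herm_H2_H3[OF section_derivative(2,3)[OF s w]] herm_cnj[of "s w" "vel w i *v s w"] by auto
  show ?thesis
    using nz by (simp add: gram_WP_def Let_def c herm_left herm_right o power2_eq_square field_simps)
qed

text \<open>\<open>wp_coeff\<close> chooses a section anew at every point. Before the metric can be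
  differentiated, these choices must be replaced by one section on all of \<open>N\<close>;
  independence of scale makes that possible.\<close>

lemma wp_coeff_eq:
  assumes s: "nonvanishing_section N s" and w: "w \<in> N"
  shows "wp_coeff Q W \<phi> w $ i $ j = gram_WP s w i j"
proof -
  define t where "t = local_Omega W \<phi> w"
  have "\<exists>\<Omega> N. w \<in> N \<and> N \<subseteq> W \<and> hol_section \<phi> 3 N \<Omega> \<and> (\<forall>w\<in>N. \<Omega> w \<noteq> 0)"
    using s w unfolding nonvanishing_section_def by blast
  then have "\<exists>N. w \<in> N \<and> N \<subseteq> W \<and> hol_section \<phi> 3 N t \<and> (\<forall>w\<in>N. t w \<noteq> 0)"
    unfolding t_def local_Omega_def by (rule someI_ex)
  then obtain M where M: "nonvanishing_section M t" "w \<in> M" unfolding nonvanishing_section_def by blast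
  have wW: "w \<in> W" using s w by (auto simp: nonvanishing_section_def)
  obtain f :: "'n option \<Rightarrow> complex^'m" where f: "hodge_frame Q (\<phi> w) f" using frame_ex wW by blast
  obtain a b where ab: "a \<noteq> 0" "b \<noteq> 0" "s w = a *s f None" "t w = b *s f None"
    using section_H3(1)[OF s w f] section_H3(1)[OF M f] by blast
  have "wp_coeff Q W \<phi> w $ i $ j = gram_WP t w i j"
    by (simp add: wp_coeff_def Let_def t_def[symmetric] levi_log_norm[OF M])
  also have "\<dots> = gram_WP s w i j"
    unfolding gram_WP_velocity[OF M] gram_WP_velocity[OF s w] ab mat_vec_linear herm_left herm_right
    using ab(1,2) by simp
  finally show ?thesis .
qed

text \<open>Any section \<open>t\<close> with \<open>t z = f None\<close> is divided by
  \<open>herm Q (t w) (f None)\<close>, which is holomorphic because its second argument is fixed,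
  equals \<open>1\<close> at \<open>z\<close>, and is nonzero nearby.\<close>

lemma normalized_section_exists:
  assumes z: "z \<in> W" and f: "hodge_frame Q (\<phi> z) (f :: 'n option \<Rightarrow> complex^'m)"
  shows "\<exists>N s. z \<in> N \<and> nonvanishing_section N s \<and> s z = f None \<and> (\<forall>w\<in>N. herm Q (s w) (f None) = 1)"
proof -
  interpret framed Q "\<phi> z" f by unfold_locales (rule f)
  have "f None \<in> Fil (\<phi> z) 3"
    using bv_mem[of "(None, True)"] by (simp add: Fil_3 basis_vec_def hodge_type_def)
  then have "\<exists>N s. z \<in> N \<and> N \<subseteq> W \<and> hol_section \<phi> 3 N s \<and> s z = f None"
    by (intro section_exists[OF z]) auto
  then obtain M t where t: "z \<in> M" "M \<subseteq> W" "hol_section \<phi> 3 M t" "t z = f None"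
    by (elim exE conjE)
  have M: "open M" "holo_on t M" using t by (auto simp: hol_section_def)
  define g where "g w = herm Q (t w) (f None)" for w
  have g: "cdiff g w" if "w \<in> M" for w
  proof -
    have "(g has_derivative (\<lambda>v. herm Q (frechet_derivative t (at w) v) (f None))) (at w)"
      unfolding g_def[abs_def]
      by (rule bounded_linear.has_derivative[OF bounded_bilinear.bounded_linear_left[OF bounded_bilinear_herm] holo_onD(1)[OF M(2) that]])
    then show ?thesis unfolding cdiff_def
      by (intro exI[of _ "\<lambda>v. herm Q (frechet_derivative t (at w) v) (f None)"]) (simp add: holo_onD(2)[OF M(2) that] herm_left)
  qed
  define N where "N = {w \<in> M. g w \<noteq> 0}"
  have "continuous_on M g"
    using g cdiffD(1) has_derivative_continuous continuous_at_imp_continuous_on by metis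
  then have No: "open N"
    unfolding N_def using continuous_open_preimage[OF _ M(1), of g "- {0}"] by (simp add: vimage_def Int_def open_Compl)
  have gz: "g z = 1" by (simp add: g_def t(4) herm_f_None)
  define s where "s w = inverse (g w) *s t w" for w
  have NW: "N \<subseteq> W" using t by (auto simp: N_def)
  have "holo_on s N"
    unfolding s_def[abs_def]
    by (rule holo_on_smult) (use g M in \<open>auto simp: N_def intro!: cdiff_inverse intro: holo_on_subset\<close>)
  moreover have "s w \<in> Fil (\<phi> w) 3" if "w \<in> N" for w
    unfolding s_def using t that NW by (intro vec.subspace_scale Fil_sub) (auto simp: N_def hol_section_def)
  moreover have "herm Q (s w) (f None) = 1" if "w \<in> N" for w
    using that by (simp add: s_def herm_left N_def g_def[symmetric])
  moreover then have "s w \<noteq> 0" if "w \<in> N" for w using that by (metis herm_left(5) zero_neq_one)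
  moreover have "s z = f None" by (simp add: s_def gz t(4))
  moreover have "z \<in> N" using t gz by (simp add: N_def)
  ultimately show ?thesis using No NW unfolding nonvanishing_section_def hol_section_def by blast
qed

end

section \<open>The Ricci form at the centre of a normalised section\<close>

context hodge_chart
begin

text \<open>The pairing with the fixed vector \<open>f None\<close> commutes with differentiation
  and is constant along \<open>s\<close>, so the first and second derivatives have no component
  along \<open>f None\<close>.\<close>

lemma normalized_section_derivatives:
  assumes s: "nonvanishing_section N s" and z: "z \<in> N" and f: "hodge_frame Q (\<phi> z) (f :: 'n option \<Rightarrow> complex^'m)"
    and n1: "\<And>w. w \<in> N \<Longrightarrow> herm Q (s w) (f None) = 1" and w: "w \<in> N"
  shows "herm Q (frechet_derivative s (at w) v) (f None) = 0"
    "herm Q (frechet_derivative (\<lambda>y. frechet_derivative s (at y) v) (at w) v') (f None) = 0"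
proof -
  have N: "open N" "holo_on s N" using s by (auto simp: nonvanishing_section_def hol_section_def)
  have const: "herm Q (frechet_derivative t (at w) v) (f None) = 0"
    if t: "holo_on t N" and c: "\<And>y. y \<in> N \<Longrightarrow> herm Q (t y) (f None) = c" and w: "w \<in> N" for t c v w
  proof -
    have "((\<lambda>y. herm Q (t y) (f None)) has_derivative (\<lambda>v. herm Q (frechet_derivative t (at w) v) (f None))) (at w)"
      by (rule bounded_linear.has_derivative[OF bounded_bilinear.bounded_linear_left[OF bounded_bilinear_herm] holo_onD(1)[OF t w]])
    then have "((\<lambda>y. c) has_derivative (\<lambda>v. herm Q (frechet_derivative t (at w) v) (f None))) (at w)"
      by (rule has_derivative_transform_within_open[OF _ N(1) w c])
    then have "(\<lambda>v. herm Q (frechet_derivative t (at w) v) (f None)) = (\<lambda>v. 0)"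
      using has_derivative_unique has_derivative_const by blast
    then show ?thesis by (rule fun_cong)
  qed
  show "herm Q (frechet_derivative s (at w) v) (f None) = 0" by (rule const[OF N(2) n1 w])
  show "herm Q (frechet_derivative (\<lambda>y. frechet_derivative s (at y) v) (at w) v') (f None) = 0"
    by (rule const[OF holo_on_derivative[OF N] _ w]) (rule const[OF N(2) n1])
qed

lemma wp_coeff_hermitian:
  assumes s: "nonvanishing_section N s" and w: "w \<in> N"
  shows "wp_coeff Q W \<phi> w $ j $ i = cnj (wp_coeff Q W \<phi> w $ i $ j)"
  unfolding wp_coeff_eq[OF s w] gram_WP_velocity[OF s w]
  using herm_cnj[of "vel w j *v s w" "vel w i *v s w"] herm_cnj[of "s w" "s w"] by simp

text \<open>Jacobi's formula applied to the metric. The first derivatives are kept on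
  \<open>N\<close> and evaluated at \<open>z\<close> only after the second differentiation; there
  the normalisation makes the products of derivatives of \<open>s\<close> with \<open>s\<close>
  itself vanish.\<close>

lemma ricci_wp_coeff:
  assumes s: "nonvanishing_section N s" and z: "z \<in> N" and f: "hodge_frame Q (\<phi> z) (f :: 'n option \<Rightarrow> complex^'m)"
    and n1: "\<And>w. w \<in> N \<Longrightarrow> herm Q (s w) (f None) = 1" and sz: "s z = f None"
    and pd: "\<And>w. w \<in> W \<Longrightarrow> positive_definite (wp_coeff Q W \<phi> w)"
    and X: "X ** wp_coeff Q W \<phi> z = mat 1"
  defines "u \<equiv> \<lambda>i w. frechet_derivative s (at w) (axis i 1)"
  defines "v \<equiv> \<lambda>i j. frechet_derivative (u i) (at z) (axis j 1)"
  shows "ricci_coeff (wp_coeff Q W \<phi>) z $ k $ l =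
     trace (X ** (\<chi> i j. - herm Q (v i k) (u j z)) ** X ** (\<chi> i j. - herm Q (u i z) (v j l)))
     - trace (X ** (\<chi> i j. - herm Q (v i k) (v j l) + herm Q (u i z) (u j z) * herm Q (u k z) (u l z)
          + herm Q (u i z) (u l z) * herm Q (u k z) (u j z)))"
    and "wp_coeff Q W \<phi> z $ k $ l = - herm Q (u k z) (u l z)"
proof -
  have N: "open N" "holo_on s N" "N \<subseteq> W" using s by (auto simp: nonvanishing_section_def hol_section_def)
  have hu: "holo_on (u i) N" for i unfolding u_def by (rule holo_on_derivative[OF N(1,2)])
  define v' where "v' i j w = frechet_derivative (u i) (at w) (axis j 1)" for i j w
  define h where "h w = herm Q (s w) (s w)" for w
  define r where "r w = inverse (h w)" for w
  define a where "a i j w = herm Q (u i w) (u j w)" for i j w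
  define b where "b i w = herm Q (u i w) (s w)" for i w
  define c where "c j w = herm Q (s w) (u j w)" for j w
  have nr: "h w \<notin> \<real>\<^sub>\<le>\<^sub>0" if w: "w \<in> N" for w
  proof -
    obtain f' :: "'n option \<Rightarrow> complex^'m" where f': "hodge_frame Q (\<phi> w) f'" using frame_ex N(3) w by blast
    show ?thesis unfolding h_def by (rule section_H3(2)[OF s w f'])
  qed
  have nz: "h w \<noteq> 0" if "w \<in> N" for w using nr[OF that] by auto
  have wh: "has_wirt h (\<lambda>k. b k w) (\<lambda>k. c k w) w" if "w \<in> N" for w
    unfolding h_def[abs_def] b_def c_def u_def by (rule has_wirt_herm[OF N(2) N(2) that])
  have wr: "has_wirt r (\<lambda>k. - (b k w * (r w)\<^sup>2)) (\<lambda>k. - (c k w * (r w)\<^sup>2)) w" if "w \<in> N" for w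
    unfolding r_def[abs_def]
    by (rule has_wirt_cong[OF has_wirt_inverse[OF wh[OF that] nz[OF that]]]) (simp_all add: divide_inverse power_inverse)
  have wa: "has_wirt (a i j) (\<lambda>k. herm Q (v' i k w) (u j w)) (\<lambda>k. herm Q (u i w) (v' j k w)) w" if "w \<in> N" for i j w
    unfolding a_def[abs_def] v'_def by (rule has_wirt_herm[OF hu hu that])
  have wb: "has_wirt (b i) (\<lambda>k. herm Q (v' i k w) (s w)) (\<lambda>k. a i k w) w" if "w \<in> N" for i w
    unfolding b_def[abs_def] v'_def a_def u_def using has_wirt_herm[OF hu N(2) that] by (simp add: u_def)
  have wc: "has_wirt (c j) (\<lambda>k. a k j w) (\<lambda>k. herm Q (s w) (v' j k w)) w" if "w \<in> N" for j w
    unfolding c_def[abs_def] v'_def a_def u_def using has_wirt_herm[OF N(2) hu that] by (simp add: u_def)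
  define G where "G i j w = - (a i j w * r w) + b i w * c j w * (r w * r w)" for i j w
  have G: "wp_coeff Q W \<phi> w $ i $ j = G i j w" if "w \<in> N" for w i j
    by (simp add: wp_coeff_eq[OF s that] gram_WP_def Let_def G_def a_def b_def c_def r_def h_def u_def power2_eq_square)
  \<comment> \<open>\<open>A\<close> and \<open>B\<close> follow the product rule literally, in the
    shape produced by \<open>has_wirt_add\<close>, \<open>has_wirt_uminus\<close> and
    \<open>has_wirt_mult\<close>.\<close>
  define A where "A w k = (\<chi> i j. - (herm Q (v' i k w) (u j w) * r w + a i j w * - (b k w * (r w)\<^sup>2))
      + ((herm Q (v' i k w) (s w) * c j w + b i w * a k j w) * (r w * r w)
        + b i w * c j w * (- (b k w * (r w)\<^sup>2) * r w + r w * - (b k w * (r w)\<^sup>2))))" for w k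
  define B where "B w k = (\<chi> i j. - (herm Q (u i w) (v' j k w) * r w + a i j w * - (c k w * (r w)\<^sup>2))
      + ((a i k w * c j w + b i w * herm Q (s w) (v' j k w)) * (r w * r w)
        + b i w * c j w * (- (c k w * (r w)\<^sup>2) * r w + r w * - (c k w * (r w)\<^sup>2))))" for w k
  have wG: "has_wirt (G i j) (\<lambda>k. A w k $ i $ j) (\<lambda>k. B w k $ i $ j) w" if w: "w \<in> N" for i j w
    unfolding G_def[abs_def] A_def B_def vec_lambda_beta
    by (intro has_wirt_add has_wirt_uminus has_wirt_mult wa wb wc wr w)
  have wM: "has_wirt (\<lambda>y. wp_coeff Q W \<phi> y $ i $ j) (\<lambda>k. A w k $ i $ j) (\<lambda>k. B w k $ i $ j) w" if w: "w \<in> N" for i j w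
    by (rule has_wirt_transform[OF wG[OF w] N(1) w]) (simp add: G)
  have z0: "b i z = 0" "c i z = 0" "h z = 1" "r z = 1" "herm Q (v' i k z) (s z) = 0" for i k
  proof -
    interpret framed Q "\<phi> z" f by unfold_locales (rule f)
    show b0: "b i z = 0" for i
      using normalized_section_derivatives(1)[OF s z f n1 z] by (simp add: b_def u_def sz)
    then show "c i z = 0" using herm_cnj[of "s z" "u i z"] by (simp add: b_def c_def)
    show "h z = 1" by (simp add: h_def sz herm_f_None)
    then show "r z = 1" by (simp add: r_def)
    show "herm Q (v' i k z) (s z) = 0"
      using normalized_section_derivatives(2)[OF s z f n1 z, of "axis i 1" "axis k 1"] by (simp add: v'_def u_def sz)
  qed
  have hv: "holo_on (v' j l) N" for j l
    unfolding v'_def[abs_def] by (rule holo_on_derivative[OF N(1) hu])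
  have wuv: "has_wirt (\<lambda>w. herm Q (u i w) (v' j l w)) (\<lambda>k. herm Q (v' i k z) (v' j l z))
      (\<lambda>k. herm Q (u i z) (frechet_derivative (v' j l) (at z) (axis k 1))) z" for i j l
    using has_wirt_herm[OF hu hv z] by (simp add: v'_def)
  have wsv: "has_wirt (\<lambda>w. herm Q (s w) (v' j l w)) (\<lambda>k. herm Q (u k z) (v' j l z))
      (\<lambda>k. herm Q (s z) (frechet_derivative (v' j l) (at z) (axis k 1))) z" for j l
    using has_wirt_herm[OF N(2) hv z] by (simp add: u_def)
  have dB: "\<exists>D. has_wirt (\<lambda>w. B w l $ i $ j)
      (\<lambda>k. - herm Q (v' i k z) (v' j l z) + a i j z * a k l z + a i l z * a k j z) D z" for l i j
  proof -
    \<comment> \<open>The derivative of \<open>B\<close> is assembled along its syntactic structure.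
      Its holomorphic part simplifies at \<open>z\<close>; the antiholomorphic part is left
      existential and named by choice afterwards.\<close>
    note wrr = has_wirt_mult[OF wr[OF z] wr[OF z]]
    note wcr = has_wirt_uminus[OF has_wirt_mult[OF wc[OF z, of l] wrr]]
    note T = has_wirt_add[OF
      has_wirt_uminus[OF has_wirt_add[OF has_wirt_mult[OF wuv[of i j l] wr[OF z]] has_wirt_mult[OF wa[OF z, of i j] wcr]]]
      has_wirt_add[OF
        has_wirt_mult[OF has_wirt_add[OF has_wirt_mult[OF wa[OF z, of i l] wc[OF z, of j]] has_wirt_mult[OF wb[OF z, of i] wsv[of j l]]] wrr]
        has_wirt_mult[OF has_wirt_mult[OF wb[OF z, of i] wc[OF z, of j]] has_wirt_add[OF has_wirt_mult[OF wcr wr[OF z]] has_wirt_mult[OF wr[OF z] wcr]]]]]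
    show ?thesis
      unfolding B_def vec_lambda_beta power2_eq_square
      apply (rule exI)
      apply (rule has_wirt_cong[OF T])
       apply (simp add: z0 algebra_simps)
      apply (rule refl)
      done
  qed
  define D where "D l i j = (SOME D. has_wirt (\<lambda>w. B w l $ i $ j)
      (\<lambda>k. - herm Q (v' i k z) (v' j l z) + a i j z * a k l z + a i l z * a k j z) D z)" for l i j
  have D: "has_wirt (\<lambda>w. B w l $ i $ j)
      (\<lambda>k. - herm Q (v' i k z) (v' j l z) + a i j z * a k l z + a i l z * a k j z) (D l i j) z" for l i j
    unfolding D_def by (rule someI_ex[OF dB])
  have "levi (\<lambda>w. ln (det (wp_coeff Q W \<phi> w))) z $ k $ l =
     trace (X ** (\<chi> i j. - herm Q (v' i k z) (v' j l z) + a i j z * a k l z + a i l z * a k j z))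
     - trace (X ** A z k ** X ** B z l)"
  proof (rule levi_ln_det[OF N(1) z _ wM _ X, where D = "\<lambda>l k. \<chi> i j. D l i j k"])
    show "det (wp_coeff Q W \<phi> w) \<notin> \<real>\<^sub>\<le>\<^sub>0" if "w \<in> N" for w
      by (rule det_positive[OF pd wp_coeff_hermitian[OF s]]) (use that N(3) in auto)
    show "has_wirt (\<lambda>w. B w l $ i $ j)
       (\<lambda>k. (\<chi> i j. - herm Q (v' i k z) (v' j l z) + a i j z * a k l z + a i l z * a k j z) $ i $ j)
       (\<lambda>k. (\<chi> i j. D l i j k) $ i $ j) z" for l i j
      using D[of l i j] by simp
  qed
  moreover have "A z k = (\<chi> i j. - herm Q (v i k) (u j z))" by (simp add: A_def z0 v_def v'_def)
  moreover have "B z l = (\<chi> i j. - herm Q (u i z) (v j l))" by (simp add: B_def z0 v_def v'_def)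
  ultimately show "ricci_coeff (wp_coeff Q W \<phi>) z $ k $ l =
     trace (X ** (\<chi> i j. - herm Q (v i k) (u j z)) ** X ** (\<chi> i j. - herm Q (u i z) (v j l)))
     - trace (X ** (\<chi> i j. - herm Q (v i k) (v j l) + herm Q (u i z) (u j z) * herm Q (u k z) (u l z)
          + herm Q (u i z) (u l z) * herm Q (u k z) (u j z)))"
    by (simp add: ricci_coeff_def a_def v_def v'_def)
  show "wp_coeff Q W \<phi> z $ k $ l = - herm Q (u k z) (u l z)"
    by (simp add: G[OF z] G_def z0 a_def)
qed

text \<open>The Ricci formula is brought into the frame at \<open>z\<close>. Once the
  (2,1)-components of the second derivatives have cancelled, the inverse metric turns a sum over the
  \<open>u\<^sub>i\<close> into a sum over the unitary frame, as in
  \<open>trace_cnj_horizontal\<close>.\<close>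

lemma wp_ricci_trace:
  assumes z: "z \<in> W" and pd: "\<And>w. w \<in> W \<Longrightarrow> positive_definite (wp_coeff Q W \<phi> w)"
  shows "of_nat (n + 3) * wp_coeff Q W \<phi> z $ k $ l + ricci_coeff (wp_coeff Q W \<phi>) z $ k $ l
    = trace (vel z k ** cnj_mat (vel z l))"
proof -
  obtain f :: "'n option \<Rightarrow> complex^'m" where f: "hodge_frame Q (\<phi> z) f" using frame_ex z by blast
  interpret framed Q "\<phi> z" f by unfold_locales (rule f)
  obtain N s where N: "z \<in> N" "nonvanishing_section N s" "s z = f None" "\<forall>w\<in>N. herm Q (s w) (f None) = 1"
    using normalized_section_exists[OF z f] by (elim exE conjE)
  have hs: "open N" "holo_on s N" "N \<subseteq> W" using N(2) by (auto simp: nonvanishing_section_def hol_section_def)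
  define g where "g = wp_coeff Q W \<phi> z"
  define X where "X = matrix_inv g"
  have "det g \<notin> \<real>\<^sub>\<le>\<^sub>0" unfolding g_def by (rule det_positive[OF pd[OF z] wp_coeff_hermitian[OF N(2,1)]])
  then have "det g \<noteq> 0" by auto
  then have Xg: "X ** g = mat 1" unfolding X_def by (rule matrix_inv_mult(1))
  define u where "u i w = frechet_derivative s (at w) (axis i 1)" for i w
  define v where "v i j = frechet_derivative (u i) (at z) (axis j 1)" for i j
  have n1: "\<And>w. w \<in> N \<Longrightarrow> herm Q (s w) (f None) = 1" using N(4) by blast
  have u0: "herm Q (u i z) (f None) = 0" and v0: "herm Q (v i j) (f None) = 0" for i j
    using normalized_section_derivatives[OF N(2,1) f n1 N(1)] by (simp_all add: u_def[abs_def] v_def)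
  have ric: "ricci_coeff (wp_coeff Q W \<phi>) z $ k $ l =
     trace (X ** (\<chi> i j. - herm Q (v i k) (u j z)) ** X ** (\<chi> i j. - herm Q (u i z) (v j l)))
     - trace (X ** (\<chi> i j. - herm Q (v i k) (v j l) + herm Q (u i z) (u j z) * herm Q (u k z) (u l z)
          + herm Q (u i z) (u l z) * herm Q (u k z) (u j z)))"
    unfolding u_def[abs_def] v_def
    by (rule ricci_wp_coeff(1)[OF N(2,1) f n1 N(3) pd Xg[unfolded g_def]])
  have gh: "g $ i $ j = - herm Q (u i z) (u j z)" for i j
    unfolding u_def g_def
    by (rule ricci_wp_coeff(2)[OF N(2,1) f n1 N(3) pd Xg[unfolded g_def]])
  have uY: "u i z = vel z i *v f None" and uH: "u i z \<in> \<phi> z 2" for i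
  proof -
    obtain c where c: "u i z = vel z i *v s z + c *s s z"
      using section_derivative(1)[OF N(2,1), of "axis i 1"] unfolding u_def by blast
    have Y2: "vel z i *v s z \<in> \<phi> z 2" by (rule section_derivative(2)[OF N(2,1)])
    have "herm Q (vel z i *v s z) (s z) = 0" by (rule herm_H2_H3[OF Y2 section_derivative(3)[OF N(2,1)]])
    then have "c = 0" using u0[of i] unfolding c by (simp add: herm_left N(3) herm_f_None)
    then show "u i z = vel z i *v f None" using c N(3) by simp
    then show "u i z \<in> \<phi> z 2" using Y2 N(3) by simp
  qed
  \<comment> \<open>Horizontality makes the coordinate derivatives of \<open>s\<close> sections of
    \<open>F\<^sup>2\<close> on all of \<open>N\<close>, so their own derivatives are given by the
    velocity modulo \<open>F\<^sup>2\<close>.\<close>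
  have usec: "hol_section \<phi> 2 N (u i)" for i
    unfolding hol_section_def
  proof (intro conjI ballI)
    show "open N" by (rule hs(1))
    show "holo_on (u i) N" unfolding u_def[abs_def] by (rule holo_on_derivative[OF hs(1,2)])
    fix w assume w: "w \<in> N"
    obtain c where c: "u i w = vel w i *v s w + c *s s w"
      using section_derivative(1)[OF N(2) w, of "axis i 1"] unfolding u_def by blast
    have sub: "vec.subspace (Fil (\<phi> w) 2)" using Fil_sub hs(3) w by blast
    have "vel w i *v s w \<in> Fil (\<phi> w) 2" "s w \<in> Fil (\<phi> w) 2"
      unfolding Fil_def
      by (rule vec.span_base, rule UN_I[of 2], simp, rule section_derivative(2)[OF N(2) w])
         (rule vec.span_base, rule UN_I[of 3], simp, rule section_derivative(3)[OF N(2) w])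
    then show "u i w \<in> Fil (\<phi> w) 2"
      unfolding c by (intro vec.subspace_add[OF sub] vec.subspace_scale[OF sub])
  qed
  \<comment> \<open>\<open>U\<close> and \<open>P\<close> hold the coordinates in type (2,1) of the
    first and second derivatives. The velocity does not give \<open>P\<close>, because it controls
    the second derivatives only modulo \<open>F\<^sup>2\<close>.\<close>
  define U where "U = (\<chi> i a. co (Some a, False) (u i z))"
  define P where "P i j a = co (Some a, False) (v i j)" for i j a
  have cu: "co (None, True) (u i z) = 0" "co (None, False) (u i z) = 0" "co (Some a, True) (u i z) = 0"
    "co (Some a, False) (u i z) = U $ i $ a" for i a
    using uH[of i] by (simp_all add: x_eq hodge_type_simps U_def)
  have Y1: "vel z j *v u i z \<in> \<phi> z 1" for i j
    using horizontal_maps[OF differential_horizontal[OF z], of "u i z" 1] uH by (simp add: numeral_2_eq_2)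
  have cY: "co (None, True) (vel z j *v u i z) = 0" "co (None, False) (vel z j *v u i z) = 0"
    "co (Some a, False) (vel z j *v u i z) = 0" for i j a
    using Y1[of j i] by (simp_all add: x_eq hodge_type_simps)
  have cv: "co (None, True) (v i j) = 0" "co (None, False) (v i j) = 0"
    "co (Some a, True) (v i j) = co (Some a, True) (vel z j *v u i z)" "co (Some a, False) (v i j) = P i j a" for i j a
  proof -
    show "co (None, True) (v i j) = 0" using v0 by (simp add: coord_def)
    have "v i j - vel z j *v u i z \<in> Fil (\<phi> z) 2"
      unfolding v_def by (rule differential_section[OF N(1) hs(3) usec]) simp
    then have "co k (v i j) = co k (vel z j *v u i z)" if "hodge_type k < 2" for k
      using that by (simp add: Fil_eq coord_linear)
    from this[of "(None, False)"] this[of "(Some a, True)"]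
    show "co (None, False) (v i j) = 0" "co (Some a, True) (v i j) = co (Some a, True) (vel z j *v u i z)"
      by (simp_all add: hodge_type_simps cY)
  qed (simp add: P_def)
  define V where "V = transpose (cnj_mat U)"
  define Pm where "Pm = (\<chi> i a. P i k a)"
  define R where "R = (\<chi> a j. cnj (P j l a))"
  define Hm where "Hm = (\<chi> i j. herm Q (vel z k *v u i z) (vel z l *v u j z))"
  define K where "K = (\<chi> a b. herm Q (vel z k *v bv (Some a, False)) (vel z l *v bv (Some b, False)))"
  have gU: "g = U ** V"
    by (simp add: vec_eq_iff gh herm_expand sum_frame_index cu matrix_matrix_mult_def V_def transpose_def cnj_mat_def sum_negf)
  \<comment> \<open>\<open>U\<close> and \<open>V\<close> are square because the chart has as many
    coordinates as type (2,1), so a one-sided inverse is two-sided. This removes the factors around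
    \<open>Pm ** R\<close> in the product of first derivatives.\<close>
  have VXU: "V ** X ** U = mat 1"
  proof -
    have "(X ** U) ** V = mat 1" using Xg by (simp add: gU matrix_mul_assoc)
    then have "V ** (X ** U) = mat 1" by (rule matrix_left_right_inverse[THEN iffD1])
    then show ?thesis by (simp only: matrix_mul_assoc)
  qed
  have AB: "(\<chi> i j. - herm Q (v i k) (u j z)) = Pm ** V" "(\<chi> i j. - herm Q (u i z) (v j l)) = U ** R"
    by (simp_all add: vec_eq_iff herm_expand sum_frame_index cu cv matrix_matrix_mult_def V_def Pm_def R_def transpose_def cnj_mat_def sum_negf)
  have hvv: "- herm Q (v i k) (v j l) = - Hm $ i $ j + (Pm ** R) $ i $ j" for i j
    by (simp add: Hm_def herm_expand sum_frame_index cv cY matrix_matrix_mult_def Pm_def R_def sum_negf)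
  define C where "C = (\<chi> i j. - herm Q (v i k) (v j l) + herm Q (u i z) (u j z) * herm Q (u k z) (u l z)
          + herm Q (u i z) (u l z) * herm Q (u k z) (u j z))"
  have trX: "trace (X ** M) = (\<Sum>j\<in>UNIV. \<Sum>i\<in>UNIV. X $ j $ i * M $ i $ j)" for M :: "complex^'n^'n"
    by (simp add: trace_def matrix_matrix_mult_def)
  \<comment> \<open>The term proportional to \<open>g $ i $ j\<close> contributes
    \<open>trace (X ** g) = n\<close>, and the one with exchanged indices one further copy of
    \<open>g $ k $ l\<close>.\<close>
  have "trace (X ** C) = - trace (X ** Hm) + trace (X ** (Pm ** R)) + g $ k $ l * trace (X ** g)
      + (\<Sum>j\<in>UNIV. \<Sum>i\<in>UNIV. X $ j $ i * (g $ i $ l * g $ k $ j))"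
  proof -
    have "C $ i $ j = - Hm $ i $ j + (Pm ** R) $ i $ j + g $ k $ l * g $ i $ j + g $ i $ l * g $ k $ j" for i j
      unfolding C_def vec_lambda_beta hvv by (simp add: gh mult.commute)
    then show ?thesis unfolding trX
      by (simp add: distrib_left right_diff_distrib sum.distrib sum_negf sum_subtractf sum_distrib_left mult_ac)
  qed
  also have "trace (X ** g) = of_nat n" using dim by (simp add: Xg trace_I)
  also have "(\<Sum>j\<in>UNIV. \<Sum>i\<in>UNIV. X $ j $ i * (g $ i $ l * g $ k $ j)) = g $ k $ l"
  proof -
    have "(\<Sum>i\<in>UNIV. X $ j $ i * (g $ i $ l * g $ k $ j)) = (if j = l then g $ k $ j else 0)" for j
    proof -
      have "(\<Sum>i\<in>UNIV. X $ j $ i * (g $ i $ l * g $ k $ j)) = (X ** g) $ j $ l * g $ k $ j"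
        by (simp add: matrix_matrix_mult_def sum_distrib_right mult.assoc)
      then show ?thesis by (simp add: Xg mat_def)
    qed
    then show ?thesis by simp
  qed
  finally have tC: "trace (X ** C) = - trace (X ** Hm) + trace (X ** (Pm ** R)) + of_nat (n + 1) * g $ k $ l"
    by (simp add: algebra_simps)
  have "X ** (Pm ** V) ** X ** (U ** R) = X ** (Pm ** (V ** X ** U) ** R)"
    by (simp only: matrix_mul_assoc)
  then have tAB: "trace (X ** (Pm ** V) ** X ** (U ** R)) = trace (X ** (Pm ** R))" by (simp add: VXU)
  \<comment> \<open>\<open>n + 3\<close> minus the \<open>n + 1\<close> just found leaves
    \<open>2\<close>, and the two traces containing \<open>Pm ** R\<close> cancel.\<close>
  have "of_nat (n + 3) * g $ k $ l + ricci_coeff (wp_coeff Q W \<phi>) z $ k $ l = 2 * g $ k $ l + trace (X ** Hm)"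
    unfolding ric AB tAB C_def[symmetric] tC by (simp add: algebra_simps)
  also have "trace (X ** Hm) = (\<Sum>a\<in>UNIV. K $ a $ a)"
  proof -
    have ue: "u i z = (\<Sum>a\<in>UNIV. U $ i $ a *s bv (Some a, False))" for i
      by (subst expand[of "u i z"]) (simp add: sum_frame_index cu)
    \<comment> \<open>Change of basis from the \<open>u\<^sub>i\<close> to the frame vectors; by
      \<open>VXU\<close> the trace against \<open>X\<close> becomes the plain trace of
      \<open>K\<close>.\<close>
    have "Hm = U ** K ** V"
    proof -
      have "Hm $ i $ j = (U ** K ** V) $ i $ j" for i j
      proof -
        have "Hm $ i $ j = (\<Sum>b\<in>UNIV. \<Sum>a\<in>UNIV. U $ i $ a * (cnj (U $ j $ b) * K $ a $ b))"
          unfolding Hm_def vec_lambda_beta ue[of i] ue[of j]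
          by (simp add: mat_vec_linear herm_left herm_right K_def sum_distrib_left mult.left_commute)
        then show ?thesis
          by (simp add: matrix_matrix_mult_def V_def transpose_def cnj_mat_def sum_distrib_left sum_distrib_right mult_ac)
      qed
      then show ?thesis by (simp add: vec_eq_iff)
    qed
    then have "trace (X ** Hm) = trace ((X ** U ** K) ** V)" by (simp add: matrix_mul_assoc)
    also have "\<dots> = trace (V ** (X ** U ** K))" by (rule trace_mul_sym)
    also have "V ** (X ** U ** K) = (V ** X ** U) ** K" by (simp only: matrix_mul_assoc)
    finally show ?thesis by (simp add: VXU trace_def)
  qed
  also have "2 * g $ k $ l + (\<Sum>a\<in>UNIV. K $ a $ a) = trace (vel z k ** cnj_mat (vel z l))"
    unfolding trace_cnj_horizontal[OF differential_horizontal[OF z] differential_horizontal[OF z]]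
    by (simp add: gh uY K_def)
  finally show ?thesis by (simp add: g_def)
qed

lemma trace_differential:
  assumes z: "z \<in> W"
  shows "trace (differential Q W \<phi> z v ** cnj_mat (differential Q W \<phi> z w)) =
    (\<Sum>i\<in>UNIV. \<Sum>j\<in>UNIV. trace (vel z i ** cnj_mat (vel z j)) * (v $ i * cnj (w $ j)))"
proof -
  have e: "differential Q W \<phi> z v $ a $ b = (\<Sum>i\<in>UNIV. v $ i * vel z i $ a $ b)" for v a b
  proof -
    have c: "(M *v axis b 1) $ a = M $ a $ b" for M :: "complex^'m^'m"
      by (simp add: matrix_vector_mult_def axis_def if_distrib cong: if_cong)
    show ?thesis using arg_cong[OF differential_linear[OF z, of v "axis b 1"], of "\<lambda>u. u $ a"] by (simp add: c)
  qed
  have t: "trace (Y ** cnj_mat Z) = (\<Sum>p\<in>UNIV. Y $ fst p $ snd p * cnj (Z $ snd p $ fst p))" for Y Z :: "complex^'m^'m"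
    by (simp add: trace_def matrix_matrix_mult_def cnj_mat_def sum.cartesian_product case_prod_unfold)
  have "trace (differential Q W \<phi> z v ** cnj_mat (differential Q W \<phi> z w)) =
     (\<Sum>p\<in>UNIV. \<Sum>i\<in>UNIV. \<Sum>j\<in>UNIV. vel z i $ fst p $ snd p * cnj (vel z j $ snd p $ fst p) * (v $ i * cnj (w $ j)))"
    unfolding t e[of v] e[of w] cnj_sum sum_product by (intro sum.cong refl) (simp add: mult_ac)
  also have "\<dots> = (\<Sum>i\<in>UNIV. \<Sum>p\<in>UNIV. \<Sum>j\<in>UNIV. vel z i $ fst p $ snd p * cnj (vel z j $ snd p $ fst p) * (v $ i * cnj (w $ j)))"
    by (rule sum.swap)
  also have "\<dots> = (\<Sum>i\<in>UNIV. \<Sum>j\<in>UNIV. \<Sum>p\<in>UNIV. vel z i $ fst p $ snd p * cnj (vel z j $ snd p $ fst p) * (v $ i * cnj (w $ j)))"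
    by (intro sum.cong refl sum.swap)
  finally show ?thesis unfolding t by (simp only: sum_distrib_right)
qed

text \<open>The trace form is Hermitian in the two directions, so the antisymmetrisation in
  \<open>form11\<close> yields \<open>\<i> / 2\<close> times a number minus its conjugate, that is,
  minus its imaginary part.\<close>

lemma omega_1_trace:
  assumes z: "z \<in> W" and pd: "\<And>w. w \<in> W \<Longrightarrow> positive_definite (wp_coeff Q W \<phi> w)"
  shows "omega_1 n Q W \<phi> z v w =
    complex_of_real (- Im (trace (differential Q W \<phi> z v ** cnj_mat (differential Q W \<phi> z w))))"
proof -
  let ?T = "\<lambda>v w. trace (differential Q W \<phi> z v ** cnj_mat (differential Q W \<phi> z w))"
  have T: "?T v w = (\<Sum>i\<in>UNIV. \<Sum>j\<in>UNIV.
      (of_nat (n + 3) * wp_coeff Q W \<phi> z $ i $ j + ricci_coeff (wp_coeff Q W \<phi>) z $ i $ j) * (v $ i * cnj (w $ j)))" for v w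
    by (simp only: trace_differential[OF z, of v w] wp_ricci_trace[OF z pd])
  have "omega_1 n Q W \<phi> z v w = \<i> / 2 * (?T v w - ?T w v)"
  proof -
    have "omega_1 n Q W \<phi> z v w = (\<Sum>i\<in>UNIV. \<Sum>j\<in>UNIV. \<i> / 2 *
      ((of_nat (n + 3) * wp_coeff Q W \<phi> z $ i $ j + ricci_coeff (wp_coeff Q W \<phi>) z $ i $ j) * (v $ i * cnj (w $ j) - w $ i * cnj (v $ j))))"
      unfolding omega_1_def omega_WP_def Ric_WP_def form11_def sum_distrib_left sum.distrib[symmetric]
      by (intro sum.cong refl) (simp only: distrib_left distrib_right mult_ac)
    moreover have "\<i> / 2 * (?T v w - ?T w v) = (\<Sum>i\<in>UNIV. \<Sum>j\<in>UNIV. \<i> / 2 *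
      ((of_nat (n + 3) * wp_coeff Q W \<phi> z $ i $ j + ricci_coeff (wp_coeff Q W \<phi>) z $ i $ j) * (v $ i * cnj (w $ j) - w $ i * cnj (v $ j))))"
      unfolding T sum_subtractf[symmetric] sum_distrib_left
      by (intro sum.cong refl) (simp only: right_diff_distrib)
    ultimately show ?thesis by simp
  qed
  moreover have "?T w v = cnj (?T v w)"
  proof -
    have "cnj (?T v w) = trace (cnj_mat (differential Q W \<phi> z v ** cnj_mat (differential Q W \<phi> z w)))"
      by (simp add: trace_def cnj_mat_def)
    also have "\<dots> = trace (cnj_mat (differential Q W \<phi> z v) ** differential Q W \<phi> z w)"
      by (simp add: cnj_mat_def matrix_matrix_mult_def)
    also have "\<dots> = ?T w v" by (rule trace_mul_sym)
    finally show ?thesis ..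
  qed
  ultimately show ?thesis by (simp add: complex_eq_iff)
qed

end

theorem theorem3p1:
  fixes n :: nat
    and Q :: "complex^'m \<Rightarrow> complex^'m \<Rightarrow> complex"
    and x\<^sub>0 :: "'m::finite hodge"
    and U :: "'m hodge set"
    and \<A> :: "((complex^'n::finite) set \<times> (complex^'n \<Rightarrow> 'm hodge)) set"
  assumes "CARD('n) = n" and "CARD('m) = 2 * n + 2"
    and "polarization Q"
    and "x\<^sub>0 \<in> classifying_space n Q"
    and "normal_horizontal_slice n Q U \<A>"
  shows "\<exists>c>0. \<forall>(W, \<phi>)\<in>\<A>. \<forall>z\<in>W. \<forall>v w.
    omega_1 n Q W \<phi> z v w = complex_of_real (c * hodge_form Q x\<^sub>0 W \<phi> z v w)"
proof -
  interpret polarized Q by unfold_locales (rule assms(3))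
  obtain f :: "'n option \<Rightarrow> complex^'m" where f: "hodge_frame Q x\<^sub>0 f"
    using hodge_frame_exists[OF assms(4,1)] by blast
  interpret framed Q x\<^sub>0 f by unfold_locales (rule f)
  \<comment> \<open>\<open>CARD('m) + 2\<close> is the ratio of the Killing form to the trace form,
    and \<open>2\<close> arises from lifting a horizontal vector to \<open>Y + cnj_mat Y\<close>.
    The constant depends only on the dimension of \<open>H\<close>, so it serves all charts at
    once.\<close>
  define c where "c = 1 / (2 * (real CARD('m) + 2))"
  have "omega_1 n Q W \<phi> z v w = complex_of_real (c * hodge_form Q x\<^sub>0 W \<phi> z v w)"
    if chart: "(W, \<phi>) \<in> \<A>" and z: "z \<in> W" for W \<phi> z v w
  proof -
    have "horizontal_chart n Q W \<phi>" and pd: "\<And>w. w \<in> W \<Longrightarrow> positive_definite (wp_coeff Q W \<phi> w)"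
      using assms(5) chart unfolding normal_horizontal_slice_def horizontal_slice_def by auto
    then interpret hodge_chart Q n W \<phi> using assms(1) by unfold_locales
    have h: "hodge_form Q x\<^sub>0 W \<phi> z v w =
      - 2 * (real CARD('m) + 2) * Im (trace (differential Q W \<phi> z v ** cnj_mat (differential Q W \<phi> z w)))"
      unfolding hodge_form_def
      by (rule omega_D_horizontal[OF frame_ex[OF z] differential_horizontal[OF z] differential_horizontal[OF z]])
    define K where "K = real CARD('m) + 2"
    have "K \<noteq> 0" unfolding K_def by linarith
    then have "c * hodge_form Q x\<^sub>0 W \<phi> z v w =
      - Im (trace (differential Q W \<phi> z v ** cnj_mat (differential Q W \<phi> z w)))"
      unfolding h[folded K_def] c_def[folded K_def] by simp
    then show ?thesis by (simp only: omega_1_trace[OF z pd])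
  qed
  moreover have "c > 0" by (simp add: c_def add_pos_pos)
  ultimately show ?thesis by blast
qed

end
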